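(* Let $n\ge2$, $q\in\{1,\ldots,n-1\}$ and $\gamma\in\{0,\ldots,q-1\}$. Let $L$ be a random linear subspace with distribution $\nu_q$, and let $E$ be a stochastically independent random affine subspace with distribution $\kappa_{q-\gamma}^{-1}\mu_{n-q+\gamma}$ restricted to $[B^n]_{n-q+\gamma}$. Then the random variable $d(o,E\cap L)$ has the probability density (with respect to Lebesgue measure on $[0,\infty)$) $$f_{n,q,\gamma}(\delta)=(q-\gamma)\frac{\omega_{\gamma+1}\omega_{n-q}}{\omega_{n-(q-\gamma)+1}}\begin{cases}\dfrac{\omega_{n+1}}{\omega_{q+1}\omega_{n-q}}\,\delta^{q-\gamma-1}, & 0\le\delta\le1,\\[2mm] \tfrac12\,\delta^{q-\gamma-1}\,B\big(\delta^{-2};\tfrac{q+1}{2},\tfrac{n-q}{2}\big), & \delta>1.\end{cases}$$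
   Context: $\kappa_k=\pi^{k/2}/\Gamma(k/2+1)$ is the volume of the unit ball $B^k$, $\omega_k=2\pi^{k/2}/\Gamma(k/2)$; $B(x;\alpha,\beta)=\int_0^x t^{\alpha-1}(1-t)^{\beta-1}dt$. $d(o,E)=\inf_{x\in E}\|x\|$. $G(n,k)$ is the Grassmannian of $k$-dimensional linear subspaces of $\mathbb{R}^n$ with $SO_n$-invariant probability measure $\nu_k$; $A(n,k)$ is the space of $k$-dimensional affine subspaces with motion invariant measure $\mu_k(\cdot)=\int_{G(n,k)}\int_{L^\perp}1\{L+x\in\cdot\}\,\lambda_{L^\perp}(dx)\,\nu_k(dL)$. $[B^n]_k=\{E\in A(n,k):E\cap B^n\ne\emptyset\}$; $\kappa_{q-\gamma}^{-1}\mu_{n-q+\gamma}$ restricted to $[B^n]_{n-q+\gamma}$ is a probability measure. *)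

theory Defs
  imports "HOL-Probability.Probability"
begin

text \<open>Volume of the unit ball in R^k and surface area of the unit sphere in R^k.\<close>
definition kappa :: "nat \<Rightarrow> real" where
  "kappa k = pi powr (real k / 2) / Gamma (real k / 2 + 1)"

definition omega :: "nat \<Rightarrow> real" where
  "omega k = 2 * pi powr (real k / 2) / Gamma (real k / 2)"

definition incomplete_beta :: "real \<Rightarrow> real \<Rightarrow> real \<Rightarrow> real" where
  "incomplete_beta x a b = (LBINT t=0..x. t powr (a - 1) * (1 - t) powr (b - 1))"

definition grass :: "nat \<Rightarrow> (real^'n) set set" where
  "grass k = {L. subspace L \<and> dim L = k}"

text \<open>The topology on G(n,k) is the one induced by orthogonal projection matrices.\<close>
definition proj_mat :: "(real^'n) set \<Rightarrow> real^'n^'n" where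
  "proj_mat L = matrix (closest_point L)"

definition grass_space :: "nat \<Rightarrow> (real^'n) set measure" where
  "grass_space k = vimage_algebra (grass k) proj_mat borel"

definition rotation :: "(real^'n \<Rightarrow> real^'n) \<Rightarrow> bool" where
  "rotation f \<longleftrightarrow> orthogonal_transformation f \<and> det (matrix f) = 1"

definition grass_invariant_prob :: "nat \<Rightarrow> (real^'n) set measure \<Rightarrow> bool" where
  "grass_invariant_prob k \<nu> \<longleftrightarrow>
     sets \<nu> = sets (grass_space k) \<and> prob_space \<nu> \<and>
     (\<forall>f. rotation f \<longrightarrow> distr \<nu> (grass_space k) (\<lambda>L. f ` L) = \<nu>)"

definition affgrass :: "nat \<Rightarrow> (real^'n) set set" where
  "affgrass k = {E. affine E \<and> E \<noteq> {} \<and> aff_dim E = int k}"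

text \<open>An affine subspace E = L + x (x in L-perp) is parametrised by (projection matrix of L, x).\<close>
definition aff_param :: "(real^'n) set \<Rightarrow> (real^'n^'n) \<times> (real^'n)" where
  "aff_param E = (let p = closest_point E 0 in (proj_mat ((\<lambda>y. y - p) ` E), p))"

definition affgrass_space :: "nat \<Rightarrow> (real^'n) set measure" where
  "affgrass_space k = vimage_algebra (affgrass k) aff_param borel"

text \<open>Lebesgue measure lambda_V on a linear subspace V: image of Lebesgue measure on R^(dim V)
  under the linear isometry given by an orthonormal basis of V (independent of the choice).\<close>
definition onb :: "(real^'n) set \<Rightarrow> nat \<Rightarrow> real^'n" where
  "onb V = (SOME b. (\<forall>i<dim V. \<forall>j<dim V. b i \<bullet> b j = (if i = j then 1 else 0))
                    \<and> span (b ` {..<dim V}) = V)"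

definition lebesgue_subspace :: "(real^'n) set \<Rightarrow> (real^'n) measure" where
  "lebesgue_subspace V =
     distr (Pi\<^sub>M {..<dim V} (\<lambda>_. lborel)) borel (\<lambda>x. \<Sum>i<dim V. x i *\<^sub>R onb V i)"

definition affgrass_measure :: "nat \<Rightarrow> (real^'n) set measure \<Rightarrow> (real^'n) set measure" where
  "affgrass_measure k \<nu> =
     measure_of (affgrass k) (sets (affgrass_space k))
       (\<lambda>A. \<integral>\<^sup>+ L. (\<integral>\<^sup>+ x. indicator A ((\<lambda>y. y + x) ` L)
                          \<partial>lebesgue_subspace (orthogonal_comp L)) \<partial>\<nu>)"

definition hitting_ball :: "nat \<Rightarrow> (real^'n) set set" where
  "hitting_ball k = {E \<in> affgrass k. E \<inter> cball 0 1 \<noteq> {}}"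

definition f_dens :: "nat \<Rightarrow> nat \<Rightarrow> nat \<Rightarrow> real \<Rightarrow> real" where
  "f_dens n q \<gamma> \<delta> =
     (if \<delta> < 0 then 0
      else real (q - \<gamma>) * (omega (\<gamma> + 1) * omega (n - q) / omega (n - (q - \<gamma>) + 1)) *
        (if \<delta> \<le> 1 then omega (n + 1) / (omega (q + 1) * omega (n - q)) * \<delta> ^ (q - \<gamma> - 1)
         else 1/2 * \<delta> ^ (q - \<gamma> - 1) *
              incomplete_beta (\<delta> powr (-2)) (real (q + 1) / 2) (real (n - q) / 2)))"

end

theory Submission
  imports Defs
begin

text \<open>Write \<open>E = M + x\<close> with \<open>x \<in> M\<^sup>\<bottom>\<close> and \<open>|x| = r\<close>, and let \<open>M' = M + \<real>x\<close>, \<open>V = M' \<inter> L\<close>.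
  Then \<open>E \<inter> L = {y \<in> V. y \<bullet> x = r\<^sup>2}\<close> has distance \<open>r\<^sup>2 / |P x|\<close> from the origin, where \<open>P\<close> is the
  orthogonal projection to \<open>V\<close>. By invariance of the distribution of \<open>L\<close>, the conditional
  distribution of this distance depends only on \<open>r\<close>, so that \<open>x\<close> may be replaced by a random vector
  of \<open>M'\<close> with uniform direction. As almost surely \<open>dim V = \<gamma> + 1\<close>, only the joint distribution of the
  norms of the two components of a random vector in \<open>V\<close> and in the orthogonal complement of \<open>V\<close> in
  \<open>M'\<close>, of dimension \<open>n - q\<close>, matters. Finally \<open>r\<close> has density proportional to \<open>r\<^sup>q\<^sup>-\<^sup>\<gamma>\<^sup>-\<^sup>1\<close> on \<open>[0, 1]\<close>,
  and integrating out \<open>r\<close> leaves an incomplete beta integral.\<close>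

section \<open>Lebesgue measure in polar and orthonormal coordinates\<close>

text \<open>A uniform direction in a subspace is represented by Lebesgue measure on a unit ball, so
  that every average becomes an integral over the whole space, split along orthonormal coordinates.
  The price is one factor \<open>kappa\<close> per ball, carried along and cancelled once it is seen
  to be finite and positive. Two obstacles shape the rest. Measurability in the subspace cannot be
  read off a chosen basis, so it is expressed through the projection matrix: distances of sections
  are infima over closed relations in this matrix, handled by projection along compact balls. And
  general position is not proved for a prescribed subspace: one that is generic for the given
  distribution is constructed, and others are rotated into it. An empty intersection has
  \<open>infdist\<close> 0. It corresponds to a vanishing projection to \<open>V\<close>, which is a
  null event in the averaged integrals.\<close>

lemma kappa_eq_unit_ball_vol: "kappa k = unit_ball_vol (real k)"
  by (simp add: kappa_def unit_ball_vol_def)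

lemma kappa_pos: "kappa k > 0"
  by (simp add: kappa_eq_unit_ball_vol)

lemma emeasure_norm_PiM_le:
  assumes "finite I" "r > 0"
  shows "emeasure (distr (Pi\<^sub>M I (\<lambda>_. lborel)) borel (\<lambda>x. sqrt (\<Sum>i\<in>I. (x i)\<^sup>2))) {..r}
    = ennreal (kappa (card I) * r ^ card I)"
proof -
  have "emeasure (distr (Pi\<^sub>M I (\<lambda>_. lborel)) borel (\<lambda>x. sqrt (\<Sum>i\<in>I. (x i)\<^sup>2))) {..r}
     = emeasure (Pi\<^sub>M I (\<lambda>_. lborel))
        ({f. sqrt (\<Sum>i\<in>I. (f i)\<^sup>2) \<le> r} \<inter> space (Pi\<^sub>M I (\<lambda>_. lborel)))"
    by (subst emeasure_distr) (auto intro!: arg_cong2[where f=emeasure])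
  then show ?thesis
    using emeasure_cball_aux[OF assms] by (simp add: kappa_eq_unit_ball_vol)
qed

lemma nn_integral_ball_PiM:
  assumes "finite I"
  shows "(\<integral>\<^sup>+x. indicator {..1} (sqrt (\<Sum>i\<in>I. (x i)\<^sup>2)) \<partial>Pi\<^sub>M I (\<lambda>_. lborel)) = ennreal (kappa (card I))"
proof -
  have "(\<integral>\<^sup>+x. indicator {..1} (sqrt (\<Sum>i\<in>I. (x i)\<^sup>2)) \<partial>Pi\<^sub>M I (\<lambda>_. lborel))
    = (\<integral>\<^sup>+r. indicator {..1} r \<partial>distr (Pi\<^sub>M I (\<lambda>_. lborel)) borel (\<lambda>x. sqrt (\<Sum>i\<in>I. (x i)\<^sup>2)))"
    by (subst nn_integral_distr) auto
  then show ?thesis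
    using emeasure_norm_PiM_le[OF assms, of 1] by simp
qed

text \<open>Both measures give \<open>{..r}\<close> the ball volume \<open>kappa d * r ^ d\<close>,
  the right one because its density is the derivative of this power. The rays form an
  intersection-stable generator.\<close>

lemma distr_norm_PiM:
  assumes I: "finite I" "I \<noteq> {}"
  shows "distr (Pi\<^sub>M I (\<lambda>_. lborel)) borel (\<lambda>x. sqrt (\<Sum>i\<in>I. (x i)\<^sup>2))
    = density lborel (\<lambda>r. indicator {0<..} r * ennreal (real (card I) * kappa (card I) * r ^ (card I - 1)))"
    (is "?M = ?N")
proof (rule measure_eqI_generator_eq[where E="range atMost" and \<Omega>=UNIV and A="\<lambda>n. {..real n}"])
  define d where "d = card I"
  have d: "d > 0" using I by (simp add: d_def card_gt_0_iff)
  have N: "emeasure ?N {..r} = ennreal (kappa d * r ^ d)" if "r \<ge> 0" for r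
  proof -
    have "emeasure ?N {..r} = (\<integral>\<^sup>+x. indicator {0<..} x * ennreal (real d * kappa d * x ^ (d - 1)) * indicator {..r} x \<partial>lborel)"
      by (subst emeasure_density) (auto simp: d_def)
    also have "\<dots> = (\<integral>\<^sup>+x. ennreal (real d * kappa d * x ^ (d - 1)) * indicator {0..r} x \<partial>lborel)"
      by (intro nn_integral_cong_AE eventually_mono[OF AE_lborel_singleton[of 0]])
         (auto simp: indicator_def)
    also have "\<dots> = ennreal (kappa d * r ^ d - kappa d * 0 ^ d)"
      using that kappa_pos[of d]
      by (intro nn_integral_FTC_Icc) (auto intro!: derivative_eq_intros)
    finally show ?thesis using d by (simp add: zero_power)
  qed
  have Mpos: "emeasure ?M {..r} = ennreal (kappa d * r ^ d)" if "r > 0" for r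
    using emeasure_norm_PiM_le[OF I(1) that] by (simp add: d_def)
  \<comment> \<open>The ball volume formula is for positive radii; the mass of \<open>{..0}\<close>
    is squeezed to 0 by letting \<open>r\<close> tend to 0, where \<open>d > 0\<close> makes
    \<open>r ^ d\<close> vanish.\<close>
  have M0: "emeasure ?M {..0} = 0"
  proof -
    have "emeasure ?M {..0} \<le> 0"
    proof (rule tendsto_lowerbound)
      show "((\<lambda>r. ennreal (kappa d * r ^ d)) \<longlongrightarrow> 0) (at_right 0)"
      proof -
        have "((\<lambda>r. ennreal (kappa d * r ^ d)) \<longlongrightarrow> ennreal (kappa d * 0 ^ d)) (at_right 0)"
          by (intro tendsto_intros)
        then show ?thesis using d by (simp add: zero_power)
      qed
      show "\<forall>\<^sub>F r in at_right 0. emeasure ?M {..0} \<le> ennreal (kappa d * r ^ d)"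
        unfolding eventually_at_right_field
        by (intro exI[of _ 1] conjI allI impI, simp)
           (subst Mpos[symmetric], simp, rule emeasure_mono, auto)
    qed auto
    then show ?thesis by simp
  qed
  show "Int_stable (range atMost :: real set set)"
    by (auto simp: Int_stable_def Int_atMost)
  show "sets ?M = sigma_sets UNIV (range atMost)" "sets ?N = sigma_sets UNIV (range atMost)"
    by (simp_all add: borel_eq_atMost)
  fix X :: "real set" assume "X \<in> range atMost"
  then obtain r where X: "X = {..r}" by auto
  consider "r > 0" | "r = 0" | "r < 0" by linarith
  then show "emeasure ?M X = emeasure ?N X"
  proof cases
    case 1 then show ?thesis using N[of r] Mpos[of r] X by simp
  next
    case 2 then show ?thesis using N[of r] M0 X d by (simp add: zero_power)
  next
    case 3
    have "emeasure ?M {..r} \<le> emeasure ?M {..0}" "emeasure ?N {..r} \<le> emeasure ?N {..0}"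
      using 3 by (auto intro!: emeasure_mono)
    then show ?thesis using N[of 0] M0 X d by (simp add: zero_power)
  qed
next
  show "emeasure ?M {..real n} \<noteq> \<infinity>" for n
  proof -
    have "emeasure ?M {..real n} \<le> emeasure ?M {..real (Suc n)}"
      by (intro emeasure_mono) auto
    also have "\<dots> < \<infinity>"
      by (subst emeasure_norm_PiM_le) (use I in auto)
    finally show ?thesis by simp
  qed
qed (auto intro: real_arch_simple)

lemma nn_integral_norm_PiM:
  assumes I: "finite I" "I \<noteq> {}" and [measurable]: "h \<in> borel_measurable borel"
  shows "(\<integral>\<^sup>+x. h (sqrt (\<Sum>i\<in>I. (x i)\<^sup>2)) \<partial>Pi\<^sub>M I (\<lambda>_. lborel))
    = (\<integral>\<^sup>+r. indicator {0<..} r * ennreal (real (card I) * kappa (card I) * r ^ (card I - 1)) * h r \<partial>lborel)"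
proof -
  have "(\<integral>\<^sup>+x. h (sqrt (\<Sum>i\<in>I. (x i)\<^sup>2)) \<partial>Pi\<^sub>M I (\<lambda>_. lborel))
    = (\<integral>\<^sup>+r. h r \<partial>distr (Pi\<^sub>M I (\<lambda>_. lborel)) borel (\<lambda>x. sqrt (\<Sum>i\<in>I. (x i)\<^sup>2)))"
    by (subst nn_integral_distr) auto
  also have "\<dots> = (\<integral>\<^sup>+r. indicator {0<..} r * ennreal (real (card I) * kappa (card I) * r ^ (card I - 1)) * h r \<partial>lborel)"
    unfolding distr_norm_PiM[OF I] by (subst nn_integral_density) auto
  finally show ?thesis .
qed

section \<open>Haar uniqueness and rotation invariance of Lebesgue measure\<close>

lemma nn_integral_translate:
  fixes M :: "'a::euclidean_space measure"
  assumes "distr M borel ((+) c) = M" and [measurable]: "f \<in> borel_measurable borel"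
    and [measurable_cong]: "sets M = sets borel"
  shows "(\<integral>\<^sup>+x. f (c + x) \<partial>M) = (\<integral>\<^sup>+x. f x \<partial>M)"
proof -
  have "(\<integral>\<^sup>+x. f x \<partial>M) = (\<integral>\<^sup>+x. f x \<partial>distr M borel ((+) c))"
    by (simp add: assms)
  also have "\<dots> = (\<integral>\<^sup>+x. f (c + x) \<partial>M)"
    by (subst nn_integral_distr) auto
  finally show ?thesis ..
qed

text \<open>Uniqueness of Haar measure on a Euclidean space, in the form of Weil's integral identity.\<close>
lemma translation_invariant_exchange:
  fixes M :: "'a::euclidean_space measure"
  assumes M[measurable_cong]: "sets M = sets borel" and "sigma_finite_measure M"
    and inv: "\<And>c. distr M borel ((+) c) = M"
    and f[measurable]: "f \<in> borel_measurable borel" and g[measurable]: "g \<in> borel_measurable borel"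
  shows "(\<integral>\<^sup>+x. f x \<partial>M) * (\<integral>\<^sup>+y. g y \<partial>lborel) = (\<integral>\<^sup>+x. g x \<partial>M) * (\<integral>\<^sup>+y. f (- y) \<partial>lborel)"
proof -
  interpret M: sigma_finite_measure M by fact
  interpret P: pair_sigma_finite M lborel by standard
  have "(\<integral>\<^sup>+x. f x \<partial>M) * (\<integral>\<^sup>+y. g y \<partial>lborel) = (\<integral>\<^sup>+x. (\<integral>\<^sup>+y. f x * g (x + y) \<partial>lborel) \<partial>M)"
    by (simp add: nn_integral_cmult nn_integral_multc[symmetric] nn_integral_translate[OF lborel_distr_plus])
  also have "\<dots> = (\<integral>\<^sup>+y. (\<integral>\<^sup>+x. f x * g (x + y) \<partial>M) \<partial>lborel)"
    by (rule P.Fubini'[symmetric]) measurable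
  \<comment> \<open>The integral over \<open>M\<close> is shifted by \<open>- y\<close>. After
    another exchange the Lebesgue integral is shifted in turn, which separates \<open>f\<close> from
    \<open>g\<close>.\<close>
  also have "\<dots> = (\<integral>\<^sup>+y. (\<integral>\<^sup>+x. f (- y + x) * g x \<partial>M) \<partial>lborel)"
  proof (rule nn_integral_cong)
    fix y
    show "(\<integral>\<^sup>+x. f x * g (x + y) \<partial>M) = (\<integral>\<^sup>+x. f (- y + x) * g x \<partial>M)"
      using nn_integral_translate[OF inv, of "\<lambda>x. f x * g (x + y)" "- y"] by (simp add: M)
  qed
  also have "\<dots> = (\<integral>\<^sup>+x. (\<integral>\<^sup>+y. f (- y + x) * g x \<partial>lborel) \<partial>M)"
    by (rule P.Fubini') measurable
  also have "\<dots> = (\<integral>\<^sup>+x. (\<integral>\<^sup>+y. f (- y) \<partial>lborel) * g x \<partial>M)"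
  proof (rule nn_integral_cong)
    fix x
    have "(\<integral>\<^sup>+y. f (- y + x) * g x \<partial>lborel) = (\<integral>\<^sup>+y. f (- (- x + y)) \<partial>lborel) * g x"
      by (subst nn_integral_multc) (auto simp: add.commute)
    also have "(\<integral>\<^sup>+y. f (- (- x + y)) \<partial>lborel) = (\<integral>\<^sup>+y. f (- y) \<partial>lborel)"
      by (rule nn_integral_translate[OF lborel_distr_plus]) auto
    finally show "(\<integral>\<^sup>+y. f (- y + x) * g x \<partial>lborel) = (\<integral>\<^sup>+y. f (- y) \<partial>lborel) * g x" .
  qed
  also have "\<dots> = (\<integral>\<^sup>+x. g x \<partial>M) * (\<integral>\<^sup>+y. f (- y) \<partial>lborel)"
    by (subst nn_integral_cmult) (auto simp: mult.commute)
  finally show ?thesis .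
qed

lemma emeasure_lborel_cball_pos_finite:
  "emeasure lborel (cball (0::'a::euclidean_space) 1) \<noteq> 0"
  "emeasure lborel (cball (0::'a::euclidean_space) 1) \<noteq> \<top>"
  using emeasure_cball[of 1 "0::'a"] unit_ball_vol_pos[of "real DIM('a)"]
  by (simp_all add: less_imp_neq[symmetric] ennreal_eq_0_iff not_le del: unit_ball_vol_pos)

text \<open>The image of Lebesgue measure is again translation invariant because \<open>f\<close> is
  linear and onto, hence proportional to Lebesgue measure. Balls about the origin are preserved, so
  the factor is 1.\<close>

lemma distr_lborel_orthogonal:
  fixes f :: "'a::euclidean_space \<Rightarrow> 'a"
  assumes f: "orthogonal_transformation f"
  shows "distr lborel borel f = lborel"
proof -
  define M where "M = distr lborel borel f"
  have lin: "linear f" using f by (rule orthogonal_transformation_linear)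
  have [measurable]: "f \<in> borel_measurable borel"
    using lin by (intro borel_measurable_continuous_onI linear_continuous_on) (simp add: linear_conv_bounded_linear)
  have M[measurable_cong, simp]: "sets M = sets borel" by (simp add: M_def)
  have ball: "emeasure M (cball 0 r) = emeasure lborel (cball (0::'a) r)" for r
    unfolding M_def
    by (subst emeasure_distr) (auto intro!: arg_cong2[where f=emeasure] simp: orthogonal_transformation_norm[OF f])
  have "sigma_finite_measure M"
  proof
    show "\<exists>A. countable A \<and> A \<subseteq> sets M \<and> \<Union>A = space M \<and> (\<forall>a\<in>A. emeasure M a \<noteq> \<infinity>)"
    proof (intro exI[of _ "range (\<lambda>n::nat. cball 0 (real n))"] conjI)
      show "\<Union>(range (\<lambda>n::nat. cball 0 (real n))) = space M"
        by (auto simp: M_def real_arch_simple)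
      show "\<forall>a\<in>range (\<lambda>n::nat. cball 0 (real n)). emeasure M a \<noteq> \<infinity>"
        using emeasure_lborel_cball_finite by (auto simp: ball less_top[symmetric])
    qed auto
  qed
  moreover have "distr M borel ((+) c) = M" for c
  proof -
    obtain e where e: "f e = c"
      using orthogonal_transformation_surj[OF f] by (metis surj_def)
    have "distr M borel ((+) c) = distr lborel borel (\<lambda>x. c + f x)"
      unfolding M_def by (subst distr_distr) (auto simp: o_def)
    also have "\<dots> = distr (distr lborel borel ((+) e)) borel f"
      by (subst distr_distr) (auto simp: o_def linear_add[OF lin] e)
    also have "\<dots> = M" by (simp add: lborel_distr_plus M_def)
    finally show ?thesis .
  qed
  ultimately have ex: "(\<integral>\<^sup>+x. h x \<partial>M) * (\<integral>\<^sup>+y. g y \<partial>lborel) = (\<integral>\<^sup>+x. g x \<partial>M) * (\<integral>\<^sup>+y. h (- y) \<partial>lborel)"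
    if "h \<in> borel_measurable borel" "g \<in> borel_measurable borel" for h g
    using that by (intro translation_invariant_exchange) auto
  \<comment> \<open>Lebesgue measure itself is put into the same identity, which eliminates the
    reflected integral of \<open>h (- y)\<close> from \<open>ex\<close>.\<close>
  have ex0: "(\<integral>\<^sup>+x. h x \<partial>lborel) * (\<integral>\<^sup>+y. g y \<partial>lborel) = (\<integral>\<^sup>+x. g x \<partial>lborel) * (\<integral>\<^sup>+y. h (- y) \<partial>lborel)"
    if "h \<in> borel_measurable borel" "g \<in> borel_measurable borel" for h g :: "'a \<Rightarrow> ennreal"
    using that by (intro translation_invariant_exchange) (auto simp: lborel_distr_plus lborel.sigma_finite_measure_axioms)
  have "M = lborel"
  proof (rule measure_eqI)
    fix A assume "A \<in> sets M"
    then have A: "A \<in> sets borel" by simp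
    let ?B = "emeasure lborel (cball (0::'a) 1)"
    have "emeasure M A * ?B = emeasure lborel A * ?B"
      using ex[of "indicator A" "indicator (cball 0 1)"] ex0[of "indicator A" "indicator (cball 0 1)"] A ball[of 1]
      by (simp add: mult.commute borel_measurable_indicator)
    then show "emeasure M A = emeasure lborel A"
      using emeasure_lborel_cball_pos_finite[where 'a='a]
      by (simp add: ennreal_mult_cancel_left mult.commute[of _ ?B])
  qed simp
  then show ?thesis by (simp add: M_def)
qed

section \<open>Orthonormal frames and projections\<close>

definition orthonormal :: "nat \<Rightarrow> (nat \<Rightarrow> 'a::euclidean_space) \<Rightarrow> bool" where
  "orthonormal d b \<longleftrightarrow> (\<forall>i<d. \<forall>j<d. b i \<bullet> b j = (if i = j then 1 else 0))"

lemma orthonormal_inner: "orthonormal d b \<Longrightarrow> i < d \<Longrightarrow> j < d \<Longrightarrow> b i \<bullet> b j = (if i = j then 1 else 0)"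
  by (simp add: orthonormal_def)

lemma orthonormal_mono: "orthonormal d b \<Longrightarrow> e \<le> d \<Longrightarrow> orthonormal e b"
  by (simp add: orthonormal_def)

lemma orthonormal_span_expand:
  assumes "orthonormal d b" "x \<in> span (b ` {..<d})"
  shows "x = (\<Sum>i<d. (x \<bullet> b i) *\<^sub>R b i)"
  using assms(2)
proof (induction rule: span_induct_alt)
  case base then show ?case by simp
next
  case (step c v y)
  then obtain j where j: "j < d" "v = b j" by auto
  have "(\<Sum>i<d. (v \<bullet> b i) *\<^sub>R b i) = (\<Sum>i<d. if i = j then b i else 0)"
    using j by (intro sum.cong) (auto simp: orthonormal_inner[OF assms(1)])
  also have "\<dots> = v" using j by simp
  finally show ?case
    using step.IH by (simp add: inner_add_left scaleR_add_left sum.distrib flip: scaleR_scaleR scaleR_sum_right)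
qed

lemma inner_sum_orthonormal:
  assumes "orthonormal d b" "I \<subseteq> {..<d}" "j < d"
  shows "(\<Sum>i\<in>I. x i *\<^sub>R b i) \<bullet> b j = (if j \<in> I then x j else 0)"
proof -
  have fin: "finite I" using assms(2) finite_subset by blast
  have "(\<Sum>i\<in>I. x i *\<^sub>R b i) \<bullet> b j = (\<Sum>i\<in>I. if i = j then x i else 0)"
    unfolding inner_sum_left using assms
    by (intro sum.cong) (auto simp: orthonormal_inner[OF assms(1)])
  then show ?thesis using fin by simp
qed

lemma norm_sum_orthonormal:
  assumes "orthonormal d b" "I \<subseteq> {..<d}"
  shows "norm (\<Sum>i\<in>I. x i *\<^sub>R b i) = sqrt (\<Sum>i\<in>I. (x i)\<^sup>2)"
proof -
  have "(\<Sum>i\<in>I. x i *\<^sub>R b i) \<bullet> (\<Sum>i\<in>I. x i *\<^sub>R b i) = (\<Sum>j\<in>I. x j * ((\<Sum>i\<in>I. x i *\<^sub>R b i) \<bullet> b j))"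
    by (subst inner_sum_right) simp
  also have "\<dots> = (\<Sum>j\<in>I. (x j)\<^sup>2)"
    using assms(2) by (intro sum.cong) (auto simp: inner_sum_orthonormal[OF assms] power2_eq_square)
  finally show ?thesis by (simp add: norm_eq_sqrt_inner)
qed

lemma orthonormal_dim_span:
  assumes "orthonormal d b"
  shows "dim (span (b ` {..<d})) = d"
proof -
  have inj: "inj_on b {..<d}"
    using orthonormal_inner[OF assms] by (intro inj_onI) (metis lessThan_iff zero_neq_one)
  have "independent (b ` {..<d})"
  proof (rule pairwise_orthogonal_independent)
    show "pairwise orthogonal (b ` {..<d})"
      by (auto simp: pairwise_def orthogonal_def orthonormal_inner[OF assms])
    show "0 \<notin> b ` {..<d}"
      using orthonormal_inner[OF assms] by (metis (no_types, lifting) imageE inner_zero_left lessThan_iff zero_neq_one)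
  qed
  then show ?thesis by (simp add: dim_eq_card_independent card_image[OF inj])
qed

text \<open>Induction on the number of missing vectors: as long as the span is proper in
  \<open>M\<close>, a unit vector of \<open>M\<close> orthogonal to it can be appended. The given
  vectors keep their places, so that a flag of subspaces becomes a chain of initial index segments
  and a prescribed direction can sit at index 0.\<close>

lemma orthonormal_extend:
  fixes b :: "nat \<Rightarrow> 'a::euclidean_space"
  assumes "orthonormal j b" "b ` {..<j} \<subseteq> M" "subspace M" "j \<le> dim M"
  obtains b' where "orthonormal (dim M) b'" "\<And>i. i < j \<Longrightarrow> b' i = b i" "span (b' ` {..<dim M}) = M"
proof -
  have "\<exists>b'. orthonormal (dim M) b' \<and> (\<forall>i<j. b' i = b i) \<and> b' ` {..<dim M} \<subseteq> M"
    using assms(1,2,4)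
  proof (induction "dim M - j" arbitrary: j b)
    case 0
    then show ?case by (intro exI[of _ b]) auto
  next
    case (Suc m)
    have sub: "span (b ` {..<j}) \<subseteq> M"
      using Suc.prems assms(3) by (simp add: span_minimal)
    moreover have "span (b ` {..<j}) \<noteq> M"
      using orthonormal_dim_span[OF Suc.prems(1)] Suc.hyps by auto
    ultimately have "span (b ` {..<j}) \<subset> span M"
      using assms(3) by (simp add: span_eq_iff[THEN iffD2])
    then obtain x where x: "x \<noteq> 0" "x \<in> span M" "\<And>y. y \<in> span (b ` {..<j}) \<Longrightarrow> orthogonal x y"
      using orthogonal_to_subspace_exists_gen by blast
    define v where "v = x /\<^sub>R norm x"
    have v: "v \<in> M" "v \<bullet> v = 1" "\<And>i. i < j \<Longrightarrow> v \<bullet> b i = 0"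
      using x assms(3) span_base[of _ "b ` {..<j}"]
      by (auto simp: v_def span_eq_iff[THEN iffD2] subspace_scale orthogonal_def dot_square_norm power2_eq_square)
    have "orthonormal (Suc j) (b(j := v))"
      using Suc.prems(1) v by (auto simp: orthonormal_def less_Suc_eq inner_commute)
    moreover have "(b(j := v)) ` {..<Suc j} \<subseteq> M"
      using Suc.prems v by (auto simp: less_Suc_eq)
    ultimately obtain b' where "orthonormal (dim M) b'" "\<forall>i<Suc j. b' i = (b(j := v)) i" "b' ` {..<dim M} \<subseteq> M"
      using Suc.hyps(1)[of "Suc j" "b(j := v)"] Suc.hyps(2) by (metis Suc_leI diff_Suc_Suc diff_le_self Suc_diff_Suc diff_Suc_1 zero_less_Suc zero_less_diff)
    then show ?case by (intro exI[of _ b']) auto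
  qed
  then obtain b' where b': "orthonormal (dim M) b'" "\<forall>i<j. b' i = b i" "b' ` {..<dim M} \<subseteq> M" by blast
  have "span (b' ` {..<dim M}) = M"
  proof (rule subspace_dim_equal)
    show "span (b' ` {..<dim M}) \<subseteq> M" using b'(3) assms(3) by (simp add: span_minimal)
    show "dim M \<le> dim (span (b' ` {..<dim M}))" by (subst orthonormal_dim_span[OF b'(1)]) simp
  qed (use assms in auto)
  with b' that show thesis by blast
qed

lemma orthonormal_basis_flag:
  fixes V M :: "'a::euclidean_space set"
  assumes "subspace V" "subspace M" "V \<subseteq> M"
  obtains b where "orthonormal DIM('a) b" "span (b ` {..<dim V}) = V" "span (b ` {..<dim M}) = M"
proof -
  obtain b where b: "orthonormal (dim V) b" "span (b ` {..<dim V}) = V"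
    using orthonormal_extend[of 0 _ V] assms by (auto simp: orthonormal_def)
  have le: "dim V \<le> dim M" "dim M \<le> DIM('a)" using assms by (auto intro: dim_subset dim_subset_UNIV)
  obtain b' where b': "orthonormal (dim M) b'" "\<And>i. i < dim V \<Longrightarrow> b' i = b i" "span (b' ` {..<dim M}) = M"
    using orthonormal_extend[OF b(1), of M] b(2) assms le by (metis span_superset subset_trans)
  obtain b'' where b'': "orthonormal (dim (UNIV::'a set)) b''" "\<And>i. i < dim M \<Longrightarrow> b'' i = b' i"
    using orthonormal_extend[OF b'(1), of UNIV] le by (metis dim_UNIV subset_UNIV subspace_UNIV)
  have "b'' ` {..<dim V} = b ` {..<dim V}" "b'' ` {..<dim M} = b' ` {..<dim M}"
    using b'(2) b''(2) le by (auto intro!: image_cong)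
  then show thesis using that[of b''] b'' b' b by simp
qed

lemma closest_point_subspaceI:
  fixes V :: "'a::euclidean_space set"
  assumes "subspace V" "v \<in> V" "\<And>y. y \<in> V \<Longrightarrow> (z - v) \<bullet> y = 0"
  shows "closest_point V z = v"
proof (rule closest_point_unique[symmetric])
  show "\<forall>y\<in>V. dist z v \<le> dist z y"
  proof
    fix y assume "y \<in> V"
    then have "(z - v) \<bullet> (v - y) = 0" using assms by (simp add: subspace_diff)
    then have "(norm (z - y))\<^sup>2 = (norm (z - v))\<^sup>2 + (norm (v - y))\<^sup>2"
      using norm_add_Pythagorean[of "z - v" "v - y"] by (simp add: orthogonal_def)
    then show "dist z v \<le> dist z y"
      by (simp add: dist_norm power2_le_imp_le)
  qed
qed (use assms in \<open>auto simp: subspace_imp_convex closed_subspace\<close>)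

lemma closest_point_subspace:
  fixes V :: "'a::euclidean_space set"
  assumes "subspace V"
  shows "closest_point V z \<in> V" "\<And>y. y \<in> V \<Longrightarrow> (z - closest_point V z) \<bullet> y = 0"
proof -
  obtain v w where vw: "v \<in> span V" "\<And>y. y \<in> span V \<Longrightarrow> orthogonal w y" "z = v + w"
    using orthogonal_subspace_decomp_exists[of V z] by metis
  then have "closest_point V z = v"
    using assms by (intro closest_point_subspaceI) (auto simp: orthogonal_def span_eq_iff[THEN iffD2])
  then show "closest_point V z \<in> V" "\<And>y. y \<in> V \<Longrightarrow> (z - closest_point V z) \<bullet> y = 0"
    using vw assms by (auto simp: orthogonal_def span_eq_iff[THEN iffD2])
qed

lemma closest_point_orthonormal:
  assumes b: "orthonormal n b" and "d \<le> n"
  shows "closest_point (span (b ` {..<d})) (\<Sum>i<n. x i *\<^sub>R b i) = (\<Sum>i<d. x i *\<^sub>R b i)"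
proof (rule closest_point_subspaceI)
  show "(\<Sum>i<d. x i *\<^sub>R b i) \<in> span (b ` {..<d})"
    by (intro span_sum span_scale span_base) auto
  fix y assume "y \<in> span (b ` {..<d})"
  then show "((\<Sum>i<n. x i *\<^sub>R b i) - (\<Sum>i<d. x i *\<^sub>R b i)) \<bullet> y = 0"
  proof (induction rule: span_induct_alt)
    case (step c v y)
    then show ?case using assms(2)
      by (auto simp: inner_add_right inner_diff_left inner_sum_orthonormal[OF b])
  qed simp
qed simp

text \<open>For the standard basis \<open>e\<close> the measures of boxes determine the image
  measure. A general frame is reached by the orthogonal map taking \<open>e i\<close> to
  \<open>b i\<close>, which preserves Lebesgue measure.\<close>

lemma lborel_eq_distr_orthonormal:
  fixes b :: "nat \<Rightarrow> 'a::euclidean_space"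
  assumes b: "orthonormal DIM('a) b"
  shows "lborel = distr (Pi\<^sub>M {..<DIM('a)} (\<lambda>_. lborel)) borel (\<lambda>x. \<Sum>i<DIM('a). x i *\<^sub>R b i)"
proof -
  let ?n = "DIM('a)" and ?P = "Pi\<^sub>M {..<DIM('a)} (\<lambda>_. lborel::real measure)"
  obtain e where e: "bij_betw e {..<?n} (Basis::'a set)"
    using ex_bij_betw_nat_finite[of "Basis::'a set"] by (auto simp: atLeast0LessThan)
  have eB: "e i \<in> Basis" if "i < ?n" for i using e that by (auto simp: bij_betw_def)
  have e_inj: "e i = e j \<longleftrightarrow> i = j" if "i < ?n" "j < ?n" for i j
    using e that by (auto simp: bij_betw_def inj_on_def)
  have eo: "orthonormal ?n e"
    by (auto simp: orthonormal_def inner_Basis eB e_inj)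
  have "lborel = distr ?P borel (\<lambda>x. \<Sum>i<?n. x i *\<^sub>R e i)"
  proof (rule lborel_eqI)
    fix l u :: 'a assume lu: "\<And>b. b \<in> Basis \<Longrightarrow> l \<bullet> b \<le> u \<bullet> b"
    interpret product_sigma_finite "\<lambda>_. lborel::real measure" by standard
    have "(\<lambda>x. \<Sum>i<?n. x i *\<^sub>R e i) -` box l u \<inter> space ?P
       = (\<Pi>\<^sub>E i\<in>{..<?n}. {l \<bullet> e i<..<u \<bullet> e i})" (is "?A = ?B")
    proof -
      have "(\<Sum>i<?n. x i *\<^sub>R e i) \<in> box l u \<longleftrightarrow> (\<forall>i<?n. l \<bullet> e i < x i \<and> x i < u \<bullet> e i)" for x
      proof -
        have "(\<Sum>i<?n. x i *\<^sub>R e i) \<in> box l u \<longleftrightarrow> (\<forall>v\<in>e ` {..<?n}. l \<bullet> v < (\<Sum>i<?n. x i *\<^sub>R e i) \<bullet> v \<and> (\<Sum>i<?n. x i *\<^sub>R e i) \<bullet> v < u \<bullet> v)"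
          using e by (simp add: mem_box bij_betw_def)
        then show ?thesis by (auto simp: inner_sum_orthonormal[OF eo])
      qed
      then show ?thesis by (auto simp: space_PiM PiE_def Pi_def)
    qed
    then have "emeasure (distr ?P borel (\<lambda>x. \<Sum>i<?n. x i *\<^sub>R e i)) (box l u) = emeasure ?P (\<Pi>\<^sub>E i\<in>{..<?n}. {l \<bullet> e i<..<u \<bullet> e i})"
      by (subst emeasure_distr) auto
    also have "\<dots> = (\<Prod>i<?n. ennreal ((u - l) \<bullet> e i))"
      using lu eB by (subst emeasure_PiM) (auto simp: inner_diff_left)
    also have "\<dots> = (\<Prod>v\<in>Basis. ennreal ((u - l) \<bullet> v))"
      by (rule prod.reindex_bij_betw[OF e])
    also have "\<dots> = ennreal (\<Prod>v\<in>Basis. (u - l) \<bullet> v)"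
      using lu by (intro prod_ennreal) (auto simp: inner_diff_left)
    finally show "emeasure (distr ?P borel (\<lambda>x. \<Sum>i<?n. x i *\<^sub>R e i)) (box l u) = ennreal (\<Prod>v\<in>Basis. (u - l) \<bullet> v)" .
  qed simp
  moreover define f where "f x = (\<Sum>i<?n. (x \<bullet> e i) *\<^sub>R b i)" for x
  have "orthogonal_transformation f"
    unfolding orthogonal_transformation
  proof
    show "linear f" by (rule linearI) (auto simp: f_def inner_add_left scaleR_add_left sum.distrib scaleR_sum_right)
    have "norm (f x) = norm x" for x
    proof -
      have "(\<Sum>i<?n. (x \<bullet> e i)\<^sup>2) = (\<Sum>v\<in>Basis. (x \<bullet> v)\<^sup>2)" by (rule sum.reindex_bij_betw[OF e])
      then show ?thesis
        unfolding f_def norm_sum_orthonormal[OF b order_refl] by (simp add: euclidean_dist_l2[of x 0, simplified] L2_set_def)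
    qed
    then show "\<forall>v. norm (f v) = norm v" by blast
  qed
  then have "distr lborel borel f = lborel" and [measurable]: "f \<in> borel_measurable borel"
    by (auto intro!: distr_lborel_orthogonal borel_measurable_continuous_onI linear_continuous_on orthogonal_transformation_linear simp: linear_conv_bounded_linear[symmetric])
  ultimately have "lborel = distr ?P borel (\<lambda>x. f (\<Sum>i<?n. x i *\<^sub>R e i))"
    using distr_distr[of f borel borel "\<lambda>x. \<Sum>i<?n. x i *\<^sub>R e i" ?P] by (simp add: o_def)
  also have "(\<lambda>x. f (\<Sum>i<?n. x i *\<^sub>R e i)) = (\<lambda>x. \<Sum>i<?n. x i *\<^sub>R b i)"
    unfolding f_def by (intro ext sum.cong) (auto simp: inner_sum_orthonormal[OF eo])
  finally show ?thesis .
qed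

section \<open>Integrals in coordinates adapted to subspaces\<close>

lemma nn_integral_PiM_split:
  fixes d n :: nat
  assumes [measurable]: "h \<in> borel_measurable (Pi\<^sub>M {..<n} (\<lambda>_. lborel))" and "d \<le> n"
  shows "(\<integral>\<^sup>+x. h x \<partial>Pi\<^sub>M {..<n} (\<lambda>_. lborel))
    = (\<integral>\<^sup>+x. (\<integral>\<^sup>+y. h (merge {..<d} {d..<n} (x, y)) \<partial>Pi\<^sub>M {d..<n} (\<lambda>_. lborel)) \<partial>Pi\<^sub>M {..<d} (\<lambda>_. lborel::real measure))"
proof -
  interpret product_sigma_finite "\<lambda>_. lborel::real measure" by standard
  have I: "{..<d} \<union> {d..<n} = {..<n}" using assms(2) by auto
  have "{..<d} \<inter> {d..<n} = {}" by auto
  from product_nn_integral_fold[OF this _ _ , of h] show ?thesis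
    by (simp add: I)
qed

lemma sum_merge_lt: "(\<Sum>i<(d::nat). g (merge {..<d} {d..<n} (x, y) i) i) = (\<Sum>i<d. g (x i) i)"
  by (intro sum.cong) (auto simp: merge_def)

lemma sum_merge_ge: "(\<Sum>i=d..<(n::nat). g (merge {..<d} {d..<n} (x, y) i) i) = (\<Sum>i=d..<n. g (y i) i)"
  by (intro sum.cong) (auto simp: merge_def)

lemma sum_lt_split: "(d::nat) \<le> n \<Longrightarrow> (\<Sum>i<n. g i) = (\<Sum>i<d. g i) + (\<Sum>i=d..<n. (g i::'a::ab_group_add))"
  by (metis atLeast0LessThan le0 sum.atLeastLessThan_concat)

lemma nn_integral_lborel_orthonormal:
  fixes b :: "nat \<Rightarrow> 'a::euclidean_space"
  assumes b: "orthonormal DIM('a) b" and [measurable]: "h \<in> borel_measurable borel" and d: "d \<le> DIM('a)"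
  shows "(\<integral>\<^sup>+z. h z \<partial>lborel)
    = (\<integral>\<^sup>+x. (\<integral>\<^sup>+y. h ((\<Sum>i<d. x i *\<^sub>R b i) + (\<Sum>i=d..<DIM('a). y i *\<^sub>R b i))
        \<partial>Pi\<^sub>M {d..<DIM('a)} (\<lambda>_. lborel)) \<partial>Pi\<^sub>M {..<d} (\<lambda>_. lborel))"
proof -
  have "(\<integral>\<^sup>+z. h z \<partial>lborel) = (\<integral>\<^sup>+x. h (\<Sum>i<DIM('a). x i *\<^sub>R b i) \<partial>Pi\<^sub>M {..<DIM('a)} (\<lambda>_. lborel))"
    by (subst lborel_eq_distr_orthonormal[OF b], subst nn_integral_distr) auto
  also have "\<dots> = (\<integral>\<^sup>+x. (\<integral>\<^sup>+y. h ((\<Sum>i<d. x i *\<^sub>R b i) + (\<Sum>i=d..<DIM('a). y i *\<^sub>R b i))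
        \<partial>Pi\<^sub>M {d..<DIM('a)} (\<lambda>_. lborel)) \<partial>Pi\<^sub>M {..<d} (\<lambda>_. lborel))"
    using d
    by (subst nn_integral_PiM_split[where d=d])
       (auto simp: sum_lt_split[OF d] sum_merge_lt[where g="\<lambda>c i. c *\<^sub>R b i"] sum_merge_ge[where g="\<lambda>c i. c *\<^sub>R b i"])
  finally show ?thesis .
qed

lemma onb_props:
  fixes V :: "(real^'n) set"
  assumes "subspace V"
  shows "orthonormal (dim V) (onb V)" "span (onb V ` {..<dim V}) = V"
proof -
  obtain b where "orthonormal (dim V) b" "span (b ` {..<dim V}) = V"
    using orthonormal_extend[of 0 _ V] assms by (auto simp: orthonormal_def)
  then have "\<exists>b. (\<forall>i<dim V. \<forall>j<dim V. b i \<bullet> b j = (if i = j then 1 else 0)) \<and> span (b ` {..<dim V}) = V"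
    unfolding orthonormal_def by blast
  from someI_ex[OF this] show "orthonormal (dim V) (onb V)" "span (onb V ` {..<dim V}) = V"
    by (simp_all add: onb_def[symmetric] orthonormal_def)
qed

text \<open>Fubini in a frame that extends \<open>onb V\<close>: the additional coordinates run over
  the unit ball of the orthogonal complement and contribute its volume. On the right no basis is
  left, only the projection to \<open>V\<close>.\<close>

lemma nn_integral_lebesgue_subspace:
  fixes V :: "(real^'n) set"
  assumes V: "subspace V" and [measurable]: "h \<in> borel_measurable borel" "closest_point V \<in> borel_measurable borel"
  shows "(\<integral>\<^sup>+x. h x \<partial>lebesgue_subspace V) * ennreal (kappa (CARD('n) - dim V))
    = (\<integral>\<^sup>+z. h (closest_point V z) * indicator {..1} (norm (z - closest_point V z)) \<partial>lborel)"
proof -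
  let ?n = "CARD('n)" and ?d = "dim V"
  have le: "?d \<le> ?n" using dim_subset_UNIV[of V] by simp
  obtain b where b: "orthonormal ?n b" "\<And>i. i < ?d \<Longrightarrow> b i = onb V i"
    using orthonormal_extend[OF onb_props(1)[OF V], of UNIV] le by (metis DIM_cart DIM_real dim_UNIV mult.right_neutral subset_UNIV subspace_UNIV)
  have bV: "span (b ` {..<?d}) = V"
    using onb_props(2)[OF V] b(2) by (metis image_cong lessThan_iff)
  have "(\<integral>\<^sup>+z. h (closest_point V z) * indicator {..1} (norm (z - closest_point V z)) \<partial>lborel)
    = (\<integral>\<^sup>+x. (\<integral>\<^sup>+y. h (\<Sum>i<?d. x i *\<^sub>R b i) * indicator {..1} (sqrt (\<Sum>i=?d..<?n. (y i)\<^sup>2))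
        \<partial>Pi\<^sub>M {?d..<?n} (\<lambda>_. lborel)) \<partial>Pi\<^sub>M {..<?d} (\<lambda>_. lborel))"
  proof -
    have "closest_point V ((\<Sum>i<?d. x i *\<^sub>R b i) + (\<Sum>i=?d..<?n. y i *\<^sub>R b i)) = (\<Sum>i<?d. x i *\<^sub>R b i)" for x y
      using closest_point_orthonormal[OF b(1) le, of "merge {..<?d} {?d..<?n} (x, y)"]
      by (simp add: bV sum_lt_split[OF le] sum_merge_lt[where g="\<lambda>c i. c *\<^sub>R b i"] sum_merge_ge[where g="\<lambda>c i. c *\<^sub>R b i"])
    moreover have "norm (\<Sum>i=?d..<?n. y i *\<^sub>R b i) = sqrt (\<Sum>i=?d..<?n. (y i)\<^sup>2)" for y
      by (rule norm_sum_orthonormal[OF b(1)]) auto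
    ultimately show ?thesis
      using b(1) le by (subst nn_integral_lborel_orthonormal[of b, where d="?d"]) auto
  qed
  also have "\<dots> = (\<integral>\<^sup>+x. h (\<Sum>i<?d. x i *\<^sub>R b i) * ennreal (kappa (?n - ?d)) \<partial>Pi\<^sub>M {..<?d} (\<lambda>_. lborel))"
    by (subst nn_integral_cmult) (auto simp: nn_integral_ball_PiM)
  also have "\<dots> = (\<integral>\<^sup>+x. h (\<Sum>i<?d. x i *\<^sub>R b i) \<partial>Pi\<^sub>M {..<?d} (\<lambda>_. lborel)) * ennreal (kappa (?n - ?d))"
    by (rule nn_integral_multc) measurable
  also have "(\<integral>\<^sup>+x. h (\<Sum>i<?d. x i *\<^sub>R b i) \<partial>Pi\<^sub>M {..<?d} (\<lambda>_. lborel)) = (\<integral>\<^sup>+x. h x \<partial>lebesgue_subspace V)"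
    unfolding lebesgue_subspace_def
    by (subst nn_integral_distr) (auto simp: b(2))
  finally show ?thesis ..
qed

text \<open>The factor of polar coordinates in dimension \<open>d\<close>: for positive
  \<open>d\<close>, \<open>real d * kappa d\<close> is the sphere area \<open>omega d\<close>. The
  indicator removes negative \<open>r\<close>, where the power need not vanish.\<close>

definition radial_weight :: "nat \<Rightarrow> real \<Rightarrow> ennreal" where
  "radial_weight d r = indicator {0<..} r * ennreal (real d * kappa d * r ^ (d - 1))"

lemma radial_weight_measurable[measurable]: "radial_weight d \<in> borel_measurable borel"
  unfolding radial_weight_def[abs_def] by measurable

text \<open>In a frame adapted to the flag, \<open>z\<close> falls into three blocks of coordinates.
  The first two enter only through their norms and give one polar factor each; the third is confined
  to the unit ball and gives \<open>kappa\<close>.\<close>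

lemma nn_integral_norm_flag:
  fixes V M :: "'a::euclidean_space set"
  assumes VM: "subspace V" "subspace M" "V \<subseteq> M" and dims: "0 < dim V" "dim V < dim M"
    and [measurable]: "case_prod H \<in> borel_measurable (borel \<Otimes>\<^sub>M borel)"
      "closest_point V \<in> borel_measurable borel" "closest_point M \<in> borel_measurable borel"
  shows "(\<integral>\<^sup>+z. H (norm (closest_point V z)) (norm (closest_point M z - closest_point V z))
             * indicator {..1} (norm (z - closest_point M z)) \<partial>lborel)
    = ennreal (kappa (DIM('a) - dim M))
      * (\<integral>\<^sup>+r. radial_weight (dim V) r * (\<integral>\<^sup>+t. radial_weight (dim M - dim V) t * H r t \<partial>lborel) \<partial>lborel)"
proof -
  let ?n = "DIM('a)" and ?d = "dim M" and ?p = "dim V"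
  obtain b where b: "orthonormal ?n b" "span (b ` {..<?p}) = V" "span (b ` {..<?d}) = M"
    using orthonormal_basis_flag[OF VM] .
  have le: "?d \<le> ?n" "?p \<le> ?d" using dims dim_subset_UNIV[of M] by auto
  interpret product_sigma_finite "\<lambda>_. lborel::real measure" by standard
  interpret I: finite_product_sigma_finite "\<lambda>_. lborel::real measure" "{?p..<?d}" by standard auto
  have sI: "sigma_finite_measure (Pi\<^sub>M {?p..<?d} (\<lambda>_. lborel::real measure))" by standard
  note [measurable] = sigma_finite_measure.borel_measurable_nn_integral[OF sI]
  have [measurable]: "(\<lambda>x. sqrt (\<Sum>i<?p. (x i)\<^sup>2)) \<in> borel_measurable (Pi\<^sub>M {..<?d} (\<lambda>_. lborel))"
    using le by (intro measurable_compose[where g=sqrt, OF borel_measurable_sum] borel_measurable_power) auto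
  have cpM: "closest_point M ((\<Sum>i<?d. x i *\<^sub>R b i) + (\<Sum>i=?d..<?n. y i *\<^sub>R b i)) = (\<Sum>i<?d. x i *\<^sub>R b i)" for x y
    using closest_point_orthonormal[OF b(1) le(1), of "merge {..<?d} {?d..<?n} (x, y)"]
    by (simp add: b sum_lt_split[OF le(1)] sum_merge_lt[where g="\<lambda>c i. c *\<^sub>R b i"] sum_merge_ge[where g="\<lambda>c i. c *\<^sub>R b i"])
  have cpV: "closest_point V ((\<Sum>i<?d. x i *\<^sub>R b i) + (\<Sum>i=?d..<?n. y i *\<^sub>R b i)) = (\<Sum>i<?p. x i *\<^sub>R b i)" for x y
  proof -
    have "(\<Sum>i<?p. merge {..<?d} {?d..<?n} (x, y) i *\<^sub>R b i) = (\<Sum>i<?p. x i *\<^sub>R b i)"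
      using le by (intro sum.cong) (auto simp: merge_def)
    then show ?thesis
      using closest_point_orthonormal[OF b(1), of ?p "merge {..<?d} {?d..<?n} (x, y)"] le
      by (simp add: b sum_lt_split[OF le(1)] sum_merge_lt[where g="\<lambda>c i. c *\<^sub>R b i"] sum_merge_ge[where g="\<lambda>c i. c *\<^sub>R b i"])
  qed
  have nrm: "norm (\<Sum>i=j..<m. y i *\<^sub>R b i) = sqrt (\<Sum>i=j..<m. (y i)\<^sup>2)" if "m \<le> ?n" for y j m
    by (rule norm_sum_orthonormal[OF b(1)]) (use that in auto)
  have nrm0: "norm (\<Sum>i<?p. y i *\<^sub>R b i) = sqrt (\<Sum>i<?p. (y i)\<^sup>2)" for y
    by (rule norm_sum_orthonormal[OF b(1)]) (use le in auto)
  have diff: "(\<Sum>i<?d. x i *\<^sub>R b i) - (\<Sum>i<?p. x i *\<^sub>R b i) = (\<Sum>i=?p..<?d. x i *\<^sub>R b i)" for x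
    by (simp add: sum_lt_split[OF le(2)])
  have "(\<integral>\<^sup>+z. H (norm (closest_point V z)) (norm (closest_point M z - closest_point V z))
             * indicator {..1} (norm (z - closest_point M z)) \<partial>lborel)
    = (\<integral>\<^sup>+x. (\<integral>\<^sup>+y. H (sqrt (\<Sum>i<?p. (x i)\<^sup>2)) (sqrt (\<Sum>i=?p..<?d. (x i)\<^sup>2)) * indicator {..1} (sqrt (\<Sum>i=?d..<?n. (y i)\<^sup>2))
        \<partial>Pi\<^sub>M {?d..<?n} (\<lambda>_. lborel)) \<partial>Pi\<^sub>M {..<?d} (\<lambda>_. lborel))"
    by (subst nn_integral_lborel_orthonormal[OF b(1) _ le(1)]) (auto simp: cpM cpV nrm nrm[OF le(1)] nrm0 diff)
  also have "\<dots> = (\<integral>\<^sup>+x. H (sqrt (\<Sum>i<?p. (x i)\<^sup>2)) (sqrt (\<Sum>i=?p..<?d. (x i)\<^sup>2)) * ennreal (kappa (?n - ?d)) \<partial>Pi\<^sub>M {..<?d} (\<lambda>_. lborel))"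
    by (subst nn_integral_cmult) (auto simp: nn_integral_ball_PiM)
  also have "\<dots> = ennreal (kappa (?n - ?d)) * (\<integral>\<^sup>+x. H (sqrt (\<Sum>i<?p. (x i)\<^sup>2)) (sqrt (\<Sum>i=?p..<?d. (x i)\<^sup>2)) \<partial>Pi\<^sub>M {..<?d} (\<lambda>_. lborel))"
    using le by (subst nn_integral_multc) (auto simp: mult.commute)
  also have "(\<integral>\<^sup>+x. H (sqrt (\<Sum>i<?p. (x i)\<^sup>2)) (sqrt (\<Sum>i=?p..<?d. (x i)\<^sup>2)) \<partial>Pi\<^sub>M {..<?d} (\<lambda>_. lborel))
     = (\<integral>\<^sup>+x. (\<integral>\<^sup>+y. H (sqrt (\<Sum>i<?p. (x i)\<^sup>2)) (sqrt (\<Sum>i=?p..<?d. (y i)\<^sup>2)) \<partial>Pi\<^sub>M {?p..<?d} (\<lambda>_. lborel)) \<partial>Pi\<^sub>M {..<?p} (\<lambda>_. lborel))"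
    using le by (subst nn_integral_PiM_split[where d="?p"])
      (auto simp: sum_merge_lt[where g="\<lambda>c i. c\<^sup>2"] sum_merge_ge[where g="\<lambda>c i. c\<^sup>2"])
  also have "\<dots> = (\<integral>\<^sup>+x. (\<integral>\<^sup>+t. radial_weight (?d - ?p) t * H (sqrt (\<Sum>i<?p. (x i)\<^sup>2)) t \<partial>lborel) \<partial>Pi\<^sub>M {..<?p} (\<lambda>_. lborel))"
    using dims by (subst nn_integral_norm_PiM) (auto simp: radial_weight_def)
  also have "\<dots> = (\<integral>\<^sup>+r. radial_weight ?p r * (\<integral>\<^sup>+t. radial_weight (?d - ?p) t * H r t \<partial>lborel) \<partial>lborel)"
    using dims by (subst nn_integral_norm_PiM[where h="\<lambda>r. \<integral>\<^sup>+t. radial_weight (?d - ?p) t * H r t \<partial>lborel"])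
      (auto simp: radial_weight_def)
  finally show ?thesis .
qed

text \<open>Here the component in \<open>M\<close> is confined to the unit ball, and the norm of the
  other component is integrated in polar coordinates. When \<open>M\<close> is the direction space
  of the flat through \<open>z\<close>, this norm is the distance of the flat from the
  origin.\<close>

lemma nn_integral_norm_complement:
  fixes M :: "'a::euclidean_space set"
  assumes M: "subspace M" "dim M < DIM('a)"
    and [measurable]: "h \<in> borel_measurable borel" "closest_point M \<in> borel_measurable borel"
  shows "(\<integral>\<^sup>+z. indicator {..1} (norm (closest_point M z)) * h (norm (z - closest_point M z)) \<partial>lborel)
    = ennreal (kappa (dim M)) * (\<integral>\<^sup>+r. radial_weight (DIM('a) - dim M) r * h r \<partial>lborel)"
proof -
  let ?n = "DIM('a)" and ?d = "dim M"
  obtain b where b: "orthonormal ?n b" "span (b ` {..<?d}) = M"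
    using orthonormal_basis_flag[OF M(1) M(1) subset_refl] by metis
  have le: "?d \<le> ?n" using M by simp
  have cpM: "closest_point M ((\<Sum>i<?d. x i *\<^sub>R b i) + (\<Sum>i=?d..<?n. y i *\<^sub>R b i)) = (\<Sum>i<?d. x i *\<^sub>R b i)" for x y
    using closest_point_orthonormal[OF b(1) le(1), of "merge {..<?d} {?d..<?n} (x, y)"]
    by (simp add: b sum_lt_split[OF le(1)] sum_merge_lt[where g="\<lambda>c i. c *\<^sub>R b i"] sum_merge_ge[where g="\<lambda>c i. c *\<^sub>R b i"])
  have nrm: "norm (\<Sum>i=?d..<?n. y i *\<^sub>R b i) = sqrt (\<Sum>i=?d..<?n. (y i)\<^sup>2)"
    "norm (\<Sum>i<?d. y i *\<^sub>R b i) = sqrt (\<Sum>i<?d. (y i)\<^sup>2)" for y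
    by (rule norm_sum_orthonormal[OF b(1)], use le in auto)+
  have "(\<integral>\<^sup>+z. indicator {..1} (norm (closest_point M z)) * h (norm (z - closest_point M z)) \<partial>lborel)
    = (\<integral>\<^sup>+x. (\<integral>\<^sup>+y. indicator {..1} (sqrt (\<Sum>i<?d. (x i)\<^sup>2)) * h (sqrt (\<Sum>i=?d..<?n. (y i)\<^sup>2))
        \<partial>Pi\<^sub>M {?d..<?n} (\<lambda>_. lborel)) \<partial>Pi\<^sub>M {..<?d} (\<lambda>_. lborel))"
    by (subst nn_integral_lborel_orthonormal[OF b(1) _ le(1)]) (auto simp: cpM nrm)
  also have "\<dots> = (\<integral>\<^sup>+x. indicator {..1} (sqrt (\<Sum>i<?d. (x i)\<^sup>2)) * (\<integral>\<^sup>+r. radial_weight (?n - ?d) r * h r \<partial>lborel)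
        \<partial>Pi\<^sub>M {..<?d} (\<lambda>_. lborel))"
    using M by (subst nn_integral_cmult) (auto simp: nn_integral_norm_PiM radial_weight_def)
  also have "\<dots> = ennreal (kappa ?d) * (\<integral>\<^sup>+r. radial_weight (?n - ?d) r * h r \<partial>lborel)"
    by (subst nn_integral_multc) (auto simp: nn_integral_ball_PiM)
  finally show ?thesis .
qed

section \<open>Rotations and projections\<close>

text \<open>The bijection \<open>g\<close> translates between the index type of matrix rows and the
  numbering of frames.\<close>

lemma det_row_matrix_orthonormal:
  fixes c :: "nat \<Rightarrow> real^'n" and g :: "'n \<Rightarrow> nat"
  assumes c: "orthonormal CARD('n) c" and g: "bij_betw g UNIV {..<CARD('n)}"
  shows "det (\<chi> i. c (g i)) = 1 \<or> det (\<chi> i. c (g i)) = - 1"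
proof (rule det_orthogonal_matrix)
  have lt: "g i < CARD('n)" for i using g by (auto simp: bij_betw_def)
  have "row i (\<chi> i. c (g i)) = c (g i)" for i by (simp add: row_def vec_eq_iff)
  moreover have "g i \<noteq> g j" if "i \<noteq> j" for i j using g that by (auto simp: bij_betw_def inj_on_def)
  ultimately show "orthogonal_matrix (\<chi> i. c (g i))"
    using orthonormal_inner[OF c] lt
    by (auto simp: orthogonal_matrix_orthonormal_rows orthogonal_def norm_eq_sqrt_inner)
qed

text \<open>Flipping the sign of the last vector of the target frame adjusts the determinant; since
  the dimension is at least two, this vector is not the one in direction \<open>x\<^sub>0\<close>.\<close>
lemma rotation_transitive:
  fixes M M0 :: "(real^'n) set"
  assumes card: "CARD('n) \<ge> 2" and M: "subspace M" "subspace M0" "dim M = dim M0"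
    and x: "x \<in> M" "x0 \<in> M0" "norm x = norm x0" "x \<noteq> 0"
  obtains f where "rotation f" "f ` M = M0" "f x = x0"
proof -
  let ?n = "CARD('n)"
  have *: "\<exists>b. orthonormal ?n b \<and> span (b ` {..<dim M}) = M \<and> b 0 = x /\<^sub>R norm x"
    if M: "subspace M" and x: "x \<in> M" "x \<noteq> 0" for M and x :: "real^'n"
  proof -
    have 1: "orthonormal 1 (\<lambda>_. x /\<^sub>R norm x)"
      using x by (simp add: orthonormal_def dot_square_norm power2_eq_square)
    have d: "1 \<le> dim M" "dim M \<le> ?n"
      using x dim_eq_0[of M] dim_subset_UNIV[of M] by (auto simp: Suc_le_eq intro!: gr0I)
    have img: "(\<lambda>_::nat. x /\<^sub>R norm x) ` {..<1} \<subseteq> M" using M x by (auto simp: subspace_scale)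
    obtain b where b: "orthonormal (dim M) b" "b 0 = x /\<^sub>R norm x" "span (b ` {..<dim M}) = M"
      using orthonormal_extend[OF 1 img M d(1)] by (metis zero_less_one)
    obtain b' where b': "orthonormal ?n b'" "\<And>i. i < dim M \<Longrightarrow> b' i = b i"
      using orthonormal_extend[OF b(1), of UNIV] d by (metis DIM_cart DIM_real dim_UNIV mult.right_neutral subset_UNIV subspace_UNIV)
    have "b' ` {..<dim M} = b ` {..<dim M}" using b'(2) by (auto intro!: image_cong)
    then show ?thesis using b b' d by (intro exI[of _ b']) auto
  qed
  have x0: "x0 \<noteq> 0" using x by auto
  obtain b where b: "orthonormal ?n b" "span (b ` {..<dim M}) = M" "b 0 = x /\<^sub>R norm x"
    using *[of M x] M x by blast
  obtain c where c: "orthonormal ?n c" "span (c ` {..<dim M0}) = M0" "c 0 = x0 /\<^sub>R norm x0"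
    using *[of M0 x0] M x x0 by blast
  obtain g :: "'n \<Rightarrow> nat" where g: "bij_betw g UNIV {..<?n}"
    using ex_bij_betw_finite_nat[of "UNIV::'n set"] by (auto simp: atLeast0LessThan)
  obtain k where k: "g k = ?n - 1"
    using g card by (metis bij_betw_def imageE lessThan_iff diff_less zero_less_one less_le_trans pos2)
  define s where "s = det (\<chi> i. c (g i)) * det (\<chi> i. b (g i))"
  have s: "s = 1 \<or> s = - 1"
    using det_row_matrix_orthonormal[OF b(1) g] det_row_matrix_orthonormal[OF c(1) g] by (auto simp: s_def)
  define c' where "c' = c(?n - 1 := s *\<^sub>R c (?n - 1))"
  have c': "orthonormal ?n c'"
    using c(1) s by (auto simp: orthonormal_def c'_def)
  have gk: "g i = ?n - 1 \<longleftrightarrow> i = k" for i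
    using g k by (auto simp: bij_betw_def inj_on_def)
  have "(\<chi> i. c' (g i)) = (\<chi> i. if i = k then s *s c (g i) else c (g i))"
    by (simp add: vec_eq_iff c'_def gk gk[simplified] k scalar_mult_eq_scaleR)
  then have "det (\<chi> i. c' (g i)) = s * det (\<chi> i. c (g i))"
    using det_row_mul[of k s "\<lambda>i. c (g i)" "\<lambda>i. c (g i)"] by (simp only: if_cancel)
  then have det1: "det (\<chi> i. c' (g i)) * det (\<chi> i. b (g i)) = 1"
    using s by (auto simp: s_def)
  define f where "f z = (\<Sum>i<?n. (z \<bullet> b i) *\<^sub>R c' i)" for z
  have lin: "linear f"
    by (rule linearI) (auto simp: f_def inner_add_left scaleR_add_left sum.distrib scaleR_sum_right)
  have fb: "f (b j) = c' j" if "j < ?n" for j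
  proof -
    have "f (b j) = (\<Sum>i<?n. if i = j then c' i else 0)"
      unfolding f_def using that by (intro sum.cong) (auto simp: orthonormal_inner[OF b(1)])
    then show ?thesis using that by simp
  qed
  have spanb: "span (b ` {..<?n}) = UNIV"
    using orthonormal_dim_span[OF b(1)] by (simp flip: dim_eq_full)
  have "orthogonal_transformation f"
    unfolding orthogonal_transformation
  proof (intro conjI allI lin)
    fix z
    have "z = (\<Sum>i<?n. (z \<bullet> b i) *\<^sub>R b i)"
      by (rule orthonormal_span_expand[OF b(1)]) (simp only: spanb UNIV_I)
    from trans[OF arg_cong[OF this, of norm] norm_sum_orthonormal[OF b(1) order_refl]]
    have "norm z = sqrt (\<Sum>i<?n. (z \<bullet> b i)\<^sup>2)" .
    then show "norm (f z) = norm z"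
      unfolding f_def norm_sum_orthonormal[OF c' order_refl] by (rule sym)
  qed
  \<comment> \<open>\<open>f\<close> is the sum of the products of \<open>c' i\<close> with the
    transposed \<open>b i\<close>, hence this factorisation into frame matrices. The sign
    \<open>s\<close> was chosen so that the product of their determinants is 1.\<close>
  moreover have "matrix f = transpose (\<chi> i. c' (g i)) ** (\<chi> i. b (g i))"
  proof -
    have "matrix f $ i $ j = (\<Sum>l\<in>UNIV. c' (g l) $ i * b (g l) $ j)" for i j
    proof -
      have "matrix f $ i $ j = (\<Sum>l<?n. c' l $ i * b l $ j)"
        by (simp add: matrix_def f_def inner_axis' mult.commute)
      then show ?thesis
        using sum.reindex_bij_betw[OF g, of "\<lambda>l. c' l $ i * b l $ j"] by simp
    qed
    then show ?thesis
      by (simp add: vec_eq_iff matrix_matrix_mult_def transpose_def)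
  qed
  then have "det (matrix f) = 1"
    using det1 by (simp add: det_mul det_transpose)
  ultimately have "rotation f" by (simp add: rotation_def)
  moreover have "f ` M = M0"
  proof -
    have le: "dim M \<le> ?n" using dim_subset_UNIV[of M] by simp
    have "f ` M = span (f ` b ` {..<dim M})"
      using linear_span_image[OF lin, of "b ` {..<dim M}"] unfolding b(2) by (rule sym)
    also have "f ` b ` {..<dim M} = c' ` {..<dim M}"
      unfolding image_image using le by (intro image_cong refl fb) auto
    also have "span (c' ` {..<dim M}) = M0"
    proof (rule subspace_dim_equal)
      \<comment> \<open>A sign change keeps a vector in the subspace, so \<open>M0\<close> is still
        the span, even if the flipped vector belongs to it.\<close>
      have "c' i \<in> M0" if "i < dim M" for i
      proof -
        have "c i \<in> span (c ` {..<dim M0})" using that M(3) by (intro span_base) auto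
        then have "c i \<in> M0" unfolding c(2) .
        then show ?thesis using subspace_scale[OF M(2)] by (cases "i = ?n - 1") (simp_all add: c'_def)
      qed
      then show "span (c' ` {..<dim M}) \<subseteq> M0"
        using M by (intro span_minimal) auto
      show "dim M0 \<le> dim (span (c' ` {..<dim M}))"
        using orthonormal_dim_span[OF orthonormal_mono[OF c' le]] M by simp
    qed (use M in auto)
    finally show ?thesis .
  qed
  moreover have "f x = x0"
  proof -
    have "f (b 0) = c 0" using fb[of 0] card by (simp add: c'_def)
    then have "f (norm x *\<^sub>R b 0) = norm x *\<^sub>R c 0" by (simp add: linear_scale[OF lin])
    then show ?thesis using b(3) c(3) x x0 by simp
  qed
  ultimately show thesis using that by blast
qed

lemma linear_closest_point_subspace:
  fixes V :: "'a::euclidean_space set"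
  assumes "subspace V"
  shows "linear (closest_point V)"
proof -
  note [simp] = closest_point_subspace[OF assms]
  show ?thesis
  proof (rule linearI; rule closest_point_subspaceI[OF assms])
    fix x z y assume "y \<in> V"
    then have "(x - closest_point V x) \<bullet> y + (z - closest_point V z) \<bullet> y = 0" by simp
    then show "(x + z - (closest_point V x + closest_point V z)) \<bullet> y = 0"
      by (simp only: inner_add_left[symmetric]) (simp add: algebra_simps)
  next
    fix r x y assume "y \<in> V"
    then have "r * ((x - closest_point V x) \<bullet> y) = 0" by simp
    then show "(r *\<^sub>R x - r *\<^sub>R closest_point V x) \<bullet> y = 0"
      by (simp only: scaleR_diff_right[symmetric] inner_scaleR_left)
  qed (use assms in \<open>auto intro: subspace_add subspace_scale\<close>)
qed

lemma proj_mat_mult: "subspace V \<Longrightarrow> proj_mat V *v z = closest_point V z"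
  unfolding proj_mat_def by (simp add: matrix_works linear_closest_point_subspace linear_matrix_vector_mul_eq)

lemma closest_point_subspace_iff: "subspace V \<Longrightarrow> closest_point V z = z \<longleftrightarrow> z \<in> (V::'a::euclidean_space set)"
  using closest_point_refl[of V] by (metis closed_subspace empty_iff subspace_0)

lemma borel_measurable_closest_point_subspace:
  "subspace V \<Longrightarrow> closest_point V \<in> borel_measurable (borel::'a::euclidean_space measure)"
  by (intro borel_measurable_continuous_onI linear_continuous_on)
     (simp add: linear_conv_bounded_linear[symmetric] linear_closest_point_subspace)

section \<open>Measurability of distances to parametrised closed sets\<close>

lemma continuous_on_matrix_vector_mult:
  fixes A :: "'a::topological_space \<Rightarrow> real^'n^'m"
  assumes "continuous_on S A" "continuous_on S v"
  shows "continuous_on S (\<lambda>x. A x *v v x)"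
  unfolding matrix_vector_mult_def using assms by (intro continuous_intros)

lemma measurable_matrix_vector_mult:
  fixes A :: "'a \<Rightarrow> real^'n^'m"
  assumes "A \<in> borel_measurable M" "v \<in> borel_measurable M"
  shows "(\<lambda>x. A x *v v x) \<in> borel_measurable M"
  by (rule borel_measurable_continuous_Pair[OF assms])
     (auto intro!: continuous_on_matrix_vector_mult continuous_intros)

text \<open>For nonempty sections, sublevel sets are projections: the distance is at most
  \<open>c\<close> iff the section meets the compact \<open>cball 0 c\<close>, and a closed set
  projects along a compact factor to a closed set. Empty sections, where \<open>infdist\<close> is 0
  by convention, have to be added; they form the complement of a countable union of such
  projections.\<close>

lemma borel_measurable_infdist_closed:
  fixes R :: "'a::euclidean_space \<Rightarrow> 'b::euclidean_space \<Rightarrow> bool"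
  assumes R: "closed {(y, a). R a y}"
  shows "(\<lambda>a. infdist 0 {y. R a y}) \<in> borel_measurable borel"
  unfolding borel_measurable_iff_le
proof (intro allI)
  fix c
  have cl: "closed {a. \<exists>y. y \<in> cball 0 c \<and> R a y}" for c
    using closed_compact_projection[OF compact_cball R, of 0 c] by simp
  have "closed {y. R a y}" for a
  proof -
    have "{y. R a y} = (\<lambda>y. (y, a)) -` {(y, a). R a y}" by auto
    then show ?thesis by (simp only:) (rule closed_vimage[OF R], intro continuous_intros)
  qed
  then have "infdist 0 {y. R a y} \<le> c \<longleftrightarrow> 0 \<le> c \<and> ((\<exists>y. y \<in> cball 0 c \<and> R a y) \<or> \<not> (\<exists>n::nat. \<exists>y. y \<in> cball 0 (real n) \<and> R a y))" for a
  proof (cases "{y. R a y} = {}")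
    case True then show ?thesis by (simp add: infdist_def)
  next
    case False
    have *: "\<exists>n::nat. \<exists>y. y \<in> cball 0 (real n) \<and> R a y"
      using False real_arch_simple by (metis (no_types, lifting) Collect_empty_eq dist_0_norm mem_cball)
    obtain x where x: "R a x" "infdist 0 {y. R a y} = dist 0 x"
      using infdist_attains_inf[OF \<open>closed {y. R a y}\<close> False, of 0] by auto
    have "infdist 0 {y. R a y} \<le> dist 0 y" if "R a y" for y
      using that by (intro infdist_le) auto
    then have "infdist 0 {y. R a y} \<le> c \<longleftrightarrow> (\<exists>y. y \<in> cball 0 c \<and> R a y)"
      using x by (auto intro: order_trans)
    then show ?thesis using * infdist_nonneg[of 0 "{y. R a y}"] by (auto intro: order_trans)
  qed
  then have "{a \<in> space borel. infdist 0 {y. R a y} \<le> c}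
    = (if 0 \<le> c then {a. \<exists>y. y \<in> cball 0 c \<and> R a y} \<union> - (\<Union>n::nat. {a. \<exists>y. y \<in> cball 0 (real n) \<and> R a y}) else {})"
    by auto
  also have "\<dots> \<in> sets borel"
    using cl by (auto intro!: sets.Un sets.countable_UN borel_closed borel_comp)
  finally show "{a \<in> space borel. infdist 0 {y. R a y} \<le> c} \<in> sets borel" .
qed

section \<open>Grassmannians\<close>

lemma proj_mat_measurable:
  "sets \<nu> = sets (grass_space k) \<Longrightarrow> proj_mat \<in> borel_measurable \<nu>"
  using measurable_vimage_algebra1[of proj_mat "grass k" borel]
  by (simp add: grass_space_def cong: measurable_cong_sets)

lemma space_grass: "sets \<nu> = sets (grass_space k) \<Longrightarrow> space \<nu> = grass k"
  by (metis grass_space_def sets_eq_imp_space_eq space_vimage_algebra)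

lemma grassD: "L \<in> grass k \<Longrightarrow> subspace L" "L \<in> grass k \<Longrightarrow> dim L = k"
  by (simp_all add: grass_def)

lemma measurable_grass_spaceI:
  assumes "sets \<nu> = sets (grass_space k)" "g \<in> space N \<rightarrow> grass k" "(\<lambda>x. proj_mat (g x)) \<in> borel_measurable N"
  shows "g \<in> measurable N \<nu>"
  using measurable_vimage_algebra2[OF assms(2,3)] assms(1)
  by (simp add: grass_space_def cong: measurable_cong_sets)

text \<open>The projection is a matrix-vector product, jointly continuous in matrix and vector; this
  is how the topology of the Grassmannian is used.\<close>

lemma measurable_closest_point_grass:
  fixes \<nu> :: "(real^'n) set measure"
  assumes \<nu>: "sets \<nu> = sets (grass_space k)"
    and f: "f \<in> measurable N \<nu>" and g: "g \<in> borel_measurable N"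
  shows "(\<lambda>x. closest_point (f x) (g x)) \<in> borel_measurable N"
proof -
  have "(\<lambda>x. proj_mat (f x) *v g x) \<in> borel_measurable N"
    by (intro measurable_matrix_vector_mult g measurable_compose[OF f] proj_mat_measurable[OF \<nu>])
  also have "?this \<longleftrightarrow> ?thesis"
    using measurable_space[OF f] space_grass[OF \<nu>]
    by (intro measurable_cong) (auto intro!: proj_mat_mult grassD(1))
  finally show ?thesis .
qed

lemma closest_point_translate_subspace:
  fixes L :: "'a::euclidean_space set"
  assumes L: "subspace L"
  shows "closest_point ((\<lambda>y. y + z) ` L) 0 = z - closest_point L z"
proof (rule closest_point_unique[symmetric])
  have "(\<lambda>y. y + z) ` L = (+) z ` L" by (auto simp: add.commute)
  then show "convex ((\<lambda>y. y + z) ` L)" "closed ((\<lambda>y. y + z) ` L)"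
    using L by (auto simp: subspace_imp_convex closed_subspace convex_translation closed_translation)
  show "z - closest_point L z \<in> (\<lambda>y. y + z) ` L"
    using closest_point_subspace(1)[OF L, of z] L by (auto intro!: image_eqI[of _ _ "- closest_point L z"] subspace_neg)
  show "\<forall>w\<in>(\<lambda>y. y + z) ` L. dist 0 (z - closest_point L z) \<le> dist 0 w"
  proof safe
    fix y assume "y \<in> L"
    then have "y + closest_point L z \<in> L" by (simp add: L closest_point_subspace subspace_add)
    then have "(norm ((z - closest_point L z) + (y + closest_point L z)))\<^sup>2 = (norm (z - closest_point L z))\<^sup>2 + (norm (y + closest_point L z))\<^sup>2"
      by (intro norm_add_Pythagorean) (simp add: orthogonal_def closest_point_subspace(2)[OF L])
    then show "dist 0 (z - closest_point L z) \<le> dist 0 (y + z)"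
      by (simp add: power2_le_imp_le add.commute)
  qed
qed

lemma translate_subspace_cancel:
  assumes "subspace L" "w - z \<in> L"
  shows "(\<lambda>y. y + w) ` L = (\<lambda>y. y + z) ` L"
proof -
  have "y + w \<in> (\<lambda>y. y + z) ` L" if "y \<in> L" for y
    using that assms by (intro image_eqI[of _ _ "y + (w - z)"]) (auto intro: subspace_add)
  moreover have "y + z \<in> (\<lambda>y. y + w) ` L" if "y \<in> L" for y
    using that assms by (intro image_eqI[of _ _ "y - (w - z)"]) (auto intro: subspace_diff)
  ultimately show ?thesis by blast
qed

lemma aff_param_translate:
  assumes L: "subspace L"
  shows "aff_param ((\<lambda>y. y + z) ` L) = (proj_mat L, z - closest_point L z)"
proof -
  have "(\<lambda>y. y + z) ` L = (\<lambda>y. y + (z - closest_point L z)) ` L"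
    by (rule translate_subspace_cancel[OF L]) (simp add: closest_point_subspace L)
  then have "(\<lambda>y. y - (z - closest_point L z)) ` (\<lambda>y. y + z) ` L = L"
    by (simp add: image_image)
  then show ?thesis
    by (simp add: aff_param_def Let_def closest_point_translate_subspace[OF L])
qed

lemma translate_in_affgrass:
  assumes "L \<in> grass k"
  shows "(\<lambda>y. y + z) ` L \<in> affgrass k"
proof -
  have *: "(\<lambda>y. y + z) ` L = (+) z ` L" by (auto simp: add.commute)
  show ?thesis
    using grassD[OF assms] subspace_0[of L]
    by (auto simp: affgrass_def * affine_translation[symmetric] subspace_imp_affine aff_dim_translation_eq aff_dim_subspace)
qed

lemma affgrass_cases:
  fixes E :: "(real^'n) set"
  assumes "E \<in> affgrass k"
  obtains M where "M \<in> grass k" "E = (\<lambda>y. y + closest_point E 0) ` M" "aff_param E = (proj_mat M, closest_point E 0)"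
proof -
  let ?p = "closest_point E 0" let ?M = "(\<lambda>y. y - ?p) ` E"
  have E: "affine E" "E \<noteq> {}" "aff_dim E = int k" using assms by (auto simp: affgrass_def)
  then have p: "?p \<in> E" by (simp add: affine_closed closest_point_in_set)
  have "subspace ?M" using E p by (simp add: affine_diffs_subspace_subtract)
  moreover have "dim ?M = k"
    using aff_dim_eq_dim_subtract[of ?p E] E(3) p by (simp add: hull_inc)
  ultimately have "?M \<in> grass k" by (simp add: grass_def)
  moreover have "E = (\<lambda>y. y + ?p) ` ?M" by (simp add: image_image)
  ultimately show thesis using that by (simp add: aff_param_def Let_def)
qed

text \<open>The sigma-algebra on flats is pulled back along \<open>aff_param\<close>, whose value at
  the shifted subspace is its projection matrix paired with the residual of the shift.\<close>

lemma measurable_translate: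
  fixes \<nu> :: "(real^'n) set measure"
  assumes \<nu>: "sets \<nu> = sets (grass_space k)"
    and f: "f \<in> measurable N \<nu>" and g[measurable]: "g \<in> borel_measurable N"
  shows "(\<lambda>x. (\<lambda>y. y + g x) ` f x) \<in> measurable N (affgrass_space k)"
  unfolding affgrass_space_def
proof (rule measurable_vimage_algebra2)
  have fx: "f x \<in> grass k" if "x \<in> space N" for x
    using measurable_space[OF f that] space_grass[OF \<nu>] by simp
  then show "(\<lambda>x. (\<lambda>y. y + g x) ` f x) \<in> space N \<rightarrow> affgrass k"
    by (auto intro: translate_in_affgrass)
  note [measurable] = measurable_closest_point_grass[OF \<nu> f g] measurable_compose[OF f proj_mat_measurable[OF \<nu>]]
  have "(\<lambda>x. (proj_mat (f x), g x - closest_point (f x) (g x))) \<in> borel_measurable N"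
    by (rule borel_measurable_Pair) measurable
  also have "?this \<longleftrightarrow> (\<lambda>x. aff_param ((\<lambda>y. y + g x) ` f x)) \<in> borel_measurable N"
    using fx by (intro measurable_cong aff_param_translate[OF grassD(1), symmetric])
  finally show "(\<lambda>x. aff_param ((\<lambda>y. y + g x) ` f x)) \<in> borel_measurable N" .
qed

section \<open>The motion invariant measure as an image measure\<close>

lemma dim_orthogonal_comp:
  fixes L :: "(real^'n) set"
  assumes "subspace L"
  shows "dim (orthogonal_comp L) = CARD('n) - dim L"
  using dim_subspace_orthogonal_to_vectors[OF assms subspace_UNIV] by (simp add: orthogonal_comp_def)

lemma closest_point_orthogonal_comp:
  fixes L :: "'a::euclidean_space set"
  assumes "subspace L"
  shows "closest_point (orthogonal_comp L) z = z - closest_point L z"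
proof (rule closest_point_subspaceI)
  show "z - closest_point L z \<in> orthogonal_comp L"
    using closest_point_subspace(2)[OF assms] by (simp add: orthogonal_comp_def orthogonal_def inner_commute)
  show "(z - (z - closest_point L z)) \<bullet> y = 0" if "y \<in> orthogonal_comp L" for y
    using that closest_point_subspace(1)[OF assms] by (simp add: orthogonal_comp_def orthogonal_def)
qed (rule subspace_orthogonal_comp)

text \<open>Division by \<open>kappa k\<close> normalises the volume of the unit ball of
  \<open>L\<close>, so that the component of \<open>z\<close> in \<open>L\<close> carries total mass
  1.\<close>

definition cylinder_measure :: "nat \<Rightarrow> (real^'n) set measure \<Rightarrow> ((real^'n) set \<times> (real^'n)) measure" where
  "cylinder_measure k \<nu> = density (\<nu> \<Otimes>\<^sub>M lborel)
     (\<lambda>(L, z). indicator {..1} (norm (closest_point L z)) / ennreal (kappa k))"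

text \<open>The motion invariant measure as the image of a product measure: shifting \<open>L\<close> by an
  arbitrary vector \<open>z\<close> instead of \<open>z \<in> L\<^sup>\<bottom>\<close>, with the superfluous component of \<open>z\<close> confined to the
  unit ball. This makes measurability in \<open>L\<close> visible, which is not obvious for \<open>onb L\<close>.\<close>
lemma affgrass_measure_eq_distr:
  fixes \<nu> :: "(real^'n) set measure"
  assumes \<nu>: "sets \<nu> = sets (grass_space k)" and k: "k \<le> CARD('n)"
  shows "affgrass_measure k \<nu> = distr (cylinder_measure k \<nu>) (affgrass_space k) (\<lambda>(L, z). (\<lambda>y. y + z) ` L)"
    (is "_ = ?N")
proof -
  have sp: "space (affgrass_space k :: (real^'n) set measure) = affgrass k" by (simp add: affgrass_space_def)
  note [measurable] = measurable_closest_point_grass[OF \<nu>] measurable_translate[OF \<nu>]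
  have T[measurable]: "(\<lambda>(L, z). (\<lambda>y. y + z) ` L) \<in> measurable (\<nu> \<Otimes>\<^sub>M lborel) (affgrass_space k)"
    by measurable
  have W[measurable]: "(\<lambda>(L, z). indicator {..1} (norm (closest_point L z)) / ennreal (kappa k)) \<in> borel_measurable (\<nu> \<Otimes>\<^sub>M lborel)"
    by measurable
  have eq: "(\<integral>\<^sup>+ L. (\<integral>\<^sup>+ x. indicator A ((\<lambda>y. y + x) ` L) \<partial>lebesgue_subspace (orthogonal_comp L)) \<partial>\<nu>) = emeasure ?N A"
    if A[measurable]: "A \<in> sets (affgrass_space k)" for A
  proof -
    have inner: "(\<integral>\<^sup>+ x. indicator A ((\<lambda>y. y + x) ` L) \<partial>lebesgue_subspace (orthogonal_comp L))
       = (\<integral>\<^sup>+ z. indicator {..1} (norm (closest_point L z)) / ennreal (kappa k) * indicator A ((\<lambda>y. y + z) ` L) \<partial>lborel)"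
      if L: "L \<in> grass k" for L
    proof -
      have sL: "subspace L" "dim L = k" using L by (auto simp: grassD)
      have "(\<lambda>_. L) \<in> measurable borel \<nu>" using L space_grass[OF \<nu>] by (intro measurable_const) simp
      from measurable_translate[OF \<nu> this, of "\<lambda>x. x"]
      have mL[measurable]: "(\<lambda>x. (\<lambda>y. y + x) ` L) \<in> measurable borel (affgrass_space k)" by simp
      have cp[measurable]: "closest_point L \<in> borel_measurable borel"
        by (rule borel_measurable_closest_point_subspace[OF sL(1)])
      have "(\<integral>\<^sup>+ x. indicator A ((\<lambda>y. y + x) ` L) \<partial>lebesgue_subspace (orthogonal_comp L)) * ennreal (kappa k)
        = (\<integral>\<^sup>+z. indicator A ((\<lambda>y. y + closest_point (orthogonal_comp L) z) ` L)
            * indicator {..1} (norm (z - closest_point (orthogonal_comp L) z)) \<partial>lborel)"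
        using nn_integral_lebesgue_subspace[OF subspace_orthogonal_comp[of L], of "\<lambda>x. indicator A ((\<lambda>y. y + x) ` L)"]
          borel_measurable_closest_point_subspace[OF subspace_orthogonal_comp[of L]] k sL
        by (simp add: dim_orthogonal_comp)
      also have "\<dots> = (\<integral>\<^sup>+z. indicator {..1} (norm (closest_point L z)) * indicator A ((\<lambda>y. y + z) ` L) \<partial>lborel)"
      proof -
        have "(\<lambda>y. y + (z - closest_point L z)) ` L = (\<lambda>y. y + z) ` L" for z
          using closest_point_subspace(1)[OF sL(1), of z] sL(1) by (intro translate_subspace_cancel) (auto simp: subspace_neg)
        then show ?thesis by (simp add: closest_point_orthogonal_comp[OF sL(1)] mult.commute)
      qed
      finally have *: "(\<integral>\<^sup>+ x. indicator A ((\<lambda>y. y + x) ` L) \<partial>lebesgue_subspace (orthogonal_comp L)) * ennreal (kappa k) = \<dots>" .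
      have "(\<integral>\<^sup>+ x. indicator A ((\<lambda>y. y + x) ` L) \<partial>lebesgue_subspace (orthogonal_comp L))
         = (\<integral>\<^sup>+ x. indicator A ((\<lambda>y. y + x) ` L) \<partial>lebesgue_subspace (orthogonal_comp L)) * ennreal (kappa k) / ennreal (kappa k)"
        using kappa_pos[of k] by (simp add: ennreal_mult_divide_eq)
      also have "\<dots> = (\<integral>\<^sup>+z. indicator {..1} (norm (closest_point L z)) * indicator A ((\<lambda>y. y + z) ` L) / ennreal (kappa k) \<partial>lborel)"
        unfolding * by (subst nn_integral_divide) auto
      finally show ?thesis
        by (simp add: divide_ennreal_def mult.commute mult.left_commute)
    qed
    have "emeasure ?N A = (\<integral>\<^sup>+ Lz. indicator A ((\<lambda>(L, z). (\<lambda>y. y + z) ` L) Lz) \<partial>cylinder_measure k \<nu>)"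
    proof -
      have "emeasure ?N A = (\<integral>\<^sup>+ E. indicator A E \<partial>?N)" by simp
      also have "\<dots> = (\<integral>\<^sup>+ Lz. indicator A ((\<lambda>(L, z). (\<lambda>y. y + z) ` L) Lz) \<partial>cylinder_measure k \<nu>)"
        by (rule nn_integral_distr) (auto simp: cylinder_measure_def)
      finally show ?thesis .
    qed
    also have "\<dots> = (\<integral>\<^sup>+ Lz. (\<lambda>(L, z). indicator {..1} (norm (closest_point L z)) / ennreal (kappa k)) Lz * indicator A ((\<lambda>(L, z). (\<lambda>y. y + z) ` L) Lz) \<partial>(\<nu> \<Otimes>\<^sub>M lborel))"
      unfolding cylinder_measure_def by (rule nn_integral_density) measurable
    also have "\<dots> = (\<integral>\<^sup>+ L. (\<integral>\<^sup>+ z. indicator {..1} (norm (closest_point L z)) / ennreal (kappa k) * indicator A ((\<lambda>y. y + z) ` L) \<partial>lborel) \<partial>\<nu>)"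
      by (subst lborel.nn_integral_fst[symmetric]) (auto, measurable)
    also have "\<dots> = (\<integral>\<^sup>+ L. (\<integral>\<^sup>+ x. indicator A ((\<lambda>y. y + x) ` L) \<partial>lebesgue_subspace (orthogonal_comp L)) \<partial>\<nu>)"
      using inner space_grass[OF \<nu>] by (intro nn_integral_cong) auto
    finally show ?thesis ..
  qed
  \<comment> \<open>\<open>measure_of\<close> depends only on the values of the set function on the
    sigma-algebra. Here they agree with those of a genuine measure, which also settles countable
    additivity.\<close>
  have "affgrass_measure k \<nu> = measure_of (affgrass k) (sets (affgrass_space k)) (emeasure ?N)"
    unfolding affgrass_measure_def
    by (rule measure_of_eq) (use eq sp sets.sets_into_space[of _ "affgrass_space k :: (real^'n) set measure"] sets.sigma_sets_eq[of "affgrass_space k :: (real^'n) set measure"] in auto)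
  also have "\<dots> = ?N"
    using measure_of_of_measure[of ?N] sp by simp
  finally show ?thesis .
qed

text \<open>Restricting the witness to balls of integer radius makes each projection closed; the
  union over all radii is then Borel.\<close>

lemma sets_borel_exists_closed:
  fixes R :: "'a::euclidean_space \<Rightarrow> 'b::euclidean_space \<Rightarrow> bool"
  assumes R: "closed {(y, a). R a y}"
  shows "{a. \<exists>y. R a y} \<in> sets borel"
proof -
  have "{a. \<exists>y. R a y} = (\<Union>n::nat. {a. \<exists>y. y \<in> cball 0 (real n) \<and> R a y})"
    using real_arch_simple by fastforce
  also have "\<dots> \<in> sets borel"
    using closed_compact_projection[OF compact_cball R, of 0] by (auto intro!: sets.countable_UN borel_closed)
  finally show ?thesis .
qed

section \<open>Generic position\<close>

lemma AE_lborel_not_in_subspace: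
  fixes S :: "'a::euclidean_space set"
  assumes "subspace S" "dim S < DIM('a)"
  shows "AE z in lborel. z \<notin> S"
proof (rule AE_not_in)
  have "S \<in> sets lborel" using assms(1) by (auto intro: borel_closed closed_subspace)
  then show "S \<in> null_sets lborel"
    using negligible_lowdim[OF assms(2)] by (simp add: negligible_iff_null_sets null_sets_completion_iff)
qed

lemma dim_add_le:
  fixes L U :: "'a::euclidean_space set"
  assumes "subspace L" "subspace U"
  shows "dim {a + b | a b. a \<in> L \<and> b \<in> U} \<le> dim L + dim U"
  using dim_sums_Int[OF assms] by simp

text \<open>The dimension of \<open>U\<close> is raised one by one. As long as \<open>L + U\<close>
  is a proper subspace, it is a Lebesgue null set, so for each \<open>L\<close> almost every
  \<open>z\<close> avoids it; exchanging the quantifiers by Fubini yields a single \<open>z\<close>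
  that is good for almost every \<open>L\<close>. The resulting \<open>U\<close> depends on the
  distribution, which suffices later, where rotations carry other subspaces to the constructed
  one.\<close>

lemma exists_generic_subspace:
  fixes \<nu> :: "(real^'n) set measure"
  assumes \<nu>: "sets \<nu> = sets (grass_space q)" and "prob_space \<nu>" and "j + q \<le> CARD('n)"
  shows "\<exists>U. subspace U \<and> dim U = j \<and> (AE L in \<nu>. L \<inter> U = {0})"
  using assms(3)
proof (induction j)
  case 0
  have "AE L in \<nu>. L \<inter> {0} = {0}"
    using space_grass[OF \<nu>] by (intro AE_I2) (auto dest: grassD subspace_0)
  then show ?case by (intro exI[of _ "{0}"]) auto
next
  case (Suc j)
  then obtain U where U: "subspace U" "dim U = j" "AE L in \<nu>. L \<inter> U = {0}" by auto
  interpret prob_space \<nu> by fact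
  interpret P: pair_sigma_finite \<nu> "lborel :: (real^'n) measure" by standard
  define S where "S L = {a + b | a b. a \<in> L \<and> b \<in> U}" for L
  have S: "subspace (S L)" "dim (S L) < CARD('n)" if "L \<in> space \<nu>" for L
    using that Suc.prems U dim_add_le[of L U] subspace_sums[of L U] space_grass[OF \<nu>]
    by (auto simp: S_def grass_def)
  have ae: "AE L in \<nu>. AE z in lborel. z \<notin> S L"
    using S by (intro AE_I2 AE_lborel_not_in_subspace) auto
  \<comment> \<open>Membership of \<open>z\<close> in \<open>L + U\<close> is encoded as the
    existence of a point of \<open>U\<close> whose difference from \<open>z\<close> is fixed by the
    projection matrix. This closed condition supplies the measurability needed to exchange the
    quantifiers.\<close>
  have cl: "closed {(y, a :: (real^'n^'n) \<times> (real^'n)). y \<in> U \<and> fst a *v (snd a - y) = snd a - y}"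
    unfolding case_prod_unfold
    by (intro closed_Collect_conj closed_Collect_eq closed_vimage[of U fst, unfolded vimage_def] closed_subspace U
        continuous_on_matrix_vector_mult continuous_intros)
  have "{x \<in> space (\<nu> \<Otimes>\<^sub>M lborel). snd x \<notin> S (fst x)}
      = (\<lambda>x. (proj_mat (fst x), snd x)) -` (- {a. \<exists>y. y \<in> U \<and> fst a *v (snd a - y) = snd a - y}) \<inter> space (\<nu> \<Otimes>\<^sub>M lborel)"
  proof -
    have "z \<in> S L \<longleftrightarrow> (\<exists>y. y \<in> U \<and> proj_mat L *v (z - y) = z - y)" if "L \<in> space \<nu>" for L z
    proof -
      have "subspace L" using that space_grass[OF \<nu>] by (auto dest: grassD)
      then have "(\<exists>y. y \<in> U \<and> proj_mat L *v (z - y) = z - y) \<longleftrightarrow> (\<exists>y. y \<in> U \<and> z - y \<in> L)"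
        by (simp add: proj_mat_mult closest_point_subspace_iff)
      also have "\<dots> \<longleftrightarrow> z \<in> S L"
        unfolding S_def mem_Collect_eq by (metis add_diff_cancel_right' diff_add_cancel)
      finally show ?thesis by simp
    qed
    then show ?thesis by (auto simp: space_pair_measure)
  qed
  also have "\<dots> \<in> sets (\<nu> \<Otimes>\<^sub>M lborel)"
  proof (rule measurable_sets[where A=borel])
    have [measurable]: "proj_mat \<in> borel_measurable \<nu>" by (rule proj_mat_measurable[OF \<nu>])
    show "(\<lambda>x. (proj_mat (fst x), snd x)) \<in> borel_measurable (\<nu> \<Otimes>\<^sub>M lborel)"
      by (rule borel_measurable_Pair) measurable
    show "- {a. \<exists>y. y \<in> U \<and> fst a *v (snd a - y) = snd a - y} \<in> sets borel"
      by (rule borel_comp[OF sets_borel_exists_closed[OF cl]])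
  qed
  finally have "AE z in lborel. AE L in \<nu>. z \<notin> S L"
    using ae by (subst (asm) P.AE_commute) auto
  \<comment> \<open>Lebesgue measure is not the null measure, so at least one \<open>z\<close> has
    the almost sure property.\<close>
  moreover have "\<not> (AE z::real^'n in lborel. False)"
    by (simp add: AE_iff_measurable[of UNIV])
  ultimately obtain z where z: "AE L in \<nu>. z \<notin> S L"
    using eventually_mono[of "\<lambda>z. AE L in \<nu>. z \<notin> S L" "ae_filter lborel" "\<lambda>_. False"] by blast
  have "z \<notin> U"
  proof
    assume "z \<in> U"
    then have "z \<in> S L" if "L \<in> space \<nu>" for L
      using that space_grass[OF \<nu>] subspace_0[of L] grassD(1)[of L q] unfolding S_def
      by (metis (mono_tags, lifting) CollectI add_0)
    then have "AE L in \<nu>. False" using z by (auto elim!: AE_mp)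
    then show False by simp
  qed
  have "dim (span (insert z U)) = Suc j"
    using \<open>z \<notin> U\<close> U by (simp add: dim_insert span_eq_iff[THEN iffD2])
  moreover have "AE L in \<nu>. L \<inter> span (insert z U) = {0}"
    using U(3) z AE_space
  proof eventually_elim
    fix L assume L: "L \<inter> U = {0}" "z \<notin> S L" "L \<in> space \<nu>"
    have sL: "subspace L" using L(3) space_grass[OF \<nu>] by (auto dest: grassD)
    have "y = 0" if y: "y \<in> L" "y \<in> span (insert z U)" for y
    proof -
      obtain k where k: "y - k *\<^sub>R z \<in> U"
        using y(2) U(1) by (auto simp: span_breakdown_eq span_eq_iff[THEN iffD2])
      \<comment> \<open>A nonzero coefficient would write \<open>z\<close> as a vector of
        \<open>L\<close> plus one of \<open>U\<close>.\<close>
      have "k = 0"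
      proof (rule ccontr)
        assume "k \<noteq> 0"
        have "(1/k) *\<^sub>R y \<in> L" "(-1/k) *\<^sub>R (y - k *\<^sub>R z) \<in> U"
          using y(1) k sL U(1) by (blast intro: subspace_scale)+
        moreover have "z = (1/k) *\<^sub>R y + (-1/k) *\<^sub>R (y - k *\<^sub>R z)"
          using \<open>k \<noteq> 0\<close> by (simp add: algebra_simps)
        ultimately show False using L(2) unfolding S_def by blast
      qed
      then show ?thesis using k y L(1) by auto
    qed
    then show "L \<inter> span (insert z U) = {0}"
      using sL by (auto intro: subspace_0 span_zero)
  qed
  ultimately show ?case by (intro exI[of _ "span (insert z U)"]) auto
qed

text \<open>\<open>U\<close> is chosen complementary to almost every \<open>L\<close>. Any
  \<open>M\<close> containing it still satisfies \<open>L + M = UNIV\<close>, and the dimension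
  formula then fixes \<open>dim (L \<inter> M)\<close>.\<close>

lemma exists_subspace_generic_intersection:
  fixes \<nu> :: "(real^'n) set measure"
  assumes \<nu>: "sets \<nu> = sets (grass_space q)" and "prob_space \<nu>" and d: "CARD('n) \<le> q + d" "d \<le> CARD('n)" "q \<le> CARD('n)"
  shows "\<exists>M. subspace M \<and> dim M = d \<and> (AE L in \<nu>. dim (L \<inter> M) = q + d - CARD('n))"
proof -
  obtain U :: "(real^'n) set" where U: "subspace U" "dim U = CARD('n) - q" "AE L in \<nu>. L \<inter> U = {0}"
    using exists_generic_subspace[OF assms(1,2), of "CARD('n) - q"] d by auto
  obtain b where b: "orthonormal CARD('n) b" "span (b ` {..<dim U}) = U"
    using orthonormal_basis_flag[OF U(1) U(1) subset_refl] by auto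
  define M where "M = span (b ` {..<d})"
  have M: "subspace M" "dim M = d" "U \<subseteq> M"
  proof -
    have "b ` {..<dim U} \<subseteq> b ` {..<d}" using U d by (intro image_mono) auto
    from span_mono[OF this] show "U \<subseteq> M" unfolding b(2) M_def .
    show "dim M = d" unfolding M_def by (rule orthonormal_dim_span[OF orthonormal_mono[OF b(1) d(2)]])
  qed (simp add: M_def)
  have "AE L in \<nu>. dim (L \<inter> M) = q + d - CARD('n)"
    using U(3) AE_space
  proof eventually_elim
    fix L assume L: "L \<inter> U = {0}" "L \<in> space \<nu>"
    have sL: "subspace L" "dim L = q" using L(2) space_grass[OF \<nu>] by (auto dest: grassD)
    have "dim {x + y |x y. x \<in> L \<and> y \<in> U} = CARD('n)"
      using dim_sums_Int[OF sL(1) U(1)] L(1) sL(2) U(2) d by simp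
    moreover have "dim {x + y |x y. x \<in> L \<and> y \<in> U} \<le> dim {x + y |x y. x \<in> L \<and> y \<in> M}"
      using M(3) by (intro dim_subset) auto
    moreover have "dim {x + y |x y. x \<in> L \<and> y \<in> M} \<le> CARD('n)"
      using dim_subset_UNIV[of "{x + y |x y. x \<in> L \<and> y \<in> M}"] by simp
    ultimately show "dim (L \<inter> M) = q + d - CARD('n)"
      using dim_sums_Int[OF sL(1) M(1)] sL(2) M(2) by simp
  qed
  then show ?thesis using M by blast
qed

section \<open>Distances of sections from the origin\<close>

text \<open>For nonzero \<open>u\<close> in \<open>M\<close> this is the section of \<open>L\<close>
  with the affine hyperplane of \<open>M\<close> whose point nearest to the origin is
  \<open>u\<close>. A linear \<open>M\<close> and a vector \<open>u\<close> are kept as data because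
  \<open>u\<close> is later averaged inside a fixed subspace.\<close>

definition slice :: "'a::real_inner set \<Rightarrow> 'a \<Rightarrow> 'a set \<Rightarrow> 'a set" where
  "slice M u L = {y \<in> L \<inter> M. y \<bullet> u = u \<bullet> u}"

text \<open>If \<open>u\<close> is orthogonal to \<open>V = L \<inter> M\<close> and nonzero, the slice is empty; both sides are then \<open>0\<close>.\<close>
lemma infdist_slice:
  fixes L M :: "'a::euclidean_space set"
  assumes "subspace L" "subspace M"
  shows "infdist 0 (slice M u L) = (norm u)\<^sup>2 / norm (closest_point (L \<inter> M) u)"
proof -
  let ?V = "L \<inter> M" let ?p = "closest_point ?V u"
  have V: "subspace ?V" using assms by (rule subspace_inter)
  have p: "?p \<in> ?V" by (rule closest_point_subspace(1)[OF V])
  have dot: "y \<bullet> u = y \<bullet> ?p" if "y \<in> ?V" for y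
    using closest_point_subspace(2)[OF V that, of u] by (simp add: inner_diff_left inner_commute[of y])
  show ?thesis
  proof (cases "?p = 0")
    case True
    show ?thesis
    proof (cases "u = 0")
      case True
      have "0 \<in> slice M u L" using True subspace_0[OF V] by (auto simp: slice_def)
      then show ?thesis using True by (simp)
    next
      case False
      then have "slice M u L = {}" using dot True by (auto simp: slice_def)
      then show ?thesis using True by (simp add: infdist_def)
    qed
  next
    case False
    \<comment> \<open>The multiple of the projection that meets the defining equation of the slice;
      Cauchy-Schwarz shows below that no point of the slice is closer to the origin.\<close>
    let ?y = "((norm u)\<^sup>2 / (norm ?p)\<^sup>2) *\<^sub>R ?p"
    have y: "?y \<in> slice M u L"
    proof -
      have yV: "?y \<in> ?V" by (rule subspace_scale[OF V p])
      have "?y \<bullet> u = u \<bullet> u"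
        using dot[OF yV] False by (simp add: dot_square_norm)
      then show ?thesis using yV by (simp add: slice_def)
    qed
    have ny: "norm ?y = (norm u)\<^sup>2 / norm ?p"
      using False by (simp add: power2_eq_square)
    have "infdist 0 (slice M u L) \<le> (norm u)\<^sup>2 / norm ?p"
      using infdist_le[OF y, of 0] ny by (simp del: norm_scaleR)
    moreover have "(norm u)\<^sup>2 / norm ?p \<le> infdist 0 (slice M u L)"
    proof -
      have "(norm u)\<^sup>2 / norm ?p \<le> dist 0 y" if "y \<in> slice M u L" for y
      proof -
        have "(norm u)\<^sup>2 = y \<bullet> ?p" using that dot[of y] by (auto simp: slice_def dot_square_norm)
        also have "\<dots> \<le> norm y * norm ?p" by (rule norm_cauchy_schwarz)
        finally show ?thesis using False by (simp add: divide_le_eq)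
      qed
      then show ?thesis using y by (auto simp: infdist_def intro!: cINF_greatest)
    qed
    ultimately show ?thesis by simp
  qed
qed

lemma infdist_norm_preserving_image:
  fixes f :: "'a::real_normed_vector \<Rightarrow> 'b::real_normed_vector"
  assumes "\<And>y. norm (f y) = norm y"
  shows "infdist 0 (f ` S) = infdist 0 S"
  using assms by (simp add: infdist_def image_image)

lemma slice_orthogonal_image:
  fixes f :: "'a::euclidean_space \<Rightarrow> 'a"
  assumes "orthogonal_transformation f"
  shows "slice (f ` M) (f u) (f ` L) = f ` slice M u L"
proof -
  have "f x = f y \<longleftrightarrow> x = y" for x y
    using orthogonal_transformation_inj[OF assms] by (auto simp: inj_on_def)
  then show ?thesis
    using assms by (fastforce simp: slice_def orthogonal_transformation_def)
qed

lemma translate_Int_eq_slice: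
  fixes M L :: "'a::euclidean_space set"
  assumes M: "subspace M" and x: "\<And>y. y \<in> M \<Longrightarrow> x \<bullet> y = 0" "x \<noteq> 0"
  shows "(\<lambda>y. y + x) ` M \<inter> L = slice (span (insert x M)) x L"
proof -
  have "w \<in> (\<lambda>y. y + x) ` M \<longleftrightarrow> w \<in> span (insert x M) \<and> w \<bullet> x = x \<bullet> x" for w
  proof
    assume "w \<in> (\<lambda>y. y + x) ` M"
    then obtain y where y: "y \<in> M" "w = y + x" by auto
    then show "w \<in> span (insert x M) \<and> w \<bullet> x = x \<bullet> x"
      using x(1)[of y] by (auto simp: inner_add_left inner_commute[of y] intro!: span_add intro: span_base)
  next
    assume w: "w \<in> span (insert x M) \<and> w \<bullet> x = x \<bullet> x"
    then obtain k where k: "w - k *\<^sub>R x \<in> M"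
      using M by (auto simp: span_breakdown_eq span_eq_iff[THEN iffD2])
    \<comment> \<open>Pairing with \<open>x\<close> removes the component in \<open>M\<close>, which
      forces the coefficient of \<open>x\<close> to be 1.\<close>
    have "x \<bullet> (w - k *\<^sub>R x) = 0" using x(1)[OF k] .
    then have "(1 - k) * (x \<bullet> x) = 0" using w by (simp add: inner_diff_right inner_commute algebra_simps)
    then have "k = 1" using x(2) by simp
    then show "w \<in> (\<lambda>y. y + x) ` M" using k by (auto intro!: image_eqI[of _ _ "w - x"])
  qed
  then show ?thesis by (auto simp: slice_def)
qed

section \<open>Invariance of the distance under rotations, and its average\<close>

lemma rotationD:
  assumes "rotation f" shows "orthogonal_transformation f" "linear f" "\<And>y. norm (f y) = norm y"
  using assms by (auto simp: rotation_def orthogonal_transformation_linear orthogonal_transformation_norm)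

lemma subspace_rotation: "rotation f \<Longrightarrow> subspace L \<Longrightarrow> subspace (f ` L)"
  by (rule linear_subspace_image[OF rotationD(2)])

lemma grass_rotation:
  assumes "rotation f" "L \<in> grass k" shows "f ` L \<in> grass k"
proof -
  have "inj_on f (span L)"
    using orthogonal_transformation_inj[OF rotationD(1)[OF assms(1)]] by (rule inj_on_subset) simp
  then show ?thesis
    using assms subspace_rotation[OF assms(1)] dim_image_eq[of f L] rotationD(2)[OF assms(1)]
    by (auto simp: grass_def)
qed

text \<open>Rotating a subspace conjugates its projection matrix by \<open>f\<close> and its inverse
  \<open>g\<close>, which is continuous in \<open>proj_mat L\<close>.\<close>

lemma measurable_rotation_grass:
  fixes \<nu> :: "(real^'n) set measure"
  assumes \<nu>: "sets \<nu> = sets (grass_space k)" and f: "rotation f"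
  shows "(\<lambda>L. f ` L) \<in> measurable \<nu> (grass_space k)"
proof (rule measurable_grass_spaceI[OF refl])
  show "(\<lambda>L. f ` L) \<in> space \<nu> \<rightarrow> grass k"
    using space_grass[OF \<nu>] grass_rotation[OF f] by auto
  obtain g where g: "orthogonal_transformation g" "\<And>x. f (g x) = x" "\<And>x. g (f x) = x"
    using orthogonal_transformation_inv[OF rotationD(1)[OF f]] orthogonal_transformation_bij[OF rotationD(1)[OF f]]
    by (metis bij_inv_eq_iff)
  have eq: "proj_mat (f ` L) = matrix f ** proj_mat L ** matrix g" if L: "L \<in> grass k" for L
  proof -
    have sL: "subspace L" using L by (rule grassD)
    have "closest_point (f ` L) z = f (closest_point L (g z))" for z
    proof (rule closest_point_subspaceI[OF subspace_rotation[OF f sL]])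
      show "f (closest_point L (g z)) \<in> f ` L" by (simp add: closest_point_subspace sL)
      fix y assume "y \<in> f ` L"
      then obtain w where w: "w \<in> L" "y = f w" by auto
      have "(f (g z) - f (closest_point L (g z))) \<bullet> f w = (g z - closest_point L (g z)) \<bullet> w"
        using rotationD(1,2)[OF f] by (simp add: orthogonal_transformation_def linear_diff[symmetric])
      then show "(z - f (closest_point L (g z))) \<bullet> y = 0"
        using closest_point_subspace(2)[OF sL w(1), of "g z"] w g by simp
    qed
    then have "closest_point (f ` L) = f \<circ> (closest_point L \<circ> g)" by auto
    then show ?thesis
      unfolding proj_mat_def
      using rotationD(2)[OF f] orthogonal_transformation_linear[OF g(1)] linear_closest_point_subspace[OF sL]
      by (simp add: matrix_compose linear_compose matrix_mul_assoc)
  qed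
  have "(\<lambda>L. matrix f ** proj_mat L ** matrix g) \<in> borel_measurable \<nu>"
    by (rule borel_measurable_continuous_on[OF _ proj_mat_measurable[OF \<nu>]])
       (auto simp: matrix_matrix_mult_def intro!: continuous_intros)
  also have "?this \<longleftrightarrow> (\<lambda>L. proj_mat (f ` L)) \<in> borel_measurable \<nu>"
    using space_grass[OF \<nu>] by (intro measurable_cong) (simp add: eq)
  finally show "(\<lambda>L. proj_mat (f ` L)) \<in> borel_measurable \<nu>" .
qed

text \<open>\<open>y \<in> slice M u L\<close> is a closed condition on \<open>y\<close>,
  \<open>u\<close> and the projection matrix of \<open>L\<close>, since lying in \<open>L\<close>
  means being fixed by the matrix.\<close>

lemma measurable_infdist_slice:
  fixes \<nu> :: "(real^'n) set measure"
  assumes \<nu>: "sets \<nu> = sets (grass_space q)" and M: "subspace M"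
    and f: "f \<in> measurable N \<nu>" and u: "u \<in> borel_measurable N"
  shows "(\<lambda>x. infdist 0 (slice M (u x) (f x))) \<in> borel_measurable N"
proof -
  have cl: "closed {(y, a :: (real^'n^'n) \<times> (real^'n)). y \<in> M \<and> fst a *v y = y \<and> y \<bullet> snd a = snd a \<bullet> snd a}"
    unfolding case_prod_unfold
    by (intro closed_Collect_conj closed_Collect_eq closed_vimage[of M fst, unfolded vimage_def] closed_subspace M
        continuous_on_matrix_vector_mult continuous_intros)
  have "(\<lambda>x. (proj_mat (f x), u x)) \<in> borel_measurable N"
    by (intro borel_measurable_Pair u measurable_compose[OF f] proj_mat_measurable[OF \<nu>])
  from measurable_compose[OF this borel_measurable_infdist_closed[OF cl]]
  have "(\<lambda>x. infdist 0 {y. y \<in> M \<and> proj_mat (f x) *v y = y \<and> y \<bullet> u x = u x \<bullet> u x}) \<in> borel_measurable N"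
    by simp
  also have "?this \<longleftrightarrow> ?thesis"
  proof (rule measurable_cong)
    fix x assume "x \<in> space N"
    then have "subspace (f x)" using measurable_space[OF f] space_grass[OF \<nu>] by (auto dest: grassD)
    then show "infdist 0 {y. y \<in> M \<and> proj_mat (f x) *v y = y \<and> y \<bullet> u x = u x \<bullet> u x} = infdist 0 (slice M (u x) (f x))"
      by (intro arg_cong[where f="infdist 0"]) (auto simp: slice_def proj_mat_mult closest_point_subspace_iff)
  qed
  finally show ?thesis .
qed

text \<open>By invariance \<open>L\<close> may be replaced by its image under \<open>f\<close>; then
  \<open>f\<close> acts on the whole slice and does not change its distance from the origin.\<close>

lemma nn_integral_slice_invariant:
  fixes \<nu> :: "(real^'n) set measure"
  assumes \<nu>: "grass_invariant_prob q \<nu>" and f: "rotation f" and M: "subspace M"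
    and [measurable]: "g \<in> borel_measurable borel"
  shows "(\<integral>\<^sup>+L. g (infdist 0 (slice (f ` M) (f u) L)) \<partial>\<nu>) = (\<integral>\<^sup>+L. g (infdist 0 (slice M u L)) \<partial>\<nu>)"
proof -
  have s: "sets \<nu> = sets (grass_space q)" and inv: "distr \<nu> (grass_space q) (\<lambda>L. f ` L) = \<nu>"
    using \<nu> f by (auto simp: grass_invariant_prob_def)
  have [measurable]: "(\<lambda>L. infdist 0 (slice (f ` M) (f u) L)) \<in> borel_measurable (grass_space q)"
    by (rule measurable_infdist_slice[OF refl[of "sets (grass_space q)"] subspace_rotation[OF f M]]) auto
  have "(\<integral>\<^sup>+L. g (infdist 0 (slice (f ` M) (f u) L)) \<partial>\<nu>)
     = (\<integral>\<^sup>+L. g (infdist 0 (slice (f ` M) (f u) L)) \<partial>distr \<nu> (grass_space q) (\<lambda>L. f ` L))"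
    by (simp add: inv)
  also have "\<dots> = (\<integral>\<^sup>+L. g (infdist 0 (slice (f ` M) (f u) (f ` L))) \<partial>\<nu>)"
    by (rule nn_integral_distr[OF measurable_rotation_grass[OF s f]]) measurable
  also have "\<dots> = (\<integral>\<^sup>+L. g (infdist 0 (slice M u L)) \<partial>\<nu>)"
    using f by (simp add: slice_orthogonal_image rotationD infdist_norm_preserving_image)
  finally show ?thesis .
qed

text \<open>This is the total weight of the averaging over \<open>z\<close>. The case that
  \<open>M\<close> is the whole space is included, with second factor \<open>kappa 0\<close>; it
  occurs when the flat is a hyperplane.\<close>

lemma nn_integral_cylinder_ball:
  fixes M :: "'a::euclidean_space set"
  assumes M: "subspace M"
  shows "(\<integral>\<^sup>+z. indicator {..1} (norm (closest_point M z)) * indicator {..1} (norm (z - closest_point M z)) \<partial>lborel)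
    = ennreal (kappa (dim M)) * ennreal (kappa (DIM('a) - dim M))"
proof -
  let ?n = "DIM('a)" and ?d = "dim M"
  note [measurable] = borel_measurable_closest_point_subspace[OF M]
  obtain b where b: "orthonormal ?n b" "span (b ` {..<?d}) = M"
    using orthonormal_basis_flag[OF M M subset_refl] by metis
  have le: "?d \<le> ?n" by (rule dim_subset_UNIV)
  have cpM: "closest_point M ((\<Sum>i<?d. x i *\<^sub>R b i) + (\<Sum>i=?d..<?n. y i *\<^sub>R b i)) = (\<Sum>i<?d. x i *\<^sub>R b i)" for x y
    using closest_point_orthonormal[OF b(1) le(1), of "merge {..<?d} {?d..<?n} (x, y)"]
    by (simp add: b sum_lt_split[OF le(1)] sum_merge_lt[where g="\<lambda>c i. c *\<^sub>R b i"] sum_merge_ge[where g="\<lambda>c i. c *\<^sub>R b i"])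
  have nrm: "norm (\<Sum>i=?d..<?n. y i *\<^sub>R b i) = sqrt (\<Sum>i=?d..<?n. (y i)\<^sup>2)"
    "norm (\<Sum>i<?d. y i *\<^sub>R b i) = sqrt (\<Sum>i<?d. (y i)\<^sup>2)" for y
    by (rule norm_sum_orthonormal[OF b(1)], use le in auto)+
  have "(\<integral>\<^sup>+z. indicator {..1} (norm (closest_point M z)) * indicator {..1} (norm (z - closest_point M z)) \<partial>lborel)
    = (\<integral>\<^sup>+x. (\<integral>\<^sup>+y. indicator {..1} (sqrt (\<Sum>i<?d. (x i)\<^sup>2)) * indicator {..1} (sqrt (\<Sum>i=?d..<?n. (y i)\<^sup>2))
        \<partial>Pi\<^sub>M {?d..<?n} (\<lambda>_. lborel)) \<partial>Pi\<^sub>M {..<?d} (\<lambda>_. lborel))"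
    by (subst nn_integral_lborel_orthonormal[OF b(1) _ le(1)]) (auto simp: cpM nrm)
  also have "\<dots> = (\<integral>\<^sup>+x. indicator {..1} (sqrt (\<Sum>i<?d. (x i)\<^sup>2)) * ennreal (kappa (?n - ?d))
        \<partial>Pi\<^sub>M {..<?d} (\<lambda>_. lborel))"
    by (subst nn_integral_cmult) (auto simp: nn_integral_ball_PiM)
  also have "\<dots> = ennreal (kappa ?d) * ennreal (kappa (?n - ?d))"
    by (subst nn_integral_multc) (auto simp: nn_integral_ball_PiM)
  finally show ?thesis .
qed

text \<open>\<open>a\<close> and \<open>b\<close> stand for the norms of the components of a vector
  in \<open>V\<close> (dimension \<open>p\<close>) and in the complement of \<open>V\<close> in the
  larger space (dimension \<open>s\<close>). Rescaled to length \<open>r\<close>, this vector gives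
  a slice at distance \<open>r * sqrt (a\<^sup>2 + b\<^sup>2) / a\<close>. The kernel is not
  normalised: as an integral over a unit ball of dimension \<open>p + s\<close> it carries the
  factor \<open>kappa (p + s)\<close>.\<close>

definition radial_kernel :: "nat \<Rightarrow> nat \<Rightarrow> (real \<Rightarrow> ennreal) \<Rightarrow> real \<Rightarrow> ennreal" where
  "radial_kernel p s g r = (\<integral>\<^sup>+a. radial_weight p a * (\<integral>\<^sup>+b. radial_weight s b *
     (indicator {..1} (sqrt (a\<^sup>2 + b\<^sup>2)) * g (r * sqrt (a\<^sup>2 + b\<^sup>2) / a)) \<partial>lborel) \<partial>lborel)"

lemma radial_kernel_measurable[measurable]:
  assumes [measurable]: "g \<in> borel_measurable borel"
  shows "radial_kernel p s g \<in> borel_measurable borel"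
  unfolding radial_kernel_def[abs_def] by measurable

lemma closest_point_flag:
  fixes V M :: "'a::euclidean_space set"
  assumes "subspace V" "subspace M" "V \<subseteq> M"
  shows "closest_point V (closest_point M z) = closest_point V z"
    and "(norm (closest_point M z))\<^sup>2 = (norm (closest_point V z))\<^sup>2 + (norm (closest_point M z - closest_point V z))\<^sup>2"
proof -
  let ?v = "closest_point V z" and ?m = "closest_point M z"
  have v: "?v \<in> V" by (rule closest_point_subspace(1)[OF assms(1)])
  have orth: "(?m - ?v) \<bullet> y = 0" if "y \<in> V" for y
  proof -
    have "(z - ?v) \<bullet> y = 0" "(z - ?m) \<bullet> y = 0"
      using closest_point_subspace(2) assms that by blast+
    then show ?thesis by (simp add: inner_diff_left)
  qed
  then show "closest_point V ?m = ?v"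
    using v by (intro closest_point_subspaceI[OF assms(1)])
  show "(norm ?m)\<^sup>2 = (norm ?v)\<^sup>2 + (norm (?m - ?v))\<^sup>2"
    using norm_add_Pythagorean[of ?v "?m - ?v"] orth[OF v] by (simp add: orthogonal_def inner_commute)
qed

text \<open>By invariance the left-hand side depends only on \<open>r\<close>, so \<open>u\<close> may be averaged: take
  \<open>u\<close> to be the projection of \<open>z\<close> to \<open>M\<close>, rescaled to length \<open>r\<close>, with \<open>z\<close> ranging over the
  product of the unit balls of \<open>M\<close> and of its orthogonal complement.\<close>
lemma nn_integral_slice:
  fixes \<nu> :: "(real^'n) set measure"
  assumes card: "CARD('n) \<ge> 2" and \<nu>: "grass_invariant_prob q \<nu>"
    and d: "q < CARD('n)" "CARD('n) < q + d" "d \<le> CARD('n)"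
    and M: "subspace M" "dim M = d" and u: "u \<in> M" "norm u = r" "r > 0"
    and g[measurable]: "g \<in> borel_measurable borel"
  shows "(\<integral>\<^sup>+L. g (infdist 0 (slice M u L)) \<partial>\<nu>) * ennreal (kappa d)
    = radial_kernel (q + d - CARD('n)) (CARD('n) - q) g r"
proof -
  let ?n = "CARD('n)" and ?p = "q + d - CARD('n)"
  have s: "sets \<nu> = sets (grass_space q)" and "prob_space \<nu>"
    using \<nu> by (auto simp: grass_invariant_prob_def)
  then interpret prob_space \<nu> by simp
  interpret P: pair_sigma_finite \<nu> "lborel :: (real^'n) measure" by standard
  \<comment> \<open>General position is available for the constructed \<open>M0\<close>, not for the
    given \<open>M\<close>; a rotation connects the two.\<close>
  obtain M0 :: "(real^'n) set" where M0: "subspace M0" "dim M0 = d" "AE L in \<nu>. dim (L \<inter> M0) = ?p"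
    using exists_subspace_generic_intersection[OF s \<open>prob_space \<nu>\<close>, of d] d by auto
  define A where "A = (\<integral>\<^sup>+L. g (infdist 0 (slice M u L)) \<partial>\<nu>)"
  let ?P = "closest_point M0"
  note [measurable] = borel_measurable_closest_point_subspace[OF M0(1)]
  define c where "c z = (r / norm (?P z)) *\<^sub>R ?P z" for z
  have [measurable]: "c \<in> borel_measurable borel" unfolding c_def[abs_def] by measurable
  have [measurable]: "(\<lambda>x. infdist 0 (slice M0 (c (snd x)) (fst x))) \<in> borel_measurable (\<nu> \<Otimes>\<^sub>M lborel)"
    by (rule measurable_infdist_slice[OF s M0(1)]) measurable
  define W :: "real^'n \<Rightarrow> ennreal" where
    "W z = indicator {..1} (norm (?P z)) * indicator {..1} (norm (z - ?P z))" for z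
  have [measurable]: "W \<in> borel_measurable borel" unfolding W_def[abs_def] by measurable
  \<comment> \<open>A rotation carries \<open>M\<close> to \<open>M0\<close> and \<open>u\<close> to
    \<open>c z\<close>, so the value does not depend on \<open>z\<close>. This is where invariance
    enters.\<close>
  have A: "(\<integral>\<^sup>+L. g (infdist 0 (slice M0 (c z) L)) \<partial>\<nu>) = A" if "?P z \<noteq> 0" for z
  proof -
    have "c z \<in> M0" unfolding c_def by (intro subspace_scale closest_point_subspace M0)
    moreover have "norm (c z) = norm u" using that u by (simp add: c_def)
    moreover have "u \<noteq> 0" using u by auto
    ultimately obtain f where f: "rotation f" "f ` M = M0" "f u = c z"
      using rotation_transitive[OF card M(1) M0(1)] M(2) M0(2) u(1) by metis
    show ?thesis
      unfolding A_def using nn_integral_slice_invariant[OF \<nu> f(1) M(1) g, of u] f by simp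
  qed
  \<comment> \<open>The projection vanishes only on the orthogonal complement of \<open>M0\<close>,
    a proper subspace since \<open>d > 0\<close>.\<close>
  have AEz: "AE z in lborel. ?P z \<noteq> 0"
  proof -
    have "AE z in lborel. z \<notin> orthogonal_comp M0"
      by (rule AE_lborel_not_in_subspace) (use d M0 in \<open>auto simp: subspace_orthogonal_comp dim_orthogonal_comp\<close>)
    then show ?thesis
    proof eventually_elim
      fix z assume "z \<notin> orthogonal_comp M0"
      then show "?P z \<noteq> 0"
        using closest_point_subspace(2)[OF M0(1), of _ z]
        by (auto simp: orthogonal_comp_def orthogonal_def inner_commute)
    qed
  qed
  have "A * (ennreal (kappa d) * ennreal (kappa (?n - d))) = (\<integral>\<^sup>+z. W z * A \<partial>lborel)"
    using nn_integral_cylinder_ball[OF M0(1)] M0(2)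
    by (subst nn_integral_multc) (auto simp: W_def[abs_def] mult.commute)
  also have "\<dots> = (\<integral>\<^sup>+z. (\<integral>\<^sup>+L. W z * g (infdist 0 (slice M0 (c z) L)) \<partial>\<nu>) \<partial>lborel)"
  proof (rule nn_integral_cong_AE, use AEz in eventually_elim)
    fix z assume z: "?P z \<noteq> 0"
    have "(\<lambda>L. infdist 0 (slice M0 (c z) L)) \<in> borel_measurable \<nu>"
      by (rule measurable_infdist_slice[OF s M0(1)]) auto
    then show "W z * A = (\<integral>\<^sup>+L. W z * g (infdist 0 (slice M0 (c z) L)) \<partial>\<nu>)"
      unfolding A[OF z, symmetric] by (subst nn_integral_cmult) auto
  qed
  also have "\<dots> = (\<integral>\<^sup>+L. (\<integral>\<^sup>+z. W z * g (infdist 0 (slice M0 (c z) L)) \<partial>lborel) \<partial>\<nu>)"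
    using P.Fubini[of "\<lambda>(L, z). W z * g (infdist 0 (slice M0 (c z) L))"] by (simp add: case_prod_unfold)
  also have "\<dots> = (\<integral>\<^sup>+L. ennreal (kappa (?n - d)) * radial_kernel ?p (?n - q) g r \<partial>\<nu>)"
  proof (rule nn_integral_cong_AE)
    show "AE L in \<nu>. (\<integral>\<^sup>+z. W z * g (infdist 0 (slice M0 (c z) L)) \<partial>lborel)
        = ennreal (kappa (?n - d)) * radial_kernel ?p (?n - q) g r"
      using M0(3) AE_space
    proof eventually_elim
      fix L assume L: "dim (L \<inter> M0) = ?p" "L \<in> space \<nu>"
      have sL: "subspace L" using L(2) space_grass[OF s] by (auto dest: grassD)
      let ?V = "L \<inter> M0"
      have V: "subspace ?V" "?V \<subseteq> M0" using sL M0(1) by (auto intro: subspace_inter)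
      note [measurable] = borel_measurable_closest_point_subspace[OF V(1)]
      have PV: "closest_point ?V (?P z) = closest_point ?V z" for z
        by (rule closest_point_flag[OF V(1) M0(1) V(2)])
      have nP: "norm (?P z) = sqrt ((norm (closest_point ?V z))\<^sup>2 + (norm (?P z - closest_point ?V z))\<^sup>2)" for z
        using closest_point_flag(2)[OF V(1) M0(1) V(2), of z] by (metis norm_ge_zero real_sqrt_unique)
      \<comment> \<open>The squared length \<open>r\<^sup>2\<close> of \<open>c z\<close> is divided
        by the norm of its projection to \<open>?V\<close>, which is \<open>r / norm (?P z)\<close>
        times that of the projection of \<open>z\<close>.\<close>
      have inf: "infdist 0 (slice M0 (c z) L) = r * norm (?P z) / norm (closest_point ?V z)" if z: "?P z \<noteq> 0" for z
      proof -
        have "closest_point ?V (c z) = (r / norm (?P z)) *\<^sub>R closest_point ?V z"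
          unfolding c_def linear_scale[OF linear_closest_point_subspace[OF V(1)]] PV ..
        then show ?thesis
          unfolding infdist_slice[OF sL M0(1)] using z u by (simp add: c_def power2_eq_square)
      qed
      let ?H = "\<lambda>a b. indicator {..1} (sqrt (a\<^sup>2 + b\<^sup>2)) * g (r * sqrt (a\<^sup>2 + b\<^sup>2) / a)"
      have "(\<integral>\<^sup>+z. W z * g (infdist 0 (slice M0 (c z) L)) \<partial>lborel)
        = (\<integral>\<^sup>+z. ?H (norm (closest_point ?V z)) (norm (?P z - closest_point ?V z)) * indicator {..1} (norm (z - ?P z)) \<partial>lborel)"
      proof (rule nn_integral_cong_AE, use AEz in eventually_elim)
        fix z assume z: "?P z \<noteq> 0"
        show "W z * g (infdist 0 (slice M0 (c z) L))
          = ?H (norm (closest_point ?V z)) (norm (?P z - closest_point ?V z)) * indicator {..1} (norm (z - ?P z))"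
          unfolding inf[OF z] W_def nP[symmetric] by (simp add: mult_ac)
      qed
      also have "\<dots> = ennreal (kappa (?n - d)) * radial_kernel ?p (?n - q) g r"
      proof -
        have "d - ?p = ?n - q" using d by simp
        then show ?thesis
          using nn_integral_norm_flag[OF V(1) M0(1) V(2), of ?H] L(1) M0(2) d
          by (simp add: radial_kernel_def)
      qed
      finally show "(\<integral>\<^sup>+z. W z * g (infdist 0 (slice M0 (c z) L)) \<partial>lborel)
        = ennreal (kappa (?n - d)) * radial_kernel ?p (?n - q) g r" .
    qed
  qed
  also have "\<dots> = ennreal (kappa (?n - d)) * radial_kernel ?p (?n - q) g r"
    by (simp add: emeasure_space_1)
  finally have "ennreal (kappa (?n - d)) * (A * ennreal (kappa d)) = ennreal (kappa (?n - d)) * radial_kernel ?p (?n - q) g r"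
    by (simp add: mult_ac)
  then show ?thesis
    using kappa_pos[of "?n - d"] by (simp add: ennreal_mult_cancel_left A_def)
qed

section \<open>Random flats that meet the unit ball\<close>

definition hitting_distribution :: "nat \<Rightarrow> nat \<Rightarrow> (real^'n) set measure \<Rightarrow> (real^'n) set measure" where
  "hitting_distribution k m \<nu> = density (affgrass_measure k \<nu>) (\<lambda>E. indicator (hitting_ball k) E / ennreal (kappa m))"

lemma aff_param_measurable: "aff_param \<in> borel_measurable (affgrass_space k)"
  unfolding affgrass_space_def by (rule measurable_vimage_algebra1) simp

lemma space_affgrass[simp]: "space (affgrass_space k) = affgrass k"
  by (simp add: affgrass_space_def)

lemma sets_affgrass_measure[simp, measurable_cong]: "sets (affgrass_measure k \<nu>) = sets (affgrass_space k)"
  unfolding affgrass_measure_def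
  using sets.space_closed[of "affgrass_space k"] sets.sigma_sets_eq[of "affgrass_space k"]
  by (subst sets_measure_of) auto

lemma sets_hitting_distribution[simp, measurable_cong]: "sets (hitting_distribution k m \<nu>) = sets (affgrass_space k)"
  by (simp add: hitting_distribution_def)

text \<open>A flat meets the unit ball iff its point nearest to the origin lies in it, and this
  point is the residual of the shift vector.\<close>

lemma hitting_ball_translate:
  assumes "L \<in> grass k"
  shows "(\<lambda>y. y + z) ` L \<in> hitting_ball k \<longleftrightarrow> norm (z - closest_point L z) \<le> 1"
proof -
  let ?E = "(\<lambda>y. y + z) ` L"
  have E: "affine ?E" "?E \<noteq> {}" "?E \<in> affgrass k"
    using translate_in_affgrass[OF assms, of z] by (auto simp: affgrass_def)
  have cp: "closest_point ?E 0 = z - closest_point L z"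
    by (rule closest_point_translate_subspace[OF grassD(1)[OF assms]])
  have "?E \<inter> cball 0 1 \<noteq> {} \<longleftrightarrow> norm (closest_point ?E 0) \<le> 1"
    using closest_point_in_set[OF affine_closed[OF E(1)] E(2), of 0]
      closest_point_le[OF affine_closed[OF E(1)], of _ 0]
    by (auto simp: disjoint_iff intro: order_trans)
  then show ?thesis using E(3) by (simp add: hitting_ball_def cp)
qed

lemma hitting_ball_measurable[measurable]: "hitting_ball k \<in> sets (affgrass_space k :: (real^'n) set measure)"
proof -
  have [measurable]: "(\<lambda>E. norm (snd (aff_param E))) \<in> borel_measurable (affgrass_space k :: (real^'n) set measure)"
    by (rule measurable_compose[OF aff_param_measurable]) (intro borel_measurable_continuous_onI continuous_intros)
  have "hitting_ball k = {E \<in> space (affgrass_space k :: (real^'n) set measure). norm (snd (aff_param E)) \<le> 1}"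
  proof -
    have "E \<in> hitting_ball k \<longleftrightarrow> norm (snd (aff_param E)) \<le> 1" if E: "E \<in> affgrass k" for E :: "(real^'n) set"
    proof -
      obtain M where M: "M \<in> grass k" "E = (\<lambda>y. y + closest_point E 0) ` M"
        using affgrass_cases[OF E] .
      show ?thesis
        using hitting_ball_translate[OF M(1), of "closest_point E 0"]
          aff_param_translate[OF grassD(1)[OF M(1)], of "closest_point E 0"] M(2) by simp
    qed
    then show ?thesis by (auto simp: hitting_ball_def)
  qed
  also have "\<dots> \<in> sets (affgrass_space k)" by measurable
  finally show ?thesis .
qed

text \<open>In the image representation the hitting condition confines the component of
  \<open>z\<close> orthogonal to \<open>L\<close> to a unit ball, in addition to the component in
  \<open>L\<close>. If \<open>k + m\<close> is the dimension of the space, the denominator is the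
  product of the volumes of these two balls.\<close>

lemma nn_integral_hitting_distribution:
  fixes \<nu> :: "(real^'n) set measure"
  assumes \<nu>: "sets \<nu> = sets (grass_space k)" and k: "k \<le> CARD('n)"
    and F[measurable]: "F \<in> borel_measurable (affgrass_space k)"
  shows "(\<integral>\<^sup>+E. F E \<partial>hitting_distribution k m \<nu>)
    = (\<integral>\<^sup>+L. (\<integral>\<^sup>+z. indicator {..1} (norm (closest_point L z)) * indicator {..1} (norm (z - closest_point L z))
         * F ((\<lambda>y. y + z) ` L) \<partial>lborel) \<partial>\<nu>) / (ennreal (kappa k) * ennreal (kappa m))"
proof -
  let ?\<kappa> = "ennreal (kappa k)" and ?\<kappa>' = "ennreal (kappa m)"
  define N where "N = \<nu> \<Otimes>\<^sub>M (lborel :: (real^'n) measure)"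
  define w1 w2 :: "(real^'n) set \<times> (real^'n) \<Rightarrow> ennreal" where
    "w1 x = indicator {..1} (norm (closest_point (fst x) (snd x)))"
    and "w2 x = indicator {..1} (norm (snd x - closest_point (fst x) (snd x)))" for x
  define T :: "(real^'n) set \<times> (real^'n) \<Rightarrow> (real^'n) set" where "T x = (\<lambda>y. y + snd x) ` fst x" for x
  have fs: "fst \<in> measurable N \<nu>" and sn[measurable]: "snd \<in> borel_measurable N"
    unfolding N_def by (simp_all add: measurable_fst measurable_snd'')
  have cp[measurable]: "(\<lambda>x. closest_point (fst x) (snd x)) \<in> borel_measurable N"
    by (rule measurable_closest_point_grass[OF \<nu> fs sn])
  have [measurable]: "w1 \<in> borel_measurable N" "w2 \<in> borel_measurable N"
    unfolding w1_def[abs_def] w2_def[abs_def] by measurable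
  have T[measurable]: "T \<in> measurable N (affgrass_space k)"
    unfolding T_def[abs_def] by (rule measurable_translate[OF \<nu> fs sn])
  have FT[measurable]: "(\<lambda>x. F (T x)) \<in> borel_measurable N"
    by (rule measurable_compose[OF T F])
  have cm: "cylinder_measure k \<nu> = density N (\<lambda>x. w1 x / ?\<kappa>)"
    unfolding cylinder_measure_def N_def w1_def case_prod_unfold by (rule refl)
  have T_eq: "(\<lambda>(L, z). (\<lambda>y. y + z) ` L) = T"
    unfolding T_def case_prod_unfold by (rule ext) (rule refl)
  have hb: "indicator (hitting_ball k) (T x) = w2 x" if "x \<in> space N" for x
  proof -
    have "fst x \<in> space \<nu>" using that unfolding N_def space_pair_measure by (rule mem_Times_iff[THEN iffD1, THEN conjunct1])
    then have "fst x \<in> grass k" unfolding space_grass[OF \<nu>] .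
    from hitting_ball_translate[OF this, of "snd x"] show ?thesis
      by (simp only: indicator_def w2_def T_def atMost_iff)
  qed
  have "(\<integral>\<^sup>+E. F E \<partial>hitting_distribution k m \<nu>)
    = (\<integral>\<^sup>+E. indicator (hitting_ball k) E / ?\<kappa>' * F E \<partial>affgrass_measure k \<nu>)"
    unfolding hitting_distribution_def by (rule nn_integral_density) measurable
  also have "\<dots> = (\<integral>\<^sup>+x. indicator (hitting_ball k) (T x) / ?\<kappa>' * F (T x) \<partial>cylinder_measure k \<nu>)"
    unfolding affgrass_measure_eq_distr[OF \<nu> k] T_eq
    by (rule nn_integral_distr) (simp_all add: cm)
  also have "\<dots> = (\<integral>\<^sup>+x. w1 x / ?\<kappa> * (indicator (hitting_ball k) (T x) / ?\<kappa>' * F (T x)) \<partial>N)"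
    unfolding cm by (rule nn_integral_density) measurable
  also have "\<dots> = (\<integral>\<^sup>+x. w1 x * w2 x * F (T x) / (?\<kappa> * ?\<kappa>') \<partial>N)"
    using kappa_pos[of k] kappa_pos[of m]
    by (intro nn_integral_cong) (simp add: hb divide_ennreal_def ennreal_inverse_mult mult_ac)
  also have "\<dots> = (\<integral>\<^sup>+x. w1 x * w2 x * F (T x) \<partial>N) / (?\<kappa> * ?\<kappa>')"
    by (rule nn_integral_divide) measurable
  also have "(\<integral>\<^sup>+x. w1 x * w2 x * F (T x) \<partial>N) = (\<integral>\<^sup>+L. (\<integral>\<^sup>+z. w1 (L, z) * w2 (L, z) * F (T (L, z)) \<partial>lborel) \<partial>\<nu>)"
  proof -
    have "(\<lambda>x. w1 x * w2 x * F (T x)) \<in> borel_measurable N" by measurable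
    from lborel.nn_integral_fst[OF this[unfolded N_def]] show ?thesis by (simp add: N_def)
  qed
  finally show ?thesis by (simp add: w1_def w2_def T_def)
qed

text \<open>A point lies in \<open>E \<inter> L\<close> iff it is fixed by the matrix of
  \<open>L\<close> and its difference from the foot point of \<open>E\<close> is fixed by the matrix
  of the direction of \<open>E\<close>. This is a closed condition jointly in all these
  data.\<close>

lemma measurable_infdist_Int:
  fixes \<nu> :: "(real^'n) set measure"
  assumes \<nu>: "sets \<nu> = sets (grass_space q)" and N: "sets N = sets (affgrass_space k :: (real^'n) set measure)"
  shows "(\<lambda>(L, E). infdist 0 (E \<inter> L)) \<in> borel_measurable (\<nu> \<Otimes>\<^sub>M N)"
proof -
  have cl: "closed {(y, a :: (real^'n^'n) \<times> (real^'n^'n) \<times> (real^'n)).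
      fst a *v y = y \<and> fst (snd a) *v (y - snd (snd a)) = y - snd (snd a)}"
    unfolding case_prod_unfold
    by (intro closed_Collect_conj closed_Collect_eq continuous_on_matrix_vector_mult continuous_intros)
  have ap: "aff_param \<in> borel_measurable N"
    using aff_param_measurable by (simp add: N cong: measurable_cong_sets)
  have "(\<lambda>x. (proj_mat (fst x), aff_param (snd x))) \<in> borel_measurable (\<nu> \<Otimes>\<^sub>M N)"
    by (rule borel_measurable_Pair[OF measurable_compose[OF measurable_fst proj_mat_measurable[OF \<nu>]] measurable_compose[OF measurable_snd ap]])
  from measurable_compose[OF this borel_measurable_infdist_closed[OF cl]]
  have "(\<lambda>x. infdist 0 {y. proj_mat (fst x) *v y = y \<and> fst (aff_param (snd x)) *v (y - snd (aff_param (snd x))) = y - snd (aff_param (snd x))})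
      \<in> borel_measurable (\<nu> \<Otimes>\<^sub>M N)" (is "?f \<in> _")
    by simp
  also have "?f \<in> borel_measurable (\<nu> \<Otimes>\<^sub>M N) \<longleftrightarrow> ?thesis"
  proof (rule measurable_cong)
    fix x assume x: "x \<in> space (\<nu> \<Otimes>\<^sub>M N)"
    obtain L E where LE: "x = (L, E)" by (cases x)
    have "L \<in> space \<nu>" "E \<in> space N" using x unfolding LE space_pair_measure by auto
    then have L: "L \<in> grass q" and E: "E \<in> affgrass k"
      using space_grass[OF \<nu>] sets_eq_imp_space_eq[OF N] by auto
    let ?p = "closest_point E 0"
    obtain M where M: "M \<in> grass k" "E = (\<lambda>y. y + ?p) ` M" "aff_param E = (proj_mat M, ?p)"
      using affgrass_cases[OF E] .
    have "y \<in> E \<longleftrightarrow> y - ?p \<in> M" for y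
      by (subst M(2)) (auto intro!: image_eqI[of _ _ "y - ?p"])
    then have "E \<inter> L = {y. proj_mat L *v y = y \<and> proj_mat M *v (y - ?p) = y - ?p}"
      using grassD(1)[OF L] grassD(1)[OF M(1)] by (auto simp: proj_mat_mult closest_point_subspace_iff)
    then show "?f x = (case x of (L, E) \<Rightarrow> infdist 0 (E \<inter> L))"
      by (simp add: LE M(3))
  qed
  finally show ?thesis .
qed

lemma prob_space_hitting_distribution:
  fixes \<nu> :: "(real^'n) set measure"
  assumes \<nu>: "sets \<nu> = sets (grass_space k)" "prob_space \<nu>" and k: "k + m = CARD('n)"
  shows "prob_space (hitting_distribution k m \<nu>)"
proof
  interpret prob_space \<nu> by fact
  have "emeasure (hitting_distribution k m \<nu>) (space (hitting_distribution k m \<nu>)) = (\<integral>\<^sup>+E. 1 \<partial>hitting_distribution k m \<nu>)"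
    by simp
  also have "\<dots> = (\<integral>\<^sup>+L. (\<integral>\<^sup>+z. indicator {..1} (norm (closest_point L z)) * indicator {..1} (norm (z - closest_point L z)) \<partial>lborel) \<partial>\<nu>)
      / (ennreal (kappa k) * ennreal (kappa m))"
    using nn_integral_hitting_distribution[OF \<nu>(1), of "\<lambda>_. 1" m] k by simp
  also have "(\<integral>\<^sup>+L. (\<integral>\<^sup>+z. indicator {..1} (norm (closest_point L z)) * indicator {..1} (norm (z - closest_point L z)) \<partial>lborel) \<partial>\<nu>)
      = (\<integral>\<^sup>+L. ennreal (kappa k) * ennreal (kappa m) \<partial>\<nu>)"
  proof (rule nn_integral_cong)
    fix L assume "L \<in> space \<nu>"
    then have L: "L \<in> grass k" using space_grass[OF \<nu>(1)] by simp
    have "CARD('n) - k = m" using k by simp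
    then show "(\<integral>\<^sup>+z. indicator {..1} (norm (closest_point L z)) * indicator {..1} (norm (z - closest_point L z)) \<partial>lborel)
       = ennreal (kappa k) * ennreal (kappa m)"
      using nn_integral_cylinder_ball[OF grassD(1)[OF L]] grassD(2)[OF L] by simp
  qed
  also have "\<dots> = ennreal (kappa k) * ennreal (kappa m)" by (simp add: emeasure_space_1)
  also have "ennreal (kappa k) * ennreal (kappa m) / (ennreal (kappa k) * ennreal (kappa m)) = 1"
    using kappa_pos[of k] kappa_pos[of m] by (simp add: ennreal_mult[symmetric] ennreal_divide_self)
  finally show "emeasure (hitting_distribution k m \<nu>) (space (hitting_distribution k m \<nu>)) = 1" .
qed

text \<open>Conditioning on the flat \<open>E = M + x\<close> with residual \<open>x\<close>: the
  integral over \<open>L\<close> is the kernel at \<open>norm x\<close> divided by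
  \<open>kappa (k + 1)\<close>, the volume from averaging in the span of \<open>M\<close> and
  \<open>x\<close>. The norm of \<open>x\<close> has the polar weight of dimension \<open>m\<close>,
  cut off at 1 and normalised by \<open>kappa m\<close>.\<close>

lemma nn_integral_distance:
  fixes \<nu>q \<nu>E :: "(real^'n) set measure"
  assumes card: "CARD('n) \<ge> 2" and q: "q < CARD('n)" "\<gamma> < q"
    and \<nu>q: "grass_invariant_prob q \<nu>q" and \<nu>E: "sets \<nu>E = sets (grass_space k)" "prob_space \<nu>E"
    and k: "k = CARD('n) - q + \<gamma>" and m: "m = q - \<gamma>"
    and g[measurable]: "g \<in> borel_measurable borel"
  shows "(\<integral>\<^sup>+x. g (case x of (L, E) \<Rightarrow> infdist 0 (E \<inter> L)) \<partial>(\<nu>q \<Otimes>\<^sub>M hitting_distribution k m \<nu>E))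
      * (ennreal (kappa m) * ennreal (kappa (k + 1)))
    = (\<integral>\<^sup>+r. radial_weight m r * (indicator {..1} r * radial_kernel (\<gamma> + 1) (CARD('n) - q) g r) \<partial>lborel)"
proof -
  let ?n = "CARD('n)" and ?D = "hitting_distribution k m \<nu>E"
  let ?K = "radial_kernel (\<gamma> + 1) (?n - q) g"
  define J where "J = (\<integral>\<^sup>+r. radial_weight m r * (indicator {..1} r * ?K r) \<partial>lborel)"
  have km: "k + m = ?n" "k < ?n" "?n - k = m" using q k m by auto
  have s: "sets \<nu>q = sets (grass_space q)" and "prob_space \<nu>q"
    using \<nu>q by (auto simp: grass_invariant_prob_def)
  interpret Q: prob_space \<nu>q by fact
  interpret E: prob_space \<nu>E by fact
  interpret D: prob_space ?D by (rule prob_space_hitting_distribution[OF \<nu>E km(1)])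
  interpret P: pair_sigma_finite \<nu>q ?D by standard
  interpret P': pair_sigma_finite ?D \<nu>q by standard
  have X[measurable]: "(\<lambda>(L, E). infdist 0 (E \<inter> L)) \<in> borel_measurable (\<nu>q \<Otimes>\<^sub>M ?D)"
    by (rule measurable_infdist_Int[OF s]) simp
  have gX: "(\<lambda>x. g (case x of (L, E) \<Rightarrow> infdist 0 (E \<inter> L))) \<in> borel_measurable (\<nu>q \<Otimes>\<^sub>M ?D)"
    by (rule measurable_compose[OF X g])
  define \<Phi> where "\<Phi> E = (\<integral>\<^sup>+L. g (infdist 0 (E \<inter> L)) \<partial>\<nu>q)" for E
  have "\<Phi> \<in> borel_measurable ?D"
    using Q.borel_measurable_nn_integral_fst[OF measurable_compose[OF measurable_pair_swap' gX]]
    by (simp add: \<Phi>_def[abs_def])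
  then have \<Phi>[measurable]: "\<Phi> \<in> borel_measurable (affgrass_space k)"
    by (simp cong: measurable_cong_sets)
  have "(\<integral>\<^sup>+x. g (case x of (L, E) \<Rightarrow> infdist 0 (E \<inter> L)) \<partial>(\<nu>q \<Otimes>\<^sub>M ?D)) = (\<integral>\<^sup>+E. \<Phi> E \<partial>?D)"
    using P.nn_integral_snd[OF gX] by (simp add: \<Phi>_def)
  also have "\<dots> = (\<integral>\<^sup>+M. (\<integral>\<^sup>+z. indicator {..1} (norm (closest_point M z)) * indicator {..1} (norm (z - closest_point M z))
         * \<Phi> ((\<lambda>y. y + z) ` M) \<partial>lborel) \<partial>\<nu>E) / (ennreal (kappa k) * ennreal (kappa m))"
    using km by (intro nn_integral_hitting_distribution[OF \<nu>E(1)]) auto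
  also have "(\<integral>\<^sup>+M. (\<integral>\<^sup>+z. indicator {..1} (norm (closest_point M z)) * indicator {..1} (norm (z - closest_point M z))
         * \<Phi> ((\<lambda>y. y + z) ` M) \<partial>lborel) \<partial>\<nu>E) = (\<integral>\<^sup>+M. ennreal (kappa k) * J / ennreal (kappa (k + 1)) \<partial>\<nu>E)"
  proof (rule nn_integral_cong)
    fix M assume "M \<in> space \<nu>E"
    then have MG: "M \<in> grass k" using space_grass[OF \<nu>E(1)] by simp
    note M = grassD[OF MG]
    let ?P = "closest_point M"
    note [measurable] = borel_measurable_closest_point_subspace[OF M(1)]
    have "(\<lambda>_. M) \<in> measurable borel \<nu>E" using \<open>M \<in> space \<nu>E\<close> by (rule measurable_const)
    from measurable_translate[OF \<nu>E(1) this, of "\<lambda>x. x"]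
    have "(\<lambda>z. (\<lambda>y. y + z) ` M) \<in> measurable borel (affgrass_space k)" by simp
    from measurable_compose[OF this \<Phi>] have [measurable]: "(\<lambda>z. \<Phi> ((\<lambda>y. y + z) ` M)) \<in> borel_measurable borel" .
    let ?I = "\<integral>\<^sup>+z. indicator {..1} (norm (?P z)) * indicator {..1} (norm (z - ?P z)) * \<Phi> ((\<lambda>y. y + z) ` M) \<partial>lborel"
    have "?I * ennreal (kappa (k + 1))
      = (\<integral>\<^sup>+z. indicator {..1} (norm (?P z)) * indicator {..1} (norm (z - ?P z)) * \<Phi> ((\<lambda>y. y + z) ` M) * ennreal (kappa (k + 1)) \<partial>lborel)"
      by (rule nn_integral_multc[symmetric]) measurable
    also have "\<dots> = (\<integral>\<^sup>+z. indicator {..1} (norm (?P z)) * (indicator {..1} (norm (z - ?P z)) * ?K (norm (z - ?P z))) \<partial>lborel)"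
    proof (rule nn_integral_cong_AE)
      \<comment> \<open>For \<open>z\<close> in \<open>M\<close> the flat passes through the origin
        and the span of \<open>M\<close> and the residual has dimension only \<open>k\<close>; this
        null set is excluded.\<close>
      have "AE z in lborel. z \<notin> M"
        by (rule AE_lborel_not_in_subspace) (use M km in auto)
      then show "AE z in lborel. indicator {..1} (norm (?P z)) * indicator {..1} (norm (z - ?P z)) * \<Phi> ((\<lambda>y. y + z) ` M) * ennreal (kappa (k + 1))
        = indicator {..1} (norm (?P z)) * (indicator {..1} (norm (z - ?P z)) * ?K (norm (z - ?P z)))"
      proof eventually_elim
        fix z assume z: "z \<notin> M"
        define x where "x = z - ?P z"
        have x: "x \<noteq> 0" "\<And>y. y \<in> M \<Longrightarrow> x \<bullet> y = 0"
          using z closest_point_subspace(1)[OF M(1), of z] closest_point_subspace(2)[OF M(1), of _ z] by (auto simp: x_def)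
        have "x \<notin> M" using x by (metis inner_eq_zero_iff)
        have eq: "(\<lambda>y. y + z) ` M = (\<lambda>y. y + x) ` M"
          by (rule translate_subspace_cancel[OF M(1)]) (simp add: x_def closest_point_subspace M)
        have sl: "(\<lambda>y. y + z) ` M \<inter> L = slice (span (insert x M)) x L" for L
          unfolding eq by (rule translate_Int_eq_slice[OF M(1) x(2) x(1)])
        have "dim (span (insert x M)) = k + 1"
          using \<open>x \<notin> M\<close> M by (simp add: dim_insert span_eq_iff[THEN iffD2])
        \<comment> \<open>The dimension of the intersection of \<open>L\<close> with the span of
          \<open>M\<close> and \<open>x\<close> in general position.\<close>
        moreover have "q + (k + 1) - ?n = \<gamma> + 1" using k q by simp
        ultimately have "\<Phi> ((\<lambda>y. y + z) ` M) * ennreal (kappa (k + 1)) = ?K (norm x)"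
          using nn_integral_slice[OF card \<nu>q q(1) _ _ subspace_span _ _ refl _ g, of "k + 1" "insert x M" x] q k km x(1)
          by (simp add: \<Phi>_def sl span_base)
        then show "indicator {..1} (norm (?P z)) * indicator {..1} (norm (z - ?P z)) * \<Phi> ((\<lambda>y. y + z) ` M) * ennreal (kappa (k + 1))
          = indicator {..1} (norm (?P z)) * (indicator {..1} (norm (z - ?P z)) * ?K (norm (z - ?P z)))"
          by (simp only: x_def[symmetric] mult.assoc)
      qed
    qed
    also have "\<dots> = ennreal (kappa k) * J"
      using nn_integral_norm_complement[OF M(1), of "\<lambda>r. indicator {..1} r * ?K r"] M(2) km by (simp add: J_def)
    finally have *: "?I * ennreal (kappa (k + 1)) = ennreal (kappa k) * J" .
    have "?I = ?I * ennreal (kappa (k + 1)) / ennreal (kappa (k + 1))"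
      by (rule ennreal_mult_divide_eq[symmetric]) (use kappa_pos[of "k + 1"] in auto)
    then show "?I = ennreal (kappa k) * J / ennreal (kappa (k + 1))"
      unfolding * .
  qed
  also have "\<dots> = ennreal (kappa k) * J / ennreal (kappa (k + 1))" by (simp add: E.emeasure_space_1)
  finally have "(\<integral>\<^sup>+x. g (case x of (L, E) \<Rightarrow> infdist 0 (E \<inter> L)) \<partial>(\<nu>q \<Otimes>\<^sub>M ?D))
    = ennreal (kappa k) * J / ennreal (kappa (k + 1)) / (ennreal (kappa k) * ennreal (kappa m))" .
  then have "(\<integral>\<^sup>+x. g (case x of (L, E) \<Rightarrow> infdist 0 (E \<inter> L)) \<partial>(\<nu>q \<Otimes>\<^sub>M ?D)) * (ennreal (kappa m) * ennreal (kappa (k + 1)))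
    = ennreal (kappa k) * J / ennreal (kappa (k + 1)) / (ennreal (kappa k) * ennreal (kappa m)) * (ennreal (kappa m) * ennreal (kappa (k + 1)))"
    by (rule arg_cong)
  \<comment> \<open>The quotients are regrouped as products with inverses; they cancel because the
    constants are neither 0 nor infinite.\<close>
  also have "\<dots> = J * ((ennreal (kappa (k + 1)) / ennreal (kappa (k + 1)))
      * ((ennreal (kappa k) * ennreal (kappa m)) / (ennreal (kappa k) * ennreal (kappa m))))"
    by (simp only: divide_ennreal_def mult_ac)
  also have "\<dots> = J"
    using kappa_pos[of k] kappa_pos[of m] kappa_pos[of "k + 1"]
    by (simp add: ennreal_mult[symmetric] ennreal_divide_self)
  finally show ?thesis by (simp add: J_def)
qed

section \<open>The radial integrals\<close>

lemma omega_eq_kappa: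
  assumes "k > 0"
  shows "omega k = real k * kappa k"
proof -
  have k: "real k / 2 \<notin> \<int>\<^sub>\<le>\<^sub>0" using assms by (auto dest: nonpos_Ints_nonpos)
  then have "Gamma (real k / 2) \<noteq> 0" by (simp add: Gamma_eq_zero_iff)
  moreover have "real k / 2 \<noteq> 0" using assms by simp
  ultimately show ?thesis
    unfolding omega_def kappa_def Gamma_plus1[OF k] by (simp add: divide_simps)
qed

text \<open>Continuity from below of the measure with density \<open>F\<close>.\<close>

lemma nn_integral_SUP_indicator:
  fixes F :: "'a \<Rightarrow> ennreal"
  assumes [measurable]: "F \<in> borel_measurable M" "\<And>i::nat. A i \<in> sets M" and "incseq A"
  shows "(SUP i. (\<integral>\<^sup>+x. F x * indicator (A i) x \<partial>M)) = (\<integral>\<^sup>+x. F x * indicator (\<Union>i. A i) x \<partial>M)"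
proof -
  have "(SUP i. emeasure (density M F) (A i)) = emeasure (density M F) (\<Union>i. A i)"
    using assms(3) by (intro SUP_emeasure_incseq) auto
  then show ?thesis by (simp add: emeasure_density)
qed

text \<open>Integrability on \<open>{0..1}\<close> comes from the finite complete Beta integral and
  allows the interval integral in \<open>incomplete_beta\<close> to be read as a nonnegative
  integral. The half-open domain, which differs from the open one by a null set, is the one that the
  later substitution produces.\<close>

lemma beta_integrand_nn_integral:
  assumes ab: "a > 0" "b > 0" and x: "0 < x" "x \<le> 1"
  shows "(\<integral>\<^sup>+t. ennreal (t powr (a - 1) * (1 - t) powr (b - 1)) * indicator {0<..x} t \<partial>lborel) = ennreal (incomplete_beta x a b)"
    and "incomplete_beta x a b \<ge> 0"
    and "incomplete_beta 1 a b = Beta a b"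
proof -
  let ?f = "\<lambda>t::real. t powr (a - 1) * (1 - t) powr (b - 1)"
  have f: "(\<integral>\<^sup>+t. ennreal (?f t * indicator {0..1} t) \<partial>lborel) = ennreal (Beta a b)"
    using nn_integral_has_integral_lebesgue[OF _ has_integral_Beta_real[OF ab]] by (simp add: mult_ac)
  have "integrable lborel (\<lambda>t. ?f t * indicator {0..1} t)"
    by (rule integrableI_nonneg) (auto simp: f)
  then have int1: "set_integrable lborel {0..1} ?f"
    by (simp add: set_integrable_def mult.commute)
  have ib: "incomplete_beta y a b = (LINT t:{0<..<y}|lborel. ?f t)" if "0 < y" for y
  proof -
    have "einterval 0 (ereal y) = {0<..<y}" by (auto simp: einterval_def)
    then show ?thesis
      unfolding incomplete_beta_def using that by (simp add: interval_lebesgue_integral_def)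
  qed
  have nn: "(\<integral>\<^sup>+t. ennreal (?f t * indicator {0<..<y} t) \<partial>lborel) = ennreal (incomplete_beta y a b)" 
    "incomplete_beta y a b \<ge> 0" if y: "0 < y" "y \<le> 1" for y
  proof -
    have "set_integrable lborel {0<..<y} ?f"
      by (rule set_integrable_subset[OF int1]) (use y in auto)
    then show "(\<integral>\<^sup>+t. ennreal (?f t * indicator {0<..<y} t) \<partial>lborel) = ennreal (incomplete_beta y a b)"
      unfolding ib[OF y(1)] set_lebesgue_integral_def set_integrable_def
      by (subst nn_integral_eq_integral) (auto simp: mult.commute)
    show "incomplete_beta y a b \<ge> 0"
      unfolding ib[OF y(1)] set_lebesgue_integral_def by (intro integral_nonneg_AE) auto
  qed
  show "incomplete_beta x a b \<ge> 0" by (rule nn(2)[OF x])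
  have "(\<integral>\<^sup>+t. ennreal (?f t) * indicator {0<..x} t \<partial>lborel) = (\<integral>\<^sup>+t. ennreal (?f t * indicator {0<..<x} t) \<partial>lborel)"
    by (intro nn_integral_cong_AE eventually_mono[OF AE_lborel_singleton[of x]]) (auto simp: indicator_def)
  then show "(\<integral>\<^sup>+t. ennreal (?f t) * indicator {0<..x} t \<partial>lborel) = ennreal (incomplete_beta x a b)"
    using nn(1)[OF x] by simp
  have "ennreal (incomplete_beta 1 a b) = (\<integral>\<^sup>+t. ennreal (?f t * indicator {0<..<1} t) \<partial>lborel)"
    by (rule nn(1)[symmetric]) auto
  also have "\<dots> = (\<integral>\<^sup>+t. ennreal (?f t * indicator {0..1} t) \<partial>lborel)"
    by (intro nn_integral_cong_AE eventually_mono[OF eventually_conj[OF AE_lborel_singleton[of 0] AE_lborel_singleton[of 1]]])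
       (auto simp: indicator_def)
  finally have "ennreal (incomplete_beta 1 a b) = ennreal (Beta a b)" using f by simp
  then show "incomplete_beta 1 a b = Beta a b"
    using nn(2)[of 1] ab by (simp add: ennreal_inj Beta_def Gamma_real_nonneg)
qed

text \<open>The substitution \<open>t = 1 / (1 + \<tau>\<^sup>2)\<close>, first for \<open>\<sigma> = - \<tau> \<in> {-N..-c}\<close> because the
  substitution rule wants an increasing function, then \<open>N \<rightarrow> \<infinity>\<close>.\<close>
lemma nn_integral_beta_substitution:
  fixes c :: real and s l :: nat
  assumes c: "c \<ge> 0" and s: "s \<ge> 1"
  shows "2 * (\<integral>\<^sup>+\<tau>. indicator {c..} \<tau> * (indicator {0<..} \<tau> * ennreal (\<tau> ^ (s - 1) * (1 / sqrt (1 + \<tau>\<^sup>2)) ^ (l + s + 1))) \<partial>lborel)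
    = (\<integral>\<^sup>+t. ennreal (t powr ((l + 1) / 2 - 1) * (1 - t) powr (s / 2 - 1)) * indicator {0<..1 / (1 + c\<^sup>2)} t \<partial>lborel)"
proof -
  let ?f = "\<lambda>t::real. t powr ((l + 1) / 2 - 1) * (1 - t) powr (s / 2 - 1)"
  let ?g = "\<lambda>x::real. 1 / (1 + x\<^sup>2)" let ?g' = "\<lambda>x::real. - 2 * x / (1 + x\<^sup>2)\<^sup>2"
  let ?F = "\<lambda>\<tau>::real. \<tau> ^ (s - 1) * (1 / sqrt (1 + \<tau>\<^sup>2)) ^ (l + s + 1)"
  have pos: "1 + x\<^sup>2 > 0" for x :: real by (simp add: add_pos_nonneg)
  \<comment> \<open>With \<open>\<rho> = sqrt (1 + y\<^sup>2)\<close> one has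
    \<open>t = \<rho> powr (- 2)\<close>, \<open>1 - t = (y / \<rho>) powr 2\<close> and derivative
    \<open>2 * y * \<rho> powr (- 4)\<close>. The exponents of \<open>\<rho>\<close> add up to
    \<open>-(l - 1) - (s - 2) - 4 = -(l + s + 1)\<close>.\<close>
  have key: "?f (?g x) * ?g' x = 2 * ?F (- x)" if x: "x < 0" for x
  proof -
    define y where "y = - x"
    define \<rho> where "\<rho> = sqrt (1 + y\<^sup>2)"
    have y: "y > 0" and \<rho>: "\<rho> > 0" "\<rho>\<^sup>2 = 1 + y\<^sup>2"
      using x pos[of y] by (auto simp: y_def \<rho>_def)
    have gx: "?g x = \<rho> powr (- 2)" "1 - ?g x = (y / \<rho>) powr 2"
    proof -
      have "\<rho> powr (- 2) = 1 / \<rho>\<^sup>2" using \<rho>(1) by (simp add: powr_minus_divide)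
      then show "?g x = \<rho> powr (- 2)" using \<rho>(2) by (simp add: y_def)
      have "(y / \<rho>) powr 2 = y\<^sup>2 / \<rho>\<^sup>2" using y \<rho>(1) by (simp add: power_divide)
      then show "1 - ?g x = (y / \<rho>) powr 2" using \<rho>(2) pos[of y] by (simp add: y_def field_simps)
    qed
    have g'x: "?g' x = 2 * y * \<rho> powr (- 4)"
    proof -
      have "\<rho> powr (- 4) = 1 / (\<rho>\<^sup>2)\<^sup>2" using \<rho>(1) by (simp add: powr_minus_divide flip: power_mult)
      then show ?thesis using \<rho>(2) by (simp add: y_def)
    qed
    have 1: "(\<rho> powr (- 2)) powr ((l + 1) / 2 - 1) = \<rho> powr (- (real l - 1))"
      "((y / \<rho>) powr 2) powr (s / 2 - 1) = (y / \<rho>) powr (real s - 2)"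
    proof -
      have "- 2 * ((real l + 1) / 2 - 1) = - (real l - 1)" "2 * (real s / 2 - 1) = real s - 2"
        by (simp_all add: field_simps)
      then show "(\<rho> powr (- 2)) powr ((l + 1) / 2 - 1) = \<rho> powr (- (real l - 1))"
        "((y / \<rho>) powr 2) powr (s / 2 - 1) = (y / \<rho>) powr (real s - 2)"
        unfolding powr_powr by (simp_all only: of_nat_add of_nat_1)
    qed
    have "?f (?g x) * ?g' x = \<rho> powr (- (real l - 1)) * (y / \<rho>) powr (real s - 2) * (2 * y * \<rho> powr (- 4))"
      unfolding g'x gx(2) unfolding gx(1) 1 ..
    also have "(y / \<rho>) powr (real s - 2) = y powr (real s - 2) * \<rho> powr (- (real s - 2))"
      using y \<rho>(1) powr_minus_divide[of \<rho> "real s - 2"] by (simp add: powr_divide)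
    also have "\<rho> powr (- (real l - 1)) * (y powr (real s - 2) * \<rho> powr (- (real s - 2))) * (2 * y * \<rho> powr (- 4))
       = 2 * (y powr (real s - 2) * y powr 1) * (\<rho> powr (- (real l - 1)) * \<rho> powr (- (real s - 2)) * \<rho> powr (- 4))"
      using y by simp
    also have "\<dots> = 2 * y powr (real s - 1) * \<rho> powr (- (real l + real s + 1))"
      unfolding powr_add[symmetric] by (simp add: algebra_simps)
    also have "y powr (real s - 1) = y ^ (s - 1)"
      using y s by (simp add: powr_realpow[symmetric] of_nat_diff)
    also have "\<rho> powr (- (real l + real s + 1)) = (1 / \<rho>) ^ (l + s + 1)"
    proof -
      have "\<rho> powr (- real (l + s + 1)) = inverse (\<rho> ^ (l + s + 1))"
        unfolding powr_minus using powr_realpow[OF \<rho>(1), of "l + s + 1"] by simp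
      then show ?thesis by (simp add: power_one_over inverse_eq_divide add.commute)
    qed
    finally show ?thesis by (simp add: y_def \<rho>_def)
  qed
  have step: "(\<integral>\<^sup>+t. ennreal (?f t) * indicator {?g (- (c + real N))..?g (- c)} t \<partial>lborel)
      = (\<integral>\<^sup>+x. (indicator {..<0} x * ennreal (2 * ?F (- x))) * indicator {- (c + real N)..- c} x \<partial>lborel)" for N
  proof -
    have "(\<integral>\<^sup>+t. ennreal (?f t * indicator {?g (- (c + real N))..?g (- c)} t) \<partial>lborel)
      = (\<integral>\<^sup>+x. ennreal (?f (?g x) * ?g' x * indicator {- (c + real N)..- c} x) \<partial>lborel)"
    proof (rule nn_integral_substitution)
      show "(?g has_real_derivative ?g' x) (at x)" for x
        using pos[of x] by (auto intro!: derivative_eq_intros simp: power2_eq_square)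
      show "continuous_on {- (c + real N)..- c} ?g'"
        using pos by (intro continuous_intros) (auto simp: less_imp_neq[symmetric])
    qed (use c in \<open>auto simp: set_borel_measurable_def intro!: divide_nonpos_nonneg mult_nonneg_nonneg\<close>)
    also have "\<dots> = (\<integral>\<^sup>+x. (indicator {..<0} x * ennreal (2 * ?F (- x))) * indicator {- (c + real N)..- c} x \<partial>lborel)"
    \<comment> \<open>For \<open>c = 0\<close> the interval contains the point 0, where
      \<open>key\<close> does not apply.\<close>
    proof (intro nn_integral_cong_AE eventually_mono[OF AE_lborel_singleton[of 0]])
      fix x :: real assume "x \<noteq> 0"
      then consider "x < 0" | "x > 0" by linarith
      then show "ennreal (?f (?g x) * ?g' x * indicator {- (c + real N)..- c} x)
         = (indicator {..<0} x * ennreal (2 * ?F (- x))) * indicator {- (c + real N)..- c} x"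
      proof cases
        case 1 show ?thesis unfolding key[OF 1] using 1 by (auto simp: indicator_def)
      next
        case 2 then show ?thesis using c by (auto simp: indicator_def)
      qed
    qed
    finally show ?thesis by (simp add: ennreal_mult'' ennreal_indicator)
  qed
  \<comment> \<open>The left endpoints tend to 0 without reaching it; for given \<open>t\<close> any
    \<open>N\<close> with \<open>1 / t \<le> N\<close> works, because
    \<open>N \<le> N\<^sup>2\<close>.\<close>
  have U1: "(\<Union>N::nat. {?g (- (c + real N))..?g (- c)}) = {0<..1 / (1 + c\<^sup>2)}"
  proof (intro equalityI subsetI)
    fix t assume "t \<in> (\<Union>N::nat. {?g (- (c + real N))..?g (- c)})"
    then obtain N :: nat where N: "?g (- (c + real N)) \<le> t" "t \<le> ?g c" by auto
    have "0 < ?g (- (c + real N))" using pos[of "- (c + real N)"] by simp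
    from less_le_trans[OF this N(1)] N(2) show "t \<in> {0<..1 / (1 + c\<^sup>2)}" by simp
  next
    fix t :: real assume t: "t \<in> {0<..1 / (1 + c\<^sup>2)}"
    obtain N :: nat where N: "1 / t \<le> real N" using real_arch_simple by blast
    have "1 \<le> real N \<or> N = 0" by (cases N) auto
    then have "real N \<le> (real N)\<^sup>2" by (auto simp: power2_eq_square)
    also have "\<dots> \<le> (c + real N)\<^sup>2" using c by (intro power_mono) auto
    finally have "1 / t \<le> 1 + (c + real N)\<^sup>2" using N by simp
    then have "1 \<le> (1 + (c + real N)\<^sup>2) * t" using t by (simp add: pos_divide_le_eq)
    then have "1 / (1 + (c + real N)\<^sup>2) \<le> t" using pos[of "c + real N"] by (simp add: pos_divide_le_eq mult.commute)
    then have "?g (- (c + real N)) \<le> t" unfolding power2_minus .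
    then show "t \<in> (\<Union>N::nat. {?g (- (c + real N))..?g (- c)})" using t by auto
  qed
  have U2: "(\<Union>N::nat. {- (c + real N)..- c}) = {..- c}"
  proof (intro equalityI subsetI)
    fix x assume x: "x \<in> {..- c}"
    obtain N :: nat where "- x - c \<le> real N" using real_arch_simple by blast
    then show "x \<in> (\<Union>N::nat. {- (c + real N)..- c})" using x by (auto intro!: exI[of _ N])
  qed auto
  have "(\<integral>\<^sup>+t. ennreal (?f t) * indicator {0<..1 / (1 + c\<^sup>2)} t \<partial>lborel)
    = (SUP N. \<integral>\<^sup>+t. ennreal (?f t) * indicator {?g (- (c + real N))..?g (- c)} t \<partial>lborel)"
    unfolding U1[symmetric]
  proof (rule nn_integral_SUP_indicator[symmetric])
    show "incseq (\<lambda>N. {?g (- (c + real N))..?g (- c)})"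
    proof (intro incseq_SucI subsetI)
      fix N t assume t: "t \<in> {?g (- (c + real N))..?g (- c)}"
      have "?g (- (c + real (Suc N))) \<le> ?g (- (c + real N))"
        unfolding power2_minus
        by (intro divide_left_mono add_left_mono power_mono mult_pos_pos pos) (use c in auto)
      with t show "t \<in> {?g (- (c + real (Suc N)))..?g (- c)}" by (meson atLeastAtMost_iff order_trans)
    qed
  qed auto
  also have "\<dots> = (SUP N. \<integral>\<^sup>+x. (indicator {..<0} x * ennreal (2 * ?F (- x))) * indicator {- (c + real N)..- c} x \<partial>lborel)"
    unfolding step ..
  also have "\<dots> = (\<integral>\<^sup>+x. (indicator {..<0} x * ennreal (2 * ?F (- x))) * indicator {..- c} x \<partial>lborel)"
    unfolding U2[symmetric]
    by (rule nn_integral_SUP_indicator) (auto simp: incseq_def)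
  also have "\<dots> = (\<integral>\<^sup>+x. (indicator {..<0} (- x) * ennreal (2 * ?F x)) * indicator {..- c} (- x) \<partial>lborel)"
    using nn_integral_real_affine[of "\<lambda>x. (indicator {..<0} x * ennreal (2 * ?F (- x))) * indicator {..- c} x" "- 1" 0]
    by simp
  also have "\<dots> = (\<integral>\<^sup>+\<tau>. 2 * (indicator {c..} \<tau> * (indicator {0<..} \<tau> * ennreal (?F \<tau>))) \<partial>lborel)"
  proof (rule nn_integral_cong)
    fix \<tau> :: real
    have "ennreal (2 * ?F \<tau>) = 2 * ennreal (?F \<tau>)"
      using ennreal_mult'[of 2 "?F \<tau>"] by simp
    then show "(indicator {..<0} (- \<tau>) * ennreal (2 * ?F \<tau>)) * indicator {..- c} (- \<tau>)
       = 2 * (indicator {c..} \<tau> * (indicator {0<..} \<tau> * ennreal (?F \<tau>)))"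
      by (simp only:) (simp add: indicator_def)
  qed
  also have "\<dots> = 2 * (\<integral>\<^sup>+\<tau>. indicator {c..} \<tau> * (indicator {0<..} \<tau> * ennreal (?F \<tau>)) \<partial>lborel)"
    by (rule nn_integral_cmult) measurable
  finally show ?thesis ..
qed

lemma nn_integral_power_Ioc:
  assumes "C \<ge> 0" "x \<ge> 0" "d \<ge> 1"
  shows "(\<integral>\<^sup>+a. indicator {0<..} a * (indicator {..x} a * ennreal (C * a ^ (d - 1))) \<partial>lborel) = ennreal (C * x ^ d / d)"
proof -
  have "(\<integral>\<^sup>+a. indicator {0<..} a * (indicator {..x} a * ennreal (C * a ^ (d - 1))) \<partial>lborel)
    = (\<integral>\<^sup>+a. ennreal (C * a ^ (d - 1)) * indicator {0..x} a \<partial>lborel)"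
    by (intro nn_integral_cong_AE eventually_mono[OF AE_lborel_singleton[of 0]]) (auto simp: indicator_def)
  also have "\<dots> = ennreal (C * x ^ d / d - C * 0 ^ d / d)"
    using assms by (intro nn_integral_FTC_Icc) (auto intro!: derivative_eq_intros)
  finally show ?thesis using assms by (simp add: zero_power)
qed

text \<open>The substitution \<open>b = a * \<tau>\<close> introduces the tangent
  \<open>\<tau>\<close> of the angle between the vector and \<open>V\<close>. The distance becomes
  \<open>r * sqrt (1 + \<tau>\<^sup>2)\<close>, free of \<open>a\<close>, and the ball condition
  becomes \<open>a \<le> 1 / sqrt (1 + \<tau>\<^sup>2)\<close>. Integrating out \<open>a\<close>
  produces both the exponent and the divisor \<open>p + s\<close>.\<close>

lemma radial_kernel_eq:
  assumes ps: "p \<ge> 1" "s \<ge> 1" and [measurable]: "g \<in> borel_measurable borel"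
  shows "radial_kernel p s g r = (\<integral>\<^sup>+\<tau>. indicator {0<..} \<tau> *
      ennreal (real p * kappa p * (real s * kappa s) / real (p + s) * \<tau> ^ (s - 1) * (1 / sqrt (1 + \<tau>\<^sup>2)) ^ (p + s))
      * g (r * sqrt (1 + \<tau>\<^sup>2)) \<partial>lborel)"
proof -
  define C where "C = real p * kappa p * (real s * kappa s)"
  have C: "C \<ge> 0" unfolding C_def using kappa_pos[of p] kappa_pos[of s] by simp
  define \<rho> where "\<rho> \<tau> = sqrt (1 + \<tau>\<^sup>2)" for \<tau> :: real
  have \<rho>: "\<rho> \<tau> > 0" for \<tau> by (simp add: \<rho>_def add_pos_nonneg)
  have [measurable]: "\<rho> \<in> borel_measurable borel" unfolding \<rho>_def[abs_def] by measurable
  define h where "h a \<tau> = indicator {0<..} a * (indicator {..1 / \<rho> \<tau>} a * ennreal (C * a ^ (p + s - 1)))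
      * (indicator {0<..} \<tau> * ennreal (\<tau> ^ (s - 1)) * g (r * \<rho> \<tau>))" for a \<tau> :: real
  \<comment> \<open>In this form the indicator of a set depending on \<open>\<tau>\<close> is a
    fixed indicator applied to a measurable function of \<open>a\<close> and \<open>\<tau>\<close>,
    hence jointly measurable.\<close>
  have ind: "indicator {..1 / \<rho> \<tau>} a = (indicator {..1} (a * \<rho> \<tau>) :: ennreal)" for a \<tau> :: real
    using \<rho>[of \<tau>] by (simp add: indicator_def pos_le_divide_eq)
  have hm[measurable]: "case_prod h \<in> borel_measurable (lborel \<Otimes>\<^sub>M lborel)"
    unfolding h_def[abs_def] ind by measurable
  have "radial_kernel p s g r = (\<integral>\<^sup>+a. (\<integral>\<^sup>+\<tau>. h a \<tau> \<partial>lborel) \<partial>lborel)"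
    unfolding radial_kernel_def
  proof (rule nn_integral_cong)
    fix a :: real
    define f where "f b = radial_weight s b * (indicator {..1} (sqrt (a\<^sup>2 + b\<^sup>2)) * g (r * sqrt (a\<^sup>2 + b\<^sup>2) / a))" for b
    have [measurable]: "f \<in> borel_measurable borel" unfolding f_def[abs_def] by measurable
    have "radial_weight p a * (\<integral>\<^sup>+b. f b \<partial>lborel) = (\<integral>\<^sup>+\<tau>. h a \<tau> \<partial>lborel)"
    proof (cases "a > 0")
      case False then show ?thesis by (simp add: radial_weight_def h_def)
    next
      case a: True
      have "(\<integral>\<^sup>+b. f b \<partial>lborel) = ennreal a * (\<integral>\<^sup>+\<tau>. f (a * \<tau>) \<partial>lborel)"
        using nn_integral_real_affine[of f a 0] a by simp
      then have "radial_weight p a * (\<integral>\<^sup>+b. f b \<partial>lborel) = (\<integral>\<^sup>+\<tau>. radial_weight p a * ennreal a * f (a * \<tau>) \<partial>lborel)"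
        by (subst nn_integral_cmult) (auto simp: mult.assoc)
      also have "\<dots> = (\<integral>\<^sup>+\<tau>. h a \<tau> \<partial>lborel)"
      proof (rule nn_integral_cong)
        fix \<tau> :: real
        have sq: "sqrt (a\<^sup>2 + (a * \<tau>)\<^sup>2) = a * \<rho> \<tau>"
        proof -
          have "a\<^sup>2 + (a * \<tau>)\<^sup>2 = a\<^sup>2 * (1 + \<tau>\<^sup>2)" by (simp add: power_mult_distrib algebra_simps)
          then show ?thesis using a by (simp add: real_sqrt_mult \<rho>_def)
        qed
        show "radial_weight p a * ennreal a * f (a * \<tau>) = h a \<tau>"
        proof (cases "\<tau> > 0")
          case False then show ?thesis using a by (simp add: radial_weight_def h_def f_def zero_less_mult_iff)
        next
          case \<tau>: True
          \<comment> \<open>The factor \<open>a\<close> in the middle is the Jacobian of the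
            substitution.\<close>
          have aps: "a ^ (p - 1) * a * a ^ (s - 1) = a ^ (p + s - 1)"
          proof -
            have "p + s - 1 = (p - 1) + 1 + (s - 1)" using ps by simp
            then show ?thesis by (simp only: power_add power_one_right)
          qed
          have "radial_weight p a * ennreal a * radial_weight s (a * \<tau>)
             = ennreal (real p * kappa p * a ^ (p - 1)) * ennreal a * ennreal (real s * kappa s * (a * \<tau>) ^ (s - 1))"
            using a \<tau> by (simp add: radial_weight_def)
          also have "\<dots> = ennreal (real p * kappa p * a ^ (p - 1) * a * (real s * kappa s * (a * \<tau>) ^ (s - 1)))"
            using a \<tau> kappa_pos[of p] kappa_pos[of s]
            by (subst ennreal_mult[symmetric], simp, simp)+ (rule refl)
          also have "real p * kappa p * a ^ (p - 1) * a * (real s * kappa s * (a * \<tau>) ^ (s - 1)) = C * a ^ (p + s - 1) * \<tau> ^ (s - 1)"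
            unfolding aps[symmetric] C_def by (simp add: power_mult_distrib)
          also have "ennreal \<dots> = ennreal (C * a ^ (p + s - 1)) * ennreal (\<tau> ^ (s - 1))"
            using C a \<tau> by (intro ennreal_mult) auto
          finally have w: "radial_weight p a * ennreal a * radial_weight s (a * \<tau>) = ennreal (C * a ^ (p + s - 1)) * ennreal (\<tau> ^ (s - 1))" .
          have ga: "g (r * (a * \<rho> \<tau>) / a) = g (r * \<rho> \<tau>)"
            using a by simp
          have "radial_weight p a * ennreal a * f (a * \<tau>)
            = (radial_weight p a * ennreal a * radial_weight s (a * \<tau>)) * (indicator {..1 / \<rho> \<tau>} a * g (r * \<rho> \<tau>))"
            unfolding f_def sq ind ga by (simp only: mult_ac)
          also have "\<dots> = h a \<tau>"
            unfolding w h_def using a \<tau> by (simp add: mult_ac)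
          finally show ?thesis .
        qed
      qed
      finally show ?thesis .
    qed
    then show "radial_weight p a * (\<integral>\<^sup>+b. radial_weight s b * (indicator {..1} (sqrt (a\<^sup>2 + b\<^sup>2)) * g (r * sqrt (a\<^sup>2 + b\<^sup>2) / a)) \<partial>lborel)
        = (\<integral>\<^sup>+\<tau>. h a \<tau> \<partial>lborel)"
      unfolding f_def .
  qed
  also have "\<dots> = (\<integral>\<^sup>+\<tau>. (\<integral>\<^sup>+a. h a \<tau> \<partial>lborel) \<partial>lborel)"
    by (rule lborel_pair.Fubini'[symmetric]) measurable
  also have "\<dots> = (\<integral>\<^sup>+\<tau>. indicator {0<..} \<tau> * ennreal (C / real (p + s) * \<tau> ^ (s - 1) * (1 / \<rho> \<tau>) ^ (p + s))
      * g (r * \<rho> \<tau>) \<partial>lborel)"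
  proof (rule nn_integral_cong)
    fix \<tau> :: real
    define G where "G = indicator {0<..} \<tau> * ennreal (\<tau> ^ (s - 1)) * g (r * \<rho> \<tau>)"
    have "(\<integral>\<^sup>+a. h a \<tau> \<partial>lborel) = ennreal (C * (1 / \<rho> \<tau>) ^ (p + s) / real (p + s)) * G"
      unfolding h_def G_def[symmetric] using C ps \<rho>[of \<tau>]
      by (subst nn_integral_multc, simp, subst nn_integral_power_Ioc[of C "1 / \<rho> \<tau>" "p + s"]) simp_all
    also have "\<dots> = indicator {0<..} \<tau> * ennreal (C / real (p + s) * \<tau> ^ (s - 1) * (1 / \<rho> \<tau>) ^ (p + s)) * g (r * \<rho> \<tau>)"
    proof (cases "\<tau> > 0")
      case True
      have "C / real (p + s) * \<tau> ^ (s - 1) * (1 / \<rho> \<tau>) ^ (p + s) = (C * (1 / \<rho> \<tau>) ^ (p + s) / real (p + s)) * \<tau> ^ (s - 1)"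
        by simp
      also have "ennreal \<dots> = ennreal (C * (1 / \<rho> \<tau>) ^ (p + s) / real (p + s)) * ennreal (\<tau> ^ (s - 1))"
        using C True \<rho>[of \<tau>] by (intro ennreal_mult) auto
      finally show ?thesis using True by (simp only: G_def mult_ac)
    qed (simp add: G_def)
    finally show "(\<integral>\<^sup>+a. h a \<tau> \<partial>lborel) = indicator {0<..} \<tau> * ennreal (C / real (p + s) * \<tau> ^ (s - 1) * (1 / \<rho> \<tau>) ^ (p + s)) * g (r * \<rho> \<tau>)" .
  qed
  finally show ?thesis by (simp only: C_def \<rho>_def)
qed

text \<open>The origin of the constant on \<open>[0, 1]\<close> in \<open>f_dens\<close>: half a
  complete Beta integral, in which all powers of \<open>pi\<close> cancel.\<close>

lemma half_Beta_eq_omega: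
  assumes "a > 0" "b > 0"
  shows "Beta (real a / 2) (real b / 2) / 2 = omega (a + b) / (omega a * omega b)"
proof -
  have G: "Gamma (real a / 2) > 0" "Gamma (real b / 2) > 0" "Gamma (real (a + b) / 2) > 0"
    using assms by (auto intro!: Gamma_real_pos)
  have "pi powr (real (a + b) / 2) = pi powr (real a / 2) * pi powr (real b / 2)"
    by (simp add: powr_add[symmetric] add_divide_distrib)
  moreover have "real a / 2 + real b / 2 = real (a + b) / 2" by (simp add: add_divide_distrib)
  ultimately show ?thesis
    using G unfolding Beta_def omega_def by (simp add: divide_simps)
qed

text \<open>The two branches are one formula, since for \<open>\<delta> \<le> 1\<close> the
  incomplete Beta integral is complete. The maximum reflects the lower limit of the integral over
  the tangent.\<close>

lemma f_dens_eq:
  assumes q: "q < n" "\<gamma> < q" and \<delta>: "\<delta> > 0"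
  shows "f_dens n q \<gamma> \<delta> = real (q - \<gamma>) * (omega (\<gamma> + 1) * omega (n - q) / omega (n - (q - \<gamma>) + 1)) * \<delta> ^ (q - \<gamma> - 1)
    * (incomplete_beta (1 / (max 1 \<delta>)\<^sup>2) (real (q + 1) / 2) (real (n - q) / 2) / 2)"
proof (cases "\<delta> \<le> 1")
  case True
  have "incomplete_beta 1 (real (q + 1) / 2) (real (n - q) / 2) / 2 = omega (n + 1) / (omega (q + 1) * omega (n - q))"
    using q half_Beta_eq_omega[of "q + 1" "n - q"]
    by (subst beta_integrand_nn_integral(3)[where x=1]) simp_all
  moreover have "max 1 \<delta> = 1" using True by simp
  moreover have "f_dens n q \<gamma> \<delta> = real (q - \<gamma>) * (omega (\<gamma> + 1) * omega (n - q) / omega (n - (q - \<gamma>) + 1))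
      * (omega (n + 1) / (omega (q + 1) * omega (n - q)) * \<delta> ^ (q - \<gamma> - 1))"
    using True \<delta> by (simp add: f_dens_def)
  ultimately show ?thesis by (simp only: power_one div_by_1 mult_ac)
next
  case False
  have "\<delta> powr (- 2) = 1 / \<delta>\<^sup>2" using \<delta> by (simp add: powr_minus_divide)
  then show ?thesis using False by (simp add: f_dens_def max_def)
qed

text \<open>The variable upper limit is moved into an indicator, which gives a parameter integral
  with jointly measurable integrand. Nonnegativity of the limit excludes the sign change of an
  interval integral with reversed limits.\<close>

lemma incomplete_beta_measurable:
  assumes [measurable]: "u \<in> borel_measurable M" and u: "\<And>x. x \<in> space M \<Longrightarrow> u x \<ge> 0"
  shows "(\<lambda>x. incomplete_beta (u x) a b) \<in> borel_measurable M"
proof -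
  have "(\<lambda>x. LBINT t. indicator {0<..} t * indicator {0<..} (u x - t) * (t powr (a - 1) * (1 - t) powr (b - 1))) \<in> borel_measurable M"
    by measurable
  also have "?this \<longleftrightarrow> ?thesis"
  proof (rule measurable_cong)
    fix x assume "x \<in> space M"
    then have "einterval 0 (ereal (u x)) = {0<..<u x}" "0 \<le> u x" using u by (auto simp: einterval_def)
    then show "(LBINT t. indicator {0<..} t * indicator {0<..} (u x - t) * (t powr (a - 1) * (1 - t) powr (b - 1))) = incomplete_beta (u x) a b"
      unfolding incomplete_beta_def interval_lebesgue_integral_def set_lebesgue_integral_def
      by (auto intro!: Bochner_Integration.integral_cong simp: indicator_def)
  qed
  finally show ?thesis .
qed

lemma f_dens_measurable[measurable]: "f_dens n q \<gamma> \<in> borel_measurable borel"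
proof -
  have [measurable]: "(\<lambda>\<delta>. incomplete_beta (\<delta> powr - 2) (real (q + 1) / 2) (real (n - q) / 2)) \<in> borel_measurable borel"
    by (rule incomplete_beta_measurable) simp_all
  show ?thesis unfolding f_dens_def[abs_def] by measurable
qed

text \<open>For positive \<open>\<tau>\<close>, the condition
  \<open>\<delta> \<le> sqrt (1 + \<tau>\<^sup>2)\<close> is a lower bound \<open>c\<close> on
  \<open>\<tau>\<close> with \<open>1 + c\<^sup>2 = (max 1 \<delta>)\<^sup>2\<close>; for
  \<open>\<delta> \<le> 1\<close> it is void and \<open>c = 0\<close>. The substitution for the Beta
  integral then applies from \<open>c\<close> on.\<close>

lemma nn_integral_radial_tail:
  assumes \<delta>: "\<delta> > 0" and s: "s \<ge> 1"
  shows "(\<integral>\<^sup>+\<tau>. indicator {..sqrt (1 + \<tau>\<^sup>2)} \<delta> * (indicator {0<..} \<tau> * ennreal (\<tau> ^ (s - 1) * (1 / sqrt (1 + \<tau>\<^sup>2)) ^ (l + s + 1))) \<partial>lborel)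
    = ennreal (incomplete_beta (1 / (max 1 \<delta>)\<^sup>2) (real (l + 1) / 2) (real s / 2) / 2)"
proof -
  define c where "c = sqrt ((max 1 \<delta>)\<^sup>2 - 1)"
  have m1: "(max 1 \<delta>)\<^sup>2 \<ge> 1" by (simp add: one_le_power)
  then have c: "c \<ge> 0" "1 + c\<^sup>2 = (max 1 \<delta>)\<^sup>2" by (simp_all add: c_def)
  have ind: "indicator {..sqrt (1 + \<tau>\<^sup>2)} \<delta> = (indicator {c..} \<tau> :: ennreal)" if \<tau>: "\<tau> > 0" for \<tau>
  proof -
    have "c \<le> \<tau> \<longleftrightarrow> c\<^sup>2 \<le> \<tau>\<^sup>2" using c \<tau> by (simp add: abs_le_square_iff[symmetric])
    also have "\<dots> \<longleftrightarrow> (max 1 \<delta>)\<^sup>2 \<le> 1 + \<tau>\<^sup>2" using c(2) by auto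
    also have "\<dots> \<longleftrightarrow> max 1 \<delta> \<le> sqrt (1 + \<tau>\<^sup>2)" using real_sqrt_le_iff[of "(max 1 \<delta>)\<^sup>2" "1 + \<tau>\<^sup>2"] by simp
    also have "\<dots> \<longleftrightarrow> \<delta> \<le> sqrt (1 + \<tau>\<^sup>2)" by simp
    finally show ?thesis by (simp add: indicator_def)
  qed
  define J where "J = (\<integral>\<^sup>+\<tau>. indicator {c..} \<tau> * (indicator {0<..} \<tau> * ennreal (\<tau> ^ (s - 1) * (1 / sqrt (1 + \<tau>\<^sup>2)) ^ (l + s + 1))) \<partial>lborel)"
  define I where "I = incomplete_beta (1 / (max 1 \<delta>)\<^sup>2) (real (l + 1) / 2) (real s / 2)"
  have x: "0 < 1 / (max 1 \<delta>)\<^sup>2" "1 / (max 1 \<delta>)\<^sup>2 \<le> 1" using m1 by (auto simp: divide_le_eq)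
  have ab: "0 < real (l + 1) / 2" "0 < real s / 2" using s by auto
  have "2 * J = ennreal I"
    unfolding J_def I_def nn_integral_beta_substitution[OF c(1) s, of l] c(2)
    using beta_integrand_nn_integral(1)[OF ab x] by simp
  also have "\<dots> = 2 * ennreal (I / 2)"
    using ennreal_mult'[of 2 "I / 2"] by simp
  finally have "J = ennreal (I / 2)"
    by (simp add: ennreal_mult_cancel_left)
  moreover have "(\<integral>\<^sup>+\<tau>. indicator {..sqrt (1 + \<tau>\<^sup>2)} \<delta> * (indicator {0<..} \<tau> * ennreal (\<tau> ^ (s - 1) * (1 / sqrt (1 + \<tau>\<^sup>2)) ^ (l + s + 1))) \<partial>lborel) = J"
    unfolding J_def
  proof (rule nn_integral_cong)
    fix \<tau> :: real
    show "indicator {..sqrt (1 + \<tau>\<^sup>2)} \<delta> * (indicator {0<..} \<tau> * ennreal (\<tau> ^ (s - 1) * (1 / sqrt (1 + \<tau>\<^sup>2)) ^ (l + s + 1)))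
      = indicator {c..} \<tau> * (indicator {0<..} \<tau> * ennreal (\<tau> ^ (s - 1) * (1 / sqrt (1 + \<tau>\<^sup>2)) ^ (l + s + 1)))"
      using ind[of \<tau>] by (cases "\<tau> > 0") simp_all
  qed
  ultimately show ?thesis by (simp only: I_def)
qed

text \<open>At fixed \<open>\<tau>\<close> the variable \<open>r\<close> is replaced by the distance
  \<open>\<delta> = r * \<rho> \<tau>\<close>, so that \<open>r \<le> 1\<close> turns into
  \<open>\<delta> \<le> \<rho> \<tau>\<close>. After exchanging the order, \<open>g \<delta>\<close>
  stands outside and the integral over \<open>\<tau>\<close> is an incomplete Beta integral.\<close>

lemma nn_integral_radial_kernel:
  assumes q: "q < n" "\<gamma> < q" and [measurable]: "g \<in> borel_measurable borel"
  shows "(\<integral>\<^sup>+r. radial_weight (q - \<gamma>) r * (indicator {..1} r * radial_kernel (\<gamma> + 1) (n - q) g r) \<partial>lborel)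
    = ennreal (kappa (q - \<gamma>)) * ennreal (kappa (n - (q - \<gamma>) + 1)) * (\<integral>\<^sup>+\<delta>. ennreal (f_dens n q \<gamma> \<delta>) * g \<delta> \<partial>lborel)"
proof -
  define m p s d where "m = q - \<gamma>" and "p = \<gamma> + 1" and "s = n - q" and "d = n - (q - \<gamma>) + 1"
  have dims: "m \<ge> 1" "p \<ge> 1" "s \<ge> 1" "p + s = d" "d + m = q + s + 1" "d > 0" "s > 0" "p > 0"
    using q by (auto simp: m_def p_def s_def d_def)
  define K where "K = real p * kappa p * (real s * kappa s) / real (p + s)"
  have K: "K \<ge> 0" unfolding K_def using kappa_pos[of p] kappa_pos[of s] by simp
  have dm: "n - m + 1 = d" by (simp add: m_def d_def)
  \<comment> \<open>Since \<open>omega\<close> is \<open>kappa\<close> times the dimension, the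
    divisor \<open>p + s = d\<close> of the kernel becomes \<open>omega d / kappa d\<close>. This is
    the origin of the quotient of sphere areas in \<open>f_dens\<close>.\<close>
  have K_omega: "K = omega p * omega s / omega d * kappa d"
    using dims kappa_pos[of d] unfolding K_def by (simp add: omega_eq_kappa)
  define \<rho> where "\<rho> \<tau> = sqrt (1 + \<tau>\<^sup>2)" for \<tau> :: real
  have \<rho>: "\<rho> \<tau> > 0" for \<tau> by (simp add: \<rho>_def add_pos_nonneg)
  have [measurable]: "\<rho> \<in> borel_measurable borel" unfolding \<rho>_def[abs_def] by measurable
  define w where "w \<tau> = indicator {0<..} \<tau> * ennreal (K * \<tau> ^ (s - 1) * (1 / \<rho> \<tau>) ^ d)" for \<tau> :: real
  have [measurable]: "w \<in> borel_measurable borel" unfolding w_def[abs_def] by measurable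
  define v where "v \<tau> = indicator {0<..} \<tau> * ennreal (\<tau> ^ (s - 1) * (1 / \<rho> \<tau>) ^ (q + s + 1))" for \<tau> :: real
  have [measurable]: "v \<in> borel_measurable borel" unfolding v_def[abs_def] by measurable
  define h where "h \<tau> \<delta> = indicator {0<..} \<delta> * ennreal (K * (real m * kappa m) * \<delta> ^ (m - 1)) * g \<delta> * (indicator {..\<rho> \<tau>} \<delta> * v \<tau>)" for \<tau> \<delta> :: real
  have ind: "indicator {..\<rho> \<tau>} \<delta> = (indicator {..0} (\<delta> - \<rho> \<tau>) :: ennreal)" for \<tau> \<delta>
    by (simp add: indicator_def)
  have [measurable]: "case_prod h \<in> borel_measurable (lborel \<Otimes>\<^sub>M lborel)"
    unfolding h_def[abs_def] ind by measurable
  have "(\<integral>\<^sup>+r. radial_weight m r * (indicator {..1} r * radial_kernel p s g r) \<partial>lborel)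
    = (\<integral>\<^sup>+r. (\<integral>\<^sup>+\<tau>. radial_weight m r * indicator {..1} r * (w \<tau> * g (r * \<rho> \<tau>)) \<partial>lborel) \<partial>lborel)"
    unfolding radial_kernel_eq[OF dims(2,3) assms(3)] K_def[symmetric]
    unfolding \<rho>_def[symmetric] dims(4) w_def[symmetric]
    by (subst nn_integral_cmult) (simp_all add: mult.assoc)
  also have "\<dots> = (\<integral>\<^sup>+\<tau>. (\<integral>\<^sup>+r. radial_weight m r * indicator {..1} r * (w \<tau> * g (r * \<rho> \<tau>)) \<partial>lborel) \<partial>lborel)"
    by (rule lborel_pair.Fubini'[symmetric]) measurable
  also have "\<dots> = (\<integral>\<^sup>+\<tau>. (\<integral>\<^sup>+\<delta>. h \<tau> \<delta> \<partial>lborel) \<partial>lborel)"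
  proof (rule nn_integral_cong)
    fix \<tau> :: real
    define F where "F r = radial_weight m r * indicator {..1} r * (w \<tau> * g (r * \<rho> \<tau>))" for r
    have [measurable]: "F \<in> borel_measurable borel" unfolding F_def[abs_def] by measurable
    have "(\<integral>\<^sup>+r. F r \<partial>lborel) = ennreal (1 / \<rho> \<tau>) * (\<integral>\<^sup>+\<delta>. F (1 / \<rho> \<tau> * \<delta>) \<partial>lborel)"
      using nn_integral_real_affine[of F "1 / \<rho> \<tau>" 0] \<rho>[of \<tau>] by simp
    also have "\<dots> = (\<integral>\<^sup>+\<delta>. ennreal (1 / \<rho> \<tau>) * F (1 / \<rho> \<tau> * \<delta>) \<partial>lborel)"
      by (rule nn_integral_cmult[symmetric]) measurable
    also have "\<dots> = (\<integral>\<^sup>+\<delta>. h \<tau> \<delta> \<partial>lborel)"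
    proof (rule nn_integral_cong)
      fix \<delta> :: real
      show "ennreal (1 / \<rho> \<tau>) * F (1 / \<rho> \<tau> * \<delta>) = h \<tau> \<delta>"
      proof (cases "\<delta> > 0 \<and> \<tau> > 0 \<and> \<delta> \<le> \<rho> \<tau>")
        case False
        then show ?thesis using \<rho>[of \<tau>]
          by (auto simp: F_def h_def w_def v_def radial_weight_def indicator_def pos_divide_le_eq zero_less_divide_iff)
      next
        case True
        let ?A = "real m * kappa m * (1 / \<rho> \<tau> * \<delta>) ^ (m - 1)" and ?B = "K * \<tau> ^ (s - 1) * (1 / \<rho> \<tau>) ^ d"
        \<comment> \<open>One factor is the Jacobian, \<open>m - 1\<close> come from the polar
          weight in \<open>r\<close> and \<open>d\<close> from the kernel. As
          \<open>d + m = q + s + 1\<close>, the total is the exponent of the tail integral for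
          \<open>l = q\<close>.\<close>
        have pw: "(1 / \<rho> \<tau>) ^ (q + s + 1) = 1 / \<rho> \<tau> * (1 / \<rho> \<tau>) ^ (m - 1) * (1 / \<rho> \<tau>) ^ d"
        proof -
          have "q + s + 1 = 1 + (m - 1) + d" using dims by simp
          then show ?thesis by (simp only: power_add power_one_right)
        qed
        have "ennreal (1 / \<rho> \<tau>) * F (1 / \<rho> \<tau> * \<delta>) = ennreal (1 / \<rho> \<tau>) * (ennreal ?A * ennreal ?B) * g \<delta>"
          using True \<rho>[of \<tau>] by (simp add: F_def w_def radial_weight_def mult_ac)
        also have "ennreal (1 / \<rho> \<tau>) * (ennreal ?A * ennreal ?B) = ennreal (1 / \<rho> \<tau> * (?A * ?B))"
          using True \<rho>[of \<tau>] K kappa_pos[of m] by (subst ennreal_mult[symmetric], simp, simp)+ (rule refl)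
        also have "1 / \<rho> \<tau> * (?A * ?B) = (K * (real m * kappa m) * \<delta> ^ (m - 1)) * (\<tau> ^ (s - 1) * (1 / \<rho> \<tau>) ^ (q + s + 1))"
          unfolding pw power_mult_distrib by (simp only: mult_ac)
        also have "ennreal \<dots> = ennreal (K * (real m * kappa m) * \<delta> ^ (m - 1)) * ennreal (\<tau> ^ (s - 1) * (1 / \<rho> \<tau>) ^ (q + s + 1))"
          using True \<rho>[of \<tau>] K kappa_pos[of m] by (intro ennreal_mult) auto
        finally show ?thesis
          using True by (simp add: h_def v_def mult_ac del: power_divide)
      qed
    qed
    finally show "(\<integral>\<^sup>+r. radial_weight m r * indicator {..1} r * (w \<tau> * g (r * \<rho> \<tau>)) \<partial>lborel) = (\<integral>\<^sup>+\<delta>. h \<tau> \<delta> \<partial>lborel)"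
      unfolding F_def .
  qed
  also have "\<dots> = (\<integral>\<^sup>+\<delta>. (\<integral>\<^sup>+\<tau>. h \<tau> \<delta> \<partial>lborel) \<partial>lborel)"
    by (rule lborel_pair.Fubini'[symmetric]) measurable
  also have "\<dots> = (\<integral>\<^sup>+\<delta>. ennreal (kappa m * kappa d) * (ennreal (f_dens n q \<gamma> \<delta>) * g \<delta>) \<partial>lborel)"
  proof (intro nn_integral_cong_AE eventually_mono[OF AE_lborel_singleton[of 0]])
    fix \<delta> :: real assume "\<delta> \<noteq> 0"
    then consider "\<delta> > 0" | "\<delta> < 0" by linarith
    then show "(\<integral>\<^sup>+\<tau>. h \<tau> \<delta> \<partial>lborel) = ennreal (kappa m * kappa d) * (ennreal (f_dens n q \<gamma> \<delta>) * g \<delta>)"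
    proof cases
      case 2 then show ?thesis by (simp add: h_def f_dens_def)
    next
      case 1
      define B where "B = incomplete_beta (1 / (max 1 \<delta>)\<^sup>2) (real (q + 1) / 2) (real s / 2) / 2"
      have [measurable]: "(\<lambda>\<tau>. indicator {..\<rho> \<tau>} \<delta> * v \<tau>) \<in> borel_measurable borel"
        unfolding ind by measurable
      have "(\<integral>\<^sup>+\<tau>. h \<tau> \<delta> \<partial>lborel) = ennreal (K * (real m * kappa m) * \<delta> ^ (m - 1)) * g \<delta> * (\<integral>\<^sup>+\<tau>. indicator {..\<rho> \<tau>} \<delta> * v \<tau> \<partial>lborel)"
        unfolding h_def using 1 by (subst nn_integral_cmult) simp_all
      also have "(\<integral>\<^sup>+\<tau>. indicator {..\<rho> \<tau>} \<delta> * v \<tau> \<partial>lborel) = ennreal B"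
        unfolding v_def \<rho>_def B_def by (rule nn_integral_radial_tail[OF 1 dims(3)])
      also have "ennreal (K * (real m * kappa m) * \<delta> ^ (m - 1)) * g \<delta> * ennreal B
         = ennreal (K * (real m * kappa m) * \<delta> ^ (m - 1)) * ennreal B * g \<delta>" by (simp only: mult_ac)
      also have "ennreal (K * (real m * kappa m) * \<delta> ^ (m - 1)) * ennreal B = ennreal (K * (real m * kappa m) * \<delta> ^ (m - 1) * B)"
        using 1 K kappa_pos[of m] by (intro ennreal_mult'[symmetric]) simp
      also have "K * (real m * kappa m) * \<delta> ^ (m - 1) * B = kappa m * kappa d * f_dens n q \<gamma> \<delta>"
        unfolding f_dens_eq[OF q 1] unfolding m_def[symmetric] s_def[symmetric] p_def[symmetric] dm B_def[symmetric] K_omega by simp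
      also have "ennreal \<dots> = ennreal (kappa m * kappa d) * ennreal (f_dens n q \<gamma> \<delta>)"
        using kappa_pos[of m] kappa_pos[of d] by (intro ennreal_mult') simp
      finally show ?thesis by (simp only: mult.assoc)
    qed
  qed
  also have "\<dots> = ennreal (kappa m * kappa d) * (\<integral>\<^sup>+\<delta>. ennreal (f_dens n q \<gamma> \<delta>) * g \<delta> \<partial>lborel)"
    using f_dens_measurable by (intro nn_integral_cmult) measurable
  also have "ennreal (kappa m * kappa d) = ennreal (kappa m) * ennreal (kappa d)"
    using kappa_pos[of m] kappa_pos[of d] by (intro ennreal_mult) auto
  finally show ?thesis unfolding m_def p_def s_def d_def .
qed

theorem theorem5p1:
  fixes \<nu>q \<nu>E :: "(real^'n) set measure" and q \<gamma> :: nat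
  assumes "CARD('n) \<ge> 2"
    and "1 \<le> q" and "q \<le> CARD('n) - 1"
    and "\<gamma> < q"
    and "grass_invariant_prob q \<nu>q"
    and "grass_invariant_prob (CARD('n) - q + \<gamma>) \<nu>E"
  shows "distributed
           (\<nu>q \<Otimes>\<^sub>M density (affgrass_measure (CARD('n) - q + \<gamma>) \<nu>E)
                    (\<lambda>E. indicator (hitting_ball (CARD('n) - q + \<gamma>)) E / ennreal (kappa (q - \<gamma>))))
           lborel
           (\<lambda>(L, E). infdist 0 (E \<inter> L))
           (\<lambda>\<delta>. ennreal (f_dens CARD('n) q \<gamma> \<delta>))"
proof -
  let ?n = "CARD('n)" let ?k = "?n - q + \<gamma>" and ?m = "q - \<gamma>"
  let ?M = "\<nu>q \<Otimes>\<^sub>M hitting_distribution ?k ?m \<nu>E" and ?X = "\<lambda>(L, E). infdist 0 (E \<inter> L)"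
  have q: "q < ?n" using assms by simp
  have \<nu>E: "sets \<nu>E = sets (grass_space ?k)" "prob_space \<nu>E"
    and s: "sets \<nu>q = sets (grass_space q)"
    using assms by (simp_all add: grass_invariant_prob_def)
  have X: "?X \<in> borel_measurable ?M"
    by (rule measurable_infdist_Int[OF s]) simp
  then have X': "?X \<in> measurable ?M lborel" by simp
  \<comment> \<open>Both measures are compared on each Borel set, with its indicator as the test
    function \<open>g\<close>. The two integral formulas share the constant \<open>?c\<close>, which
    is finite and positive and cancels.\<close>
  have "distr ?M lborel ?X = density lborel (\<lambda>\<delta>. ennreal (f_dens ?n q \<gamma> \<delta>))"
  proof (rule measure_eqI)
    fix A assume "A \<in> sets (distr ?M lborel ?X)"
    then have A[measurable]: "A \<in> sets borel" by simp
    let ?c = "ennreal (kappa ?m) * ennreal (kappa (?k + 1))"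
    have k1: "?n - ?m + 1 = ?k + 1" using q assms(4) by simp
    have "emeasure (distr ?M lborel ?X) A = (\<integral>\<^sup>+x. indicator A x \<partial>distr ?M lborel ?X)"
      by (rule nn_integral_indicator[symmetric]) simp
    also have "\<dots> = (\<integral>\<^sup>+x. indicator A (?X x) \<partial>?M)"
      by (rule nn_integral_distr[OF X']) simp
    finally have "emeasure (distr ?M lborel ?X) A * ?c = (\<integral>\<^sup>+x. indicator A (?X x) \<partial>?M) * ?c" by (rule arg_cong)
    also have "\<dots> = (\<integral>\<^sup>+r. radial_weight ?m r * (indicator {..1} r * radial_kernel (\<gamma> + 1) (?n - q) (indicator A) r) \<partial>lborel)"
      by (rule nn_integral_distance[OF assms(1) q assms(4,5) \<nu>E refl refl]) simp
    also have "\<dots> = ?c * (\<integral>\<^sup>+\<delta>. ennreal (f_dens ?n q \<gamma> \<delta>) * indicator A \<delta> \<partial>lborel)"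
      using nn_integral_radial_kernel[OF q assms(4), of "indicator A"] A unfolding k1 by simp
    also have "(\<integral>\<^sup>+\<delta>. ennreal (f_dens ?n q \<gamma> \<delta>) * indicator A \<delta> \<partial>lborel)
        = emeasure (density lborel (\<lambda>\<delta>. ennreal (f_dens ?n q \<gamma> \<delta>))) A"
      by (rule emeasure_density[symmetric]) simp_all
    finally have "?c * emeasure (distr ?M lborel ?X) A = ?c * emeasure (density lborel (\<lambda>\<delta>. ennreal (f_dens ?n q \<gamma> \<delta>))) A"
      by (simp only: mult.commute)
    moreover have "?c \<noteq> 0" "?c \<noteq> \<top>"
      using kappa_pos[of ?m] kappa_pos[of "?k + 1"] by (simp_all add: ennreal_mult_eq_top_iff)
    ultimately show "emeasure (distr ?M lborel ?X) A = emeasure (density lborel (\<lambda>\<delta>. ennreal (f_dens ?n q \<gamma> \<delta>))) A"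
      unfolding ennreal_mult_cancel_left by blast
  qed simp
  then show ?thesis
    using X' unfolding distributed_def hitting_distribution_def by simp
qed

end
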